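(* Let $X,Y$ be Banach spaces and let $T$ be a singular integral operator, bounded from $L^{p_0}(\mathbb{R}_-;X)$ into $L^{p_0}(\mathbb{R}_-;Y)$ for some $p_0\in(1,\infty)$, associated with a kernel $K$ supported on $\{(t,s)\in\mathbb{R}_-\times\mathbb{R}_-: t<s\}$. Assume that $[K]_{D_{1,-}}<\infty$ and $[K]_{D'_{r,-}}<\infty$ for some $r\in(1,\infty)$. Then, for every $p\in(0,\infty)$ and every weight $w\in A^+_\infty(\mathbb{R}_-)$, there exists a constant $C=C(p,w,T,[K]_{D_{1,-}},[K]_{D'_{r,-}})$ such that $$\int_{\mathbb{R}_-}|Tf|_Y^p\,w\,dt\le C\int_{\mathbb{R}_-}\big(M^+_-(|f|_X^{r'})\big)^{p/r'}w\,dt$$ for every $f\in L^\infty_c(\mathbb{R}_-;X)$ with $M^+_-(|Tf|_Y)\in L^p_w(\mathbb{R}_-)$. Furthermore, if $p\in(1,\infty)$ and $\mathcal{F}\subseteq A_p^+(\mathbb{R}_-)$ satisfies $\sup_{w\in\mathcal{F}}[w]_{A_p^+(\mathbb{R}_-)}<\infty$, then the constants can be chosen such that $\sup_{w\in\mathcal{F}}C(p,w,T,[K]_{D_{1,-}},[K]_{D'_{r,-}})<\infty$.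
   Context: $\mathbb{R}_-=(-\infty,0]$; $|\cdot|_X,|\cdot|_Y$ are the norms of $X,Y$; $r'=r/(r-1)$. Singular integral operators. A kernel is a measurable function $K:\mathbb{R}_-\times\mathbb{R}_-\to\mathcal{L}(X,Y)$ with $K(t,\cdot)\in L^1_{loc}(\mathbb{R}_-\setminus\{t\};\mathcal{L}(X,Y))$ for every $t$. $L_c^\infty(\mathbb{R}_-;X)$ is the space of essentially bounded measurable $X$-valued functions with compact support in $\mathbb{R}_-$. A bounded linear operator $T:L^{p_0}(\mathbb{R}_-;X)\to L^{p_0}(\mathbb{R}_-;Y)$ is a singular integral operator associated with $K$ if $Tf(t)=\int_{\mathbb{R}_-}K(t,s)f(s)\,ds$ for every $f\in L_c^\infty(\mathbb{R}_-;X)$ and every $t\in\mathbb{R}_-\setminus\operatorname{supp}f$. Kernel conditions. For $r\in[1,\infty)$ (with $\frac1{r'}=0$ if $r=1$), $$[K]_{D_{r,-}}:=\sup_{s<0,h>0}h^{1/r'}\sum_{m=1}^\infty2^{m/r'}\Big(\int_{I_m(s,h)}|K(t,s)-K(t,s-h)|^r_{\mathcal{L}(X,Y)}dt\Big)^{1/r},$$ $$[K]_{D'_{r,-}}:=\sup_{t<0,h>0}h^{1/r'}\sum_{m=1}^\infty2^{m/r'}\Big(\int_{J_m(t,h)}|K(t,s)-K(t+h,s)|^r_{\mathcal{L}(X,Y)}ds\Big)^{1/r},$$ where $I_m(s,h)=\{t\in\mathbb{R}_-:2^mh<s-t\le2^{m+1}h\}$, $J_m(t,h)=\{s\in\mathbb{R}_-:2^mh<s-t\le2^{m+1}h\}$.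 Maximal operator. For $g$ on $\mathbb{R}_-$ (extended by $0$ to $\mathbb{R}$) and $t\in\mathbb{R}_-$, $M^+_-g(t)=\sup_{h>0}\frac1h\int_t^{t+h}|g|\,ds$. Weights. A weight on $\mathbb{R}_-$ is a measurable $w:\mathbb{R}_-\to[0,\infty)$ with $w>0$ a.e.; $w(A)=\int_Aw\,dt$; $L^p_w(\mathbb{R}_-)$ is the $L^p$-space for the measure $w\,dt$. $w\in A_\infty^+(\mathbb{R}_-)$ if there are $C,\delta>0$ such that $\frac{|S|}{c-a}\le C\big(\frac{w(S)}{w(a,b)}\big)^\delta$ for every $a<b<c\le0$ and every measurable $S\subseteq[b,c]$. For $p\in(1,\infty)$, $w\in A_p^+(\mathbb{R}_-)$ if $[w]_{A_p^+(\mathbb{R}_-)}:=\sup_{a<b<c\le0}\frac1{(c-a)^p}\int_a^bw\,dt\big(\int_b^cw^{1-p'}dt\big)^{p-1}<\infty$, $p'=p/(p-1)$. *)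

theory Defs
  imports "HOL-Analysis.Analysis"
begin

abbreviation Rm :: "real set" where
  "Rm \<equiv> {..0}"

abbreviation lebm :: "real measure" where
  "lebm \<equiv> lebesgue_on Rm"

text \<open>
  Powers of values in the extended half-line, for exponents \<open>a > 0\<close> only
  (so that the powers of \<open>0\<close> and \<open>\<infinity>\<close> are \<open>0\<close> and \<open>\<infinity>\<close>).
\<close>
definition ennpow :: "ennreal \<Rightarrow> real \<Rightarrow> ennreal" where
  "ennpow x a = (if x = \<infinity> then \<infinity> else ennreal (enn2real x powr a))"

text \<open>
  The library integral \<^const>\<open>has_bochner_integral\<close> requires a second countable target space.
  Here the Banach spaces are arbitrary, and spaces of operators are not separable in general.
  Hence Borel measurability is replaced by strong measurability (almost everywhere limits of
  simple functions); the integral is otherwise the one of the library.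
\<close>
definition strongly_measurable :: "'m measure \<Rightarrow> ('m \<Rightarrow> 'b::real_normed_vector) \<Rightarrow> bool" where
  "strongly_measurable M f \<longleftrightarrow>
     (\<exists>u :: nat \<Rightarrow> 'm \<Rightarrow> 'b. (\<forall>i. simple_function M (u i)) \<and> (AE x in M. (\<lambda>i. u i x) \<longlonglongrightarrow> f x))"

definition has_banach_integral :: "'m measure \<Rightarrow> ('m \<Rightarrow> 'b::real_normed_vector) \<Rightarrow> 'b \<Rightarrow> bool" where
  "has_banach_integral M f y \<longleftrightarrow>
     strongly_measurable M f \<and>
     (\<exists>u :: nat \<Rightarrow> 'm \<Rightarrow> 'b. (\<forall>i. Bochner_Integration.simple_bochner_integrable M (u i)) \<and>
        (\<lambda>i. \<integral>\<^sup>+x. ennreal (norm (f x - u i x)) \<partial>M) \<longlonglongrightarrow> 0 \<and>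
        (\<lambda>i. Bochner_Integration.simple_bochner_integral M (u i)) \<longlonglongrightarrow> y)"

text \<open>
  Elements of the Lebesgue spaces are represented by functions on the reals, of which only the
  values on \<^term>\<open>Rm\<close>, up to null sets, are relevant.
\<close>
definition Lp_norm :: "real \<Rightarrow> (real \<Rightarrow> 'b::real_normed_vector) \<Rightarrow> ennreal" where
  "Lp_norm p f = ennpow (\<integral>\<^sup>+t. ennreal (norm (f t) powr p) \<partial>lebm) (1 / p)"

definition Lp :: "real \<Rightarrow> (real \<Rightarrow> 'b::real_normed_vector) set" where
  "Lp p = {f. strongly_measurable lebm f \<and> Lp_norm p f < \<infinity>}"

definition ess_supp :: "(real \<Rightarrow> 'b::zero) \<Rightarrow> real set" where
  "ess_supp f = {t \<in> Rm. \<forall>e>0. \<not> (AE s in lebm. \<bar>s - t\<bar> < e \<longrightarrow> f s = 0)}"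

definition Linf_c :: "(real \<Rightarrow> 'b::real_normed_vector) set" where
  "Linf_c = {f. strongly_measurable lebm f \<and> (\<exists>B. AE t in lebm. norm (f t) \<le> B) \<and>
                compact (ess_supp f)}"

text \<open>
  Linearity is required almost everywhere.  Together with boundedness it implies that \<open>T\<close> maps
  functions that agree almost everywhere to functions that agree almost everywhere, so \<open>T\<close>
  descends to equivalence classes.
\<close>
definition bounded_linear_Lp ::
  "real \<Rightarrow> ((real \<Rightarrow> 'x::real_normed_vector) \<Rightarrow> (real \<Rightarrow> 'y::real_normed_vector)) \<Rightarrow> bool" where
  "bounded_linear_Lp p T \<longleftrightarrow>
     (\<forall>f\<in>Lp p. T f \<in> Lp p) \<and>
     (\<forall>f\<in>Lp p. \<forall>g\<in>Lp p. AE t in lebm. T (\<lambda>s. f s + g s) t = T f t + T g t) \<and>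
     (\<forall>c. \<forall>f\<in>Lp p. AE t in lebm. T (\<lambda>s. c *\<^sub>R f s) t = c *\<^sub>R T f t) \<and>
     (\<exists>B\<ge>0. \<forall>f\<in>Lp p. Lp_norm p (T f) \<le> ennreal B * Lp_norm p f)"

text \<open>
  Strong measurability of the sections in the first variable is what gives a meaning to the
  integrals in \<open>D_const\<close> for each fixed \<open>s\<close>; it does not follow from joint measurability
  with respect to the completed product measure.
\<close>
definition is_kernel ::
  "(real \<Rightarrow> real \<Rightarrow> ('x::real_normed_vector \<Rightarrow>\<^sub>L 'y::real_normed_vector)) \<Rightarrow> bool" where
  "is_kernel K \<longleftrightarrow>
     strongly_measurable (lebesgue_on (Rm \<times> Rm)) (\<lambda>(t, s). K t s) \<and>
     (\<forall>s\<in>Rm. strongly_measurable lebm (\<lambda>t. K t s)) \<and>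
     (\<forall>t\<in>Rm. strongly_measurable lebm (K t) \<and>
        (\<forall>A. compact A \<and> A \<subseteq> Rm - {t} \<longrightarrow> (\<integral>\<^sup>+s\<in>A. ennreal (norm (K t s)) \<partial>lebesgue) < \<infinity>))"

text \<open>
  Since \<^term>\<open>T f\<close> is an equivalence class, the pointwise formula is required of one of its
  representatives \<open>g\<close>.
\<close>
definition singular_integral_operator ::
  "real \<Rightarrow> ((real \<Rightarrow> 'x::banach) \<Rightarrow> (real \<Rightarrow> 'y::banach))
    \<Rightarrow> (real \<Rightarrow> real \<Rightarrow> ('x \<Rightarrow>\<^sub>L 'y)) \<Rightarrow> bool" where
  "singular_integral_operator p0 T K \<longleftrightarrow>
     is_kernel K \<and> bounded_linear_Lp p0 T \<and>
     (\<forall>f\<in>Linf_c. \<exists>g. (AE t in lebm. g t = T f t) \<and>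
        (\<forall>t\<in>Rm - ess_supp f. has_banach_integral lebm (\<lambda>s. blinfun_apply (K t s) (f s)) (g t)))"

text \<open>
  In the two kernel constants \<open>1 - 1 / r\<close> is \<open>1 / r'\<close>, including the value \<open>0\<close> for \<open>r = 1\<close>,
  and \<open>m\<close> is shifted to start at \<open>0\<close>.  In \<open>D'_const\<close> the set \<open>J_set m t h\<close> is empty
  unless \<open>t + h < 0\<close>.
\<close>
definition I_set :: "nat \<Rightarrow> real \<Rightarrow> real \<Rightarrow> real set" where
  "I_set m s h = {t \<in> Rm. 2 ^ m * h < s - t \<and> s - t \<le> 2 ^ (m + 1) * h}"

definition J_set :: "nat \<Rightarrow> real \<Rightarrow> real \<Rightarrow> real set" where
  "J_set m t h = {s \<in> Rm. 2 ^ m * h < s - t \<and> s - t \<le> 2 ^ (m + 1) * h}"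

definition D_const ::
  "real \<Rightarrow> (real \<Rightarrow> real \<Rightarrow> ('x::real_normed_vector \<Rightarrow>\<^sub>L 'y::real_normed_vector)) \<Rightarrow> ennreal" where
  "D_const r K =
     (SUP (s, h)\<in>{..<0} \<times> {0<..}. ennreal (h powr (1 - 1 / r)) *
        (\<Sum>m. ennreal (2 powr (real (Suc m) * (1 - 1 / r))) *
           ennpow (\<integral>\<^sup>+t\<in>I_set (Suc m) s h. ennreal (norm (K t s - K t (s - h)) powr r) \<partial>lebesgue)
             (1 / r)))"

definition D'_const ::
  "real \<Rightarrow> (real \<Rightarrow> real \<Rightarrow> ('x::real_normed_vector \<Rightarrow>\<^sub>L 'y::real_normed_vector)) \<Rightarrow> ennreal" where
  "D'_const r K =
     (SUP (t, h)\<in>{..<0} \<times> {0<..}. ennreal (h powr (1 - 1 / r)) *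
        (\<Sum>m. ennreal (2 powr (real (Suc m) * (1 - 1 / r))) *
           ennpow (\<integral>\<^sup>+s\<in>J_set (Suc m) t h. ennreal (norm (K t s - K (t + h) s) powr r) \<partial>lebesgue)
             (1 / r)))"

definition Mplus :: "(real \<Rightarrow> real) \<Rightarrow> real \<Rightarrow> ennreal" where
  "Mplus g t = (SUP h\<in>{0<..}. (\<integral>\<^sup>+s\<in>{t..t + h} \<inter> Rm. ennreal \<bar>g s\<bar> \<partial>lebesgue) / ennreal h)"

definition is_weight :: "(real \<Rightarrow> real) \<Rightarrow> bool" where
  "is_weight w \<longleftrightarrow> w \<in> borel_measurable lebm \<and> (\<forall>t\<in>Rm. 0 \<le> w t) \<and> (AE t in lebm. 0 < w t)"

definition wmeas :: "(real \<Rightarrow> real) \<Rightarrow> real set \<Rightarrow> ennreal" where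
  "wmeas w A = (\<integral>\<^sup>+t\<in>A. ennreal (w t) \<partial>lebesgue)"

definition Ainf_plus :: "(real \<Rightarrow> real) set" where
  "Ainf_plus = {w. is_weight w \<and>
     (\<exists>C>0. \<exists>\<delta>>0. \<forall>a b c S. a < b \<and> b < c \<and> c \<le> 0 \<and> S \<in> sets lebesgue \<and> S \<subseteq> {b..c} \<longrightarrow>
        emeasure lebesgue S / ennreal (c - a)
          \<le> ennreal C * ennpow (wmeas w S / wmeas w {a<..<b}) \<delta>)}"

definition Ap_const :: "real \<Rightarrow> (real \<Rightarrow> real) \<Rightarrow> ennreal" where
  "Ap_const p w =
     (SUP (a, b, c)\<in>{(a, b, c). a < b \<and> b < c \<and> c \<le> 0}.
        ennreal (1 / (c - a) powr p) * (\<integral>\<^sup>+t\<in>{a<..<b}. ennreal (w t) \<partial>lebesgue) *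
        ennpow (\<integral>\<^sup>+t\<in>{b<..<c}. ennreal (w t powr (1 - p / (p - 1))) \<partial>lebesgue) (p - 1))"

definition Ap_plus :: "real \<Rightarrow> (real \<Rightarrow> real) set" where
  "Ap_plus p = {w. is_weight w \<and> Ap_const p w < \<infinity>}"

definition Lpw :: "real \<Rightarrow> (real \<Rightarrow> real) \<Rightarrow> (real \<Rightarrow> ennreal) set" where
  "Lpw p w = {g. g \<in> borel_measurable lebm \<and> (\<integral>\<^sup>+t. ennpow (g t) p * ennreal (w t) \<partial>lebm) < \<infinity>}"

definition weighted_estimate ::
  "((real \<Rightarrow> 'x::banach) \<Rightarrow> (real \<Rightarrow> 'y::banach)) \<Rightarrow> real \<Rightarrow> real \<Rightarrow> (real \<Rightarrow> real) \<Rightarrow> real \<Rightarrow> bool"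
where
  "weighted_estimate T r p w C \<longleftrightarrow>
     (\<forall>f\<in>Linf_c. Mplus (\<lambda>t. norm (T f t)) \<in> Lpw p w \<longrightarrow>
        (\<integral>\<^sup>+t. ennreal (norm (T f t) powr p) * ennreal (w t) \<partial>lebm)
          \<le> ennreal C *
             (\<integral>\<^sup>+t. ennpow (Mplus (\<lambda>s. norm (f s) powr (r / (r - 1))) t) (p / (r / (r - 1)))
                     * ennreal (w t) \<partial>lebm))"

end

theory Submission
  imports Defs
begin

text \<open>
  Write g for the norm of T f.  For l > 0 let O(l) be the set of points x such that g > l on more
  than half of some interval (x, y).  By the rising sun lemma O(l) is a disjoint union of intervals
  (a, b) whose right end point is not in O(l), and almost every point with g > l lies in O(l).  The
  sets O(l) replace the level sets of a maximal function of g in a good-lambda argument; since only the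
  measure of level sets enters, a weak type (1,1) bound for T suffices, and it holds by a
  Calderon-Zygmund decomposition along rising sun intervals together with the condition D 1.

  Suppose that z in (a, b) satisfies M+ (norm f ^ r') z \<le> (\<gamma> l) ^ r'.  Split f into its part on
  [z, z + 5 (b - z)] and a tail.  The first part is handled by the weak type bound.  By D' r the
  image of the tail varies little on (z, b + (b - z)), and it is not much larger than l at some point
  to the right of b, because b is not in O(l).  Hence, on dyadic pieces of (a, b) that accumulate at b,
  O((1 + \<kappa>) l) minus the set where M+ (norm f ^ r') > (\<gamma> l) ^ r' occupies only a small
  proportion.  The weight condition compares the weight of a dyadic piece with that of a large part
  of the next one.  So the weight of this difference is at most 1 - 1 / A times that of O(l), where A
  depends on the weight only.  This factor need not be small: one takes \<kappa> so small that
  (1 + \<kappa>) powr p times it is still less than 1, integrates over l, and absorbs the left-hand side,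
  which is finite by the assumption on M+ g.
\<close>

text \<open>The weight condition compares an interval only with a set to its right: if
  \<open>S\<close> fills a fixed proportion, the weight of \<open>{a<..<b}\<close> is at most
  \<open>A\<close> times that of \<open>S\<close>. It does not directly bound the weight of a small
  set, which is why the factor stays at 1 - 1 / A. The inequality comes from letting the good part
  of each dyadic piece pay for the whole piece before it; these good parts are disjoint, so summing
  over the pieces costs nothing. The constants are chosen in the order \<open>A\<close>, \<kappa>,
  \<gamma>. With (1 + \<kappa>) powr - p = 1 - 1 / (2 * A), half of the integral survives the
  absorption. With \<gamma> = \<kappa> / (320 * C1 + 16 * D'), the bad set fills at most a quarter
  of each dyadic piece. The weight enters only through \<open>A\<close>, so the final constant 2 * A
  * \<gamma> powr - p serves all weights with the same \<open>A\<close>; this gives the uniformity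
  over families in \<open>Ap_plus p\<close> with bounded constants.\<close>

subsection \<open>Strong measurability and the integral in Banach spaces\<close>

(* As a simp rule it rewrites the Lebesgue measure of a set into that of its main part. *)
declare emeasure_completion [simp del]

lemma complete_measure_lebesgue_on:
  fixes S :: "'a::euclidean_space set"
  assumes "S \<in> sets lebesgue"
  shows "complete_measure (lebesgue_on S)"
proof
  fix A B assume "B \<subseteq> A" "A \<in> null_sets (lebesgue_on S)"
  then have "A \<subseteq> S" "A \<in> null_sets lebesgue"
    using assms by (auto simp: null_sets_restrict_space)
  with \<open>B \<subseteq> A\<close> have "B \<in> sets lebesgue" "B \<subseteq> S"
    using completion.complete by blast+
  then show "B \<in> sets (lebesgue_on S)"
    using assms by (auto simp: sets_restrict_space_iff)
qed

lemma complete_measure_lebm: "complete_measure lebm"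
  by (rule complete_measure_lebesgue_on) auto

lemma borel_measurable_AE_eq:
  fixes f g :: "'m \<Rightarrow> 'b::topological_space"
  assumes "complete_measure M" "f \<in> borel_measurable M" "AE x in M. f x = g x"
  shows "g \<in> borel_measurable M"
proof (rule measurableI)
  interpret complete_measure M by fact
  fix A :: "'b set" assume A: "A \<in> sets borel"
  show "g -` A \<inter> space M \<in> sets M"
  proof (rule in_sets_AE)
    show "f -` A \<inter> space M \<in> sets M" using assms(2) A by (rule measurable_sets)
    show "AE x in M. x \<in> f -` A \<inter> space M \<longleftrightarrow> x \<in> g -` A \<inter> space M"
      using assms(3) by eventually_elim auto
  qed auto
qed auto

lemma AE_lebm_iff: "(AE x in lebm. P x) \<longleftrightarrow> (AE x in lebesgue. x \<le> 0 \<longrightarrow> P x)"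
  by (subst AE_restrict_space_iff) auto

lemma nn_integral_lebm: "(\<integral>\<^sup>+x. f x \<partial>lebm) = (\<integral>\<^sup>+x. f x * indicator Rm x \<partial>lebesgue)"
  by (rule nn_integral_restrict_space) auto

text \<open>The simple functions converge only almost everywhere, so completeness of the measure is
  what makes the limit of the norms measurable. Vector-valued functions are later estimated through
  their norms, which avoids any Borel structure on a possibly nonseparable space.\<close>

lemma strongly_measurable_norm_diff:
  fixes f g :: "'m \<Rightarrow> 'b::real_normed_vector"
  assumes c: "complete_measure M" and f: "strongly_measurable M f" and g: "simple_function M g"
  shows "(\<lambda>x. norm (f x - g x)) \<in> borel_measurable M"
proof -
  obtain u where u: "\<And>i. simple_function M (u i)" "AE x in M. (\<lambda>i. u i x) \<longlonglongrightarrow> f x"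
    using f unfolding strongly_measurable_def by blast
  have sf: "simple_function M (\<lambda>x. norm (u i x - g x))" for i
    using simple_function_compose2[OF u(1) g, of "\<lambda>a b. norm (a - b)"] .
  have "(\<lambda>x. lim (\<lambda>i. norm (u i x - g x))) \<in> borel_measurable M"
    by (rule borel_measurable_lim_metric) (use borel_measurable_simple_function[OF sf] in auto)
  moreover have "AE x in M. lim (\<lambda>i. norm (u i x - g x)) = norm (f x - g x)"
    using u(2) by eventually_elim (rule limI, auto intro!: tendsto_intros)
  ultimately show ?thesis by (rule borel_measurable_AE_eq[OF c])
qed

lemma strongly_measurable_norm:
  fixes f :: "'m \<Rightarrow> 'b::real_normed_vector"
  assumes "complete_measure M" "strongly_measurable M f"
  shows "(\<lambda>x. norm (f x)) \<in> borel_measurable M"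
  using strongly_measurable_norm_diff[OF assms, of "\<lambda>_. 0"] by simp

lemma strongly_measurable_simple: "simple_function M u \<Longrightarrow> strongly_measurable M u"
  unfolding strongly_measurable_def by (rule exI[of _ "\<lambda>_. u"]) auto

text \<open>A pointwise combination of two simple functions is simple, and sequential continuity of
  \<open>h\<close> carries the limits along. Sums, differences, cut-offs and linear images are
  instances.\<close>

lemma strongly_measurable_compose2:
  fixes f :: "'m \<Rightarrow> 'a::real_normed_vector" and g :: "'m \<Rightarrow> 'b::real_normed_vector"
    and h :: "'a \<Rightarrow> 'b \<Rightarrow> 'c::real_normed_vector"
  assumes f: "strongly_measurable M f" and g: "strongly_measurable M g"
    and h: "\<And>a b u v. u \<longlonglongrightarrow> a \<Longrightarrow> v \<longlonglongrightarrow> b \<Longrightarrow> (\<lambda>i::nat. h (u i) (v i)) \<longlonglongrightarrow> h a b"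
  shows "strongly_measurable M (\<lambda>x. h (f x) (g x))"
proof -
  obtain u where u: "\<And>i. simple_function M (u i)" "AE x in M. (\<lambda>i. u i x) \<longlonglongrightarrow> f x"
    using f unfolding strongly_measurable_def by blast
  obtain v where v: "\<And>i. simple_function M (v i)" "AE x in M. (\<lambda>i. v i x) \<longlonglongrightarrow> g x"
    using g unfolding strongly_measurable_def by blast
  show ?thesis unfolding strongly_measurable_def
  proof (intro exI conjI allI)
    show "simple_function M (\<lambda>x. h (u i x) (v i x))" for i
      by (rule simple_function_compose2[OF u(1) v(1)])
    show "AE x in M. (\<lambda>i. h (u i x) (v i x)) \<longlonglongrightarrow> h (f x) (g x)"
      using u(2) v(2) by eventually_elim (rule h)
  qed
qed

lemma strongly_measurable_diff:
  fixes f g :: "'m \<Rightarrow> 'b::real_normed_vector"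
  assumes "strongly_measurable M f" "strongly_measurable M g"
  shows "strongly_measurable M (\<lambda>x. f x - g x)"
  by (rule strongly_measurable_compose2[OF assms]) (auto intro: tendsto_intros)

lemma strongly_measurable_add:
  fixes f g :: "'m \<Rightarrow> 'b::real_normed_vector"
  assumes "strongly_measurable M f" "strongly_measurable M g"
  shows "strongly_measurable M (\<lambda>x. f x + g x)"
  by (rule strongly_measurable_compose2[OF assms]) (auto intro: tendsto_intros)

lemma strongly_measurable_indicator_scaleR:
  fixes f :: "'m \<Rightarrow> 'b::real_normed_vector"
  assumes f: "strongly_measurable M f" and A: "A \<inter> space M \<in> sets M"
  shows "strongly_measurable M (\<lambda>x. indicator A x *\<^sub>R f x)"
proof -
  have "simple_function M (indicator (A \<inter> space M) :: _ \<Rightarrow> real)" using A by simp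
  then have "simple_function M (indicator A :: _ \<Rightarrow> real)"
    by (rule simple_function_cong[THEN iffD1, rotated]) (auto simp: indicator_def)
  then show ?thesis
    by (intro strongly_measurable_compose2[OF strongly_measurable_simple f])
      (auto intro: tendsto_intros)
qed

lemma strongly_measurable_const: "strongly_measurable M (\<lambda>x. c)"
  by (rule strongly_measurable_simple) auto

lemma strongly_measurable_compose_linear:
  assumes "bounded_linear L" "strongly_measurable M f"
  shows "strongly_measurable M (\<lambda>x. L (f x))"
  by (rule strongly_measurable_compose2[OF assms(2) assms(2), of "\<lambda>a b. L a"])
    (rule bounded_linear.tendsto[OF assms(1)])

lemma simple_bochner_integrable_imp:
  "Bochner_Integration.simple_bochner_integrable M u \<Longrightarrow> simple_function M u"
  by (auto elim: simple_bochner_integrable.cases)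

lemma norm_simple_bochner_integral_le:
  fixes u :: "'m \<Rightarrow> 'b::real_normed_vector"
  assumes "Bochner_Integration.simple_bochner_integrable M u"
  shows "ennreal (norm (Bochner_Integration.simple_bochner_integral M u)) \<le> (\<integral>\<^sup>+x. ennreal (norm (u x)) \<partial>M)"
proof -
  have n: "Bochner_Integration.simple_bochner_integrable M (\<lambda>x. norm (u x))"
    using simple_bochner_integrable_compose2[of "\<lambda>a b. norm a", OF _ assms assms] by simp
  show ?thesis
    using simple_bochner_integral_norm_bound[OF assms]
      simple_bochner_integral_eq_nn_integral[OF n] by (metis ennreal_leI norm_ge_zero)
qed

lemma norm_simple_bochner_integral_diff_le:
  fixes u v :: "'m \<Rightarrow> 'b::real_normed_vector"
  assumes u: "Bochner_Integration.simple_bochner_integrable M u"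
    and v: "Bochner_Integration.simple_bochner_integrable M v"
  shows "ennreal (norm (Bochner_Integration.simple_bochner_integral M u
      - Bochner_Integration.simple_bochner_integral M v))
    \<le> (\<integral>\<^sup>+x. ennreal (norm (u x - v x)) \<partial>M)"
proof -
  have n: "Bochner_Integration.simple_bochner_integrable M (\<lambda>x. u x - v x)"
    using simple_bochner_integrable_compose2[of "(-)", OF _ u v] by simp
  show ?thesis
    using norm_simple_bochner_integral_le[OF n] simple_bochner_integral_diff[OF u v] by simp
qed

lemma has_banach_integral_norm_le:
  fixes f :: "'m \<Rightarrow> 'b::real_normed_vector"
  assumes c: "complete_measure M" and f: "has_banach_integral M f y"
  shows "ennreal (norm y) \<le> (\<integral>\<^sup>+x. ennreal (norm (f x)) \<partial>M)"
proof -
  from f obtain u where sm: "strongly_measurable M f"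
    and u: "\<And>i. Bochner_Integration.simple_bochner_integrable M (u i)"
    and e: "(\<lambda>i. \<integral>\<^sup>+x. ennreal (norm (f x - u i x)) \<partial>M) \<longlonglongrightarrow> 0"
    and y: "(\<lambda>i. Bochner_Integration.simple_bochner_integral M (u i)) \<longlonglongrightarrow> y"
    unfolding has_banach_integral_def by blast
  have 1: "(\<lambda>i. ennreal (norm (Bochner_Integration.simple_bochner_integral M (u i)))) \<longlonglongrightarrow> ennreal (norm y)"
    by (intro tendsto_ennrealI tendsto_norm y)
  have "(\<lambda>i. (\<integral>\<^sup>+x. ennreal (norm (f x)) \<partial>M) + (\<integral>\<^sup>+x. ennreal (norm (f x - u i x)) \<partial>M))
      \<longlonglongrightarrow> (\<integral>\<^sup>+x. ennreal (norm (f x)) \<partial>M) + 0"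
    by (intro tendsto_add tendsto_const e)
  then have 2: "(\<lambda>i. (\<integral>\<^sup>+x. ennreal (norm (f x)) \<partial>M) + (\<integral>\<^sup>+x. ennreal (norm (f x - u i x)) \<partial>M))
      \<longlonglongrightarrow> (\<integral>\<^sup>+x. ennreal (norm (f x)) \<partial>M)" by simp
  show ?thesis
  proof (rule LIMSEQ_le[OF 1 2], intro exI allI impI)
    fix i :: nat
    note [measurable] = strongly_measurable_norm[OF c sm]
      strongly_measurable_norm_diff[OF c sm simple_bochner_integrable_imp[OF u]]
    have "ennreal (norm (Bochner_Integration.simple_bochner_integral M (u i)))
        \<le> (\<integral>\<^sup>+x. ennreal (norm (u i x)) \<partial>M)" by (rule norm_simple_bochner_integral_le[OF u])
    also have "\<dots> \<le> (\<integral>\<^sup>+x. ennreal (norm (f x)) + ennreal (norm (f x - u i x)) \<partial>M)"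
      by (intro nn_integral_mono)
        (metis norm_triangle_sub norm_minus_commute ennreal_plus ennreal_leI norm_ge_zero)
    also have "\<dots> = (\<integral>\<^sup>+x. ennreal (norm (f x)) \<partial>M) + (\<integral>\<^sup>+x. ennreal (norm (f x - u i x)) \<partial>M)"
      by (rule nn_integral_add) auto
    finally show "ennreal (norm (Bochner_Integration.simple_bochner_integral M (u i)))
      \<le> (\<integral>\<^sup>+x. ennreal (norm (f x)) \<partial>M) + (\<integral>\<^sup>+x. ennreal (norm (f x - u i x)) \<partial>M)" .
  qed
qed

lemma has_banach_integral_diff:
  fixes f g :: "'m \<Rightarrow> 'b::real_normed_vector"
  assumes c: "complete_measure M" and f: "has_banach_integral M f y" and g: "has_banach_integral M g z"
  shows "has_banach_integral M (\<lambda>x. f x - g x) (y - z)"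
proof -
  from f obtain u where sf: "strongly_measurable M f"
    and u: "\<And>i. Bochner_Integration.simple_bochner_integrable M (u i)"
    and eu: "(\<lambda>i. \<integral>\<^sup>+x. ennreal (norm (f x - u i x)) \<partial>M) \<longlonglongrightarrow> 0"
    and y: "(\<lambda>i. Bochner_Integration.simple_bochner_integral M (u i)) \<longlonglongrightarrow> y"
    unfolding has_banach_integral_def by blast
  from g obtain v where sg: "strongly_measurable M g"
    and v: "\<And>i. Bochner_Integration.simple_bochner_integrable M (v i)"
    and ev: "(\<lambda>i. \<integral>\<^sup>+x. ennreal (norm (g x - v i x)) \<partial>M) \<longlonglongrightarrow> 0"
    and z: "(\<lambda>i. Bochner_Integration.simple_bochner_integral M (v i)) \<longlonglongrightarrow> z"
    unfolding has_banach_integral_def by blast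
  have e: "(\<lambda>i. \<integral>\<^sup>+x. ennreal (norm (f x - g x - (u i x - v i x))) \<partial>M) \<longlonglongrightarrow> 0"
  proof (rule tendsto_sandwich[OF _ _ tendsto_const])
    show "(\<lambda>i. (\<integral>\<^sup>+x. ennreal (norm (f x - u i x)) \<partial>M) + (\<integral>\<^sup>+x. ennreal (norm (g x - v i x)) \<partial>M)) \<longlonglongrightarrow> 0"
      using tendsto_add[OF eu ev] by simp
    show "\<forall>\<^sub>F i in sequentially. (\<integral>\<^sup>+x. ennreal (norm (f x - g x - (u i x - v i x))) \<partial>M)
       \<le> (\<integral>\<^sup>+x. ennreal (norm (f x - u i x)) \<partial>M) + (\<integral>\<^sup>+x. ennreal (norm (g x - v i x)) \<partial>M)"
    proof (intro always_eventually allI)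
      fix i
      note [measurable] = strongly_measurable_norm_diff[OF c sf simple_bochner_integrable_imp[OF u]]
        strongly_measurable_norm_diff[OF c sg simple_bochner_integrable_imp[OF v]]
      have "(\<integral>\<^sup>+x. ennreal (norm (f x - g x - (u i x - v i x))) \<partial>M)
        \<le> (\<integral>\<^sup>+x. ennreal (norm (f x - u i x)) + ennreal (norm (g x - v i x)) \<partial>M)"
      proof (intro nn_integral_mono)
        fix x
        have "norm (f x - g x - (u i x - v i x)) \<le> norm (f x - u i x) + norm (g x - v i x)"
          using norm_triangle_ineq4[of "f x - u i x" "g x - v i x"] by (simp add: algebra_simps)
        then show "ennreal (norm (f x - g x - (u i x - v i x)))
            \<le> ennreal (norm (f x - u i x)) + ennreal (norm (g x - v i x))"
          by (simp flip: ennreal_plus)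
      qed
      also have "\<dots> = (\<integral>\<^sup>+x. ennreal (norm (f x - u i x)) \<partial>M) + (\<integral>\<^sup>+x. ennreal (norm (g x - v i x)) \<partial>M)"
        by (rule nn_integral_add) auto
      finally show "(\<integral>\<^sup>+x. ennreal (norm (f x - g x - (u i x - v i x))) \<partial>M)
       \<le> (\<integral>\<^sup>+x. ennreal (norm (f x - u i x)) \<partial>M) + (\<integral>\<^sup>+x. ennreal (norm (g x - v i x)) \<partial>M)" .
    qed
  qed auto
  show ?thesis unfolding has_banach_integral_def
  proof (intro conjI exI[of _ "\<lambda>i x. u i x - v i x"] allI)
    show "strongly_measurable M (\<lambda>x. f x - g x)" by (rule strongly_measurable_diff[OF sf sg])
    show "Bochner_Integration.simple_bochner_integrable M (\<lambda>x. u i x - v i x)" for i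
      using simple_bochner_integrable_compose2[of "(-)", OF _ u v] by simp
    show "(\<lambda>i. Bochner_Integration.simple_bochner_integral M (\<lambda>x. u i x - v i x)) \<longlonglongrightarrow> y - z"
      using tendsto_diff[OF y z] by (simp add: simple_bochner_integral_diff[OF u v])
  qed (rule e)
qed

lemma has_banach_integral_bounded_linear:
  fixes f :: "'m \<Rightarrow> 'b::real_normed_vector" and L :: "'b \<Rightarrow> 'c::real_normed_vector"
  assumes c: "complete_measure M" and L: "bounded_linear L" and f: "has_banach_integral M f y"
  shows "has_banach_integral M (\<lambda>x. L (f x)) (L y)"
proof -
  interpret bounded_linear L by fact
  obtain B where B: "0 \<le> B" "\<And>x. norm (L x) \<le> norm x * B" using nonneg_bounded by blast
  from f obtain u where sf: "strongly_measurable M f"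
    and u: "\<And>i. Bochner_Integration.simple_bochner_integrable M (u i)"
    and eu: "(\<lambda>i. \<integral>\<^sup>+x. ennreal (norm (f x - u i x)) \<partial>M) \<longlonglongrightarrow> 0"
    and y: "(\<lambda>i. Bochner_Integration.simple_bochner_integral M (u i)) \<longlonglongrightarrow> y"
    unfolding has_banach_integral_def by blast
  have e: "(\<lambda>i. \<integral>\<^sup>+x. ennreal (norm (L (f x) - L (u i x))) \<partial>M) \<longlonglongrightarrow> 0"
  proof (rule tendsto_sandwich[OF _ _ tendsto_const])
    show "(\<lambda>i. ennreal B * (\<integral>\<^sup>+x. ennreal (norm (f x - u i x)) \<partial>M)) \<longlonglongrightarrow> 0"
      using ennreal_tendsto_cmult[OF _ eu, of "ennreal B"] by simp
    show "\<forall>\<^sub>F i in sequentially. (\<integral>\<^sup>+x. ennreal (norm (L (f x) - L (u i x))) \<partial>M)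
       \<le> ennreal B * (\<integral>\<^sup>+x. ennreal (norm (f x - u i x)) \<partial>M)"
    proof (intro always_eventually allI)
      fix i
      note [measurable] = strongly_measurable_norm_diff[OF c sf simple_bochner_integrable_imp[OF u]]
      have "(\<integral>\<^sup>+x. ennreal (norm (L (f x) - L (u i x))) \<partial>M)
        \<le> (\<integral>\<^sup>+x. ennreal B * ennreal (norm (f x - u i x)) \<partial>M)"
        using B by (intro nn_integral_mono)
          (auto simp flip: ennreal_mult' diff intro!: ennreal_leI simp: mult.commute)
      also have "\<dots> = ennreal B * (\<integral>\<^sup>+x. ennreal (norm (f x - u i x)) \<partial>M)"
        by (rule nn_integral_cmult) auto
      finally show "(\<integral>\<^sup>+x. ennreal (norm (L (f x) - L (u i x))) \<partial>M)
       \<le> ennreal B * (\<integral>\<^sup>+x. ennreal (norm (f x - u i x)) \<partial>M)" .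
    qed
  qed auto
  show ?thesis unfolding has_banach_integral_def
  proof (intro conjI exI[of _ "\<lambda>i x. L (u i x)"] allI)
    show "strongly_measurable M (\<lambda>x. L (f x))" by (rule strongly_measurable_compose_linear[OF L sf])
    show "Bochner_Integration.simple_bochner_integrable M (\<lambda>x. L (u i x))" for i
      using simple_bochner_integrable_compose2[of "\<lambda>a b. L a", OF _ u u] zero by simp
    show "(\<lambda>i. Bochner_Integration.simple_bochner_integral M (\<lambda>x. L (u i x))) \<longlonglongrightarrow> L y"
      using tendsto[OF y] simple_bochner_integral_linear[OF linear u] by simp
  qed (rule e)
qed

lemma has_banach_integral_exists:
  fixes f :: "'m \<Rightarrow> 'b::banach"
  assumes c: "complete_measure M" and f: "strongly_measurable M f"
    and fin: "(\<integral>\<^sup>+x. ennreal (norm (f x)) \<partial>M) < \<infinity>"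
  shows "\<exists>y. has_banach_integral M f y"
proof -
  obtain u where u: "\<And>i. simple_function M (u i)" "AE x in M. (\<lambda>i. u i x) \<longlonglongrightarrow> f x"
    using f unfolding strongly_measurable_def by blast
  note nf[measurable] = strongly_measurable_norm[OF c f]
  \<comment> \<open>Cutting off where the approximant exceeds twice the norm of \<open>f\<close>
    does not change the limit and provides the integrable majorant \<open>3 * norm (f x)\<close> for
    dominated convergence. Where \<open>f\<close> vanishes, so does \<open>v\<close>.\<close>
  define v where "v i x = (if norm (u i x) \<le> 2 * norm (f x) then u i x else 0)" for i x
  have [measurable]: "(\<lambda>x. norm (u i x)) \<in> borel_measurable M" for i
    by (rule borel_measurable_simple_function) (rule simple_function_compose1[OF u(1)])
  have sv: "simple_function M (v i)" for i
    unfolding v_def by (rule simple_function_If) (auto simp: u)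
  have vb: "norm (v i x) \<le> 2 * norm (f x)" for i x unfolding v_def by auto
  have fin2: "(\<integral>\<^sup>+x. ennreal (3 * norm (f x)) \<partial>M) < \<infinity>"
    using fin by (simp add: ennreal_mult' nn_integral_cmult ennreal_mult_less_top)
  have iv: "Bochner_Integration.simple_bochner_integrable M (v i)" for i
  proof (rule simple_bochner_integrableI_bounded[OF sv])
    have "(\<integral>\<^sup>+x. ennreal (norm (v i x)) \<partial>M) \<le> (\<integral>\<^sup>+x. ennreal (3 * norm (f x)) \<partial>M)"
      by (intro nn_integral_mono ennreal_leI order_trans[OF vb]) auto
    then show "(\<integral>\<^sup>+x. ennreal (norm (v i x)) \<partial>M) < \<infinity>" using fin2 by order
  qed
  note [measurable] = strongly_measurable_norm_diff[OF c f sv]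
  have lim: "AE x in M. (\<lambda>i. norm (f x - v i x)) \<longlonglongrightarrow> 0"
    using u(2)
  proof eventually_elim
    case (elim x)
    show ?case
    proof (cases "f x = 0")
      case True
      then have "v i x = 0" for i unfolding v_def by auto
      with True show ?thesis by simp
    next
      case False
      have "(\<lambda>i. norm (u i x)) \<longlonglongrightarrow> norm (f x)" using elim by (rule tendsto_norm)
      then have "\<forall>\<^sub>F i in sequentially. norm (u i x) < 2 * norm (f x)"
        by (rule order_tendstoD) (use False in auto)
      then have "\<forall>\<^sub>F i in sequentially. u i x = v i x"
        by eventually_elim (auto simp: v_def)
      with elim have "(\<lambda>i. v i x) \<longlonglongrightarrow> f x" by (rule Lim_transform_eventually)
      then have "(\<lambda>i. norm (f x - v i x)) \<longlonglongrightarrow> norm (f x - f x)" by (intro tendsto_intros)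
      then show ?thesis by simp
    qed
  qed
  have e: "(\<lambda>i. \<integral>\<^sup>+x. ennreal (norm (f x - v i x)) \<partial>M) \<longlonglongrightarrow> (\<integral>\<^sup>+x. 0 \<partial>M)"
  proof (rule nn_integral_dominated_convergence[where w = "\<lambda>x. ennreal (3 * norm (f x))"])
    show "AE x in M. ennreal (norm (f x - v i x)) \<le> ennreal (3 * norm (f x))" for i
    proof (intro AE_I2 ennreal_leI)
      fix x show "norm (f x - v i x) \<le> 3 * norm (f x)"
        using norm_triangle_ineq4[of "f x" "v i x"] vb[of i x] by linarith
    qed
    show "AE x in M. (\<lambda>i. ennreal (norm (f x - v i x))) \<longlonglongrightarrow> 0"
      using lim by eventually_elim (use tendsto_ennrealI in force)
  qed (use fin2 in auto)
  then have e: "(\<lambda>i. \<integral>\<^sup>+x. ennreal (norm (f x - v i x)) \<partial>M) \<longlonglongrightarrow> 0" by simp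
  have "Cauchy (\<lambda>i. Bochner_Integration.simple_bochner_integral M (v i))"
  proof (rule metric_CauchyI)
    fix r :: real assume r: "0 < r"
    then have "\<forall>\<^sub>F i in sequentially. (\<integral>\<^sup>+x. ennreal (norm (f x - v i x)) \<partial>M) < ennreal (r/2)"
      using e by (intro order_tendstoD) auto
    then obtain N where N: "\<And>i. i \<ge> N \<Longrightarrow> (\<integral>\<^sup>+x. ennreal (norm (f x - v i x)) \<partial>M) < ennreal (r/2)"
      unfolding eventually_sequentially by blast
    show "\<exists>K. \<forall>m\<ge>K. \<forall>n\<ge>K. dist (Bochner_Integration.simple_bochner_integral M (v m))
        (Bochner_Integration.simple_bochner_integral M (v n)) < r"
    proof (intro exI[of _ N] allI impI)
      fix m n assume "N \<le> m" "N \<le> n"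
      have "ennreal (norm (Bochner_Integration.simple_bochner_integral M (v m) - Bochner_Integration.simple_bochner_integral M (v n)))
        \<le> (\<integral>\<^sup>+x. ennreal (norm (v m x - v n x)) \<partial>M)"
        by (rule norm_simple_bochner_integral_diff_le[OF iv iv])
      also have "\<dots> \<le> (\<integral>\<^sup>+x. ennreal (norm (f x - v m x)) + ennreal (norm (f x - v n x)) \<partial>M)"
      proof (intro nn_integral_mono)
        fix x
        have "norm (v m x - v n x) \<le> norm (f x - v m x) + norm (f x - v n x)"
          using norm_triangle_ineq4[of "f x - v n x" "f x - v m x"] by (simp add: algebra_simps)
        then show "ennreal (norm (v m x - v n x)) \<le> ennreal (norm (f x - v m x)) + ennreal (norm (f x - v n x))"
          by (simp flip: ennreal_plus)
      qed
      also have "\<dots> = (\<integral>\<^sup>+x. ennreal (norm (f x - v m x)) \<partial>M) + (\<integral>\<^sup>+x. ennreal (norm (f x - v n x)) \<partial>M)"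
        by (rule nn_integral_add) auto
      also have "\<dots> < ennreal (r/2) + ennreal (r/2)"
        using N[OF \<open>N \<le> m\<close>] N[OF \<open>N \<le> n\<close>] by (rule add_strict_mono)
      also have "\<dots> = ennreal r" using r by (simp flip: ennreal_plus)
      finally show "dist (Bochner_Integration.simple_bochner_integral M (v m))
        (Bochner_Integration.simple_bochner_integral M (v n)) < r"
        using r by (simp add: dist_norm ennreal_less_iff)
    qed
  qed
  then obtain y where "(\<lambda>i. Bochner_Integration.simple_bochner_integral M (v i)) \<longlonglongrightarrow> y"
    using convergent_eq_Cauchy by blast
  then show ?thesis unfolding has_banach_integral_def using f iv e by blast
qed

lemma has_banach_integral_unique_0:
  fixes f :: "'m \<Rightarrow> 'b::real_normed_vector"
  assumes c: "complete_measure M" and f: "has_banach_integral M f y" and "AE x in M. f x = 0"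
  shows "y = 0"
proof -
  have "(\<integral>\<^sup>+x. ennreal (norm (f x)) \<partial>M) = (\<integral>\<^sup>+x. 0 \<partial>M)"
    by (rule nn_integral_cong_AE) (use assms(3) in \<open>eventually_elim, auto\<close>)
  with has_banach_integral_norm_le[OF c f] show ?thesis by simp
qed

subsection \<open>The rising sun lemma\<close>

text \<open>Estimates below are proved on single components of an open set; countable additivity
  transfers them to the whole set. Both measures are usually densities, which is how averages,
  proportions and weights are expressed.\<close>

lemma emeasure_Union_mono:
  assumes c: "countable \<C>" and d: "disjoint \<C>" and "sets \<mu> = sets \<nu>"
    and m: "\<And>C. C \<in> \<C> \<Longrightarrow> C \<in> sets \<mu>" and le: "\<And>C. C \<in> \<C> \<Longrightarrow> emeasure \<mu> C \<le> emeasure \<nu> C"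
  shows "emeasure \<mu> (\<Union>\<C>) \<le> emeasure \<nu> (\<Union>\<C>)"
proof -
  have df: "disjoint_family_on (\<lambda>C. C) \<C>"
    using d by (auto simp: disjoint_family_on_def disjoint_def)
  have "emeasure \<mu> (\<Union>C\<in>\<C>. C) = (\<integral>\<^sup>+C. emeasure \<mu> C \<partial>count_space \<C>)"
    by (rule emeasure_UN_countable[OF _ c df]) (use m in auto)
  also have "\<dots> \<le> (\<integral>\<^sup>+C. emeasure \<nu> C \<partial>count_space \<C>)"
    by (rule nn_integral_mono) (use le in auto)
  also have "\<dots> = emeasure \<nu> (\<Union>C\<in>\<C>. C)"
    by (rule emeasure_UN_countable[OF _ c df, symmetric]) (use m assms(3) in auto)
  finally show ?thesis by simp
qed

lemma disjoint_components: "disjoint (components U)"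
  by (auto simp: disjoint_def dest: components_nonoverlap)

lemma countable_components_real:
  fixes U :: "real set" assumes "open U" shows "countable (components U)"
proof (rule countable_disjoint_open_subsets)
  show "\<And>S. S \<in> components U \<Longrightarrow> open S" using open_components[OF assms] by blast
  show "disjoint (components U)" by (rule disjoint_components)
qed

lemma open_interval_real:
  fixes C :: "real set"
  assumes "open C" "connected C" "C \<noteq> {}" "bounded C"
  obtains a b where "a < b" "C = {a<..<b}"
proof -
  have ne: "bdd_above C" "bdd_below C"
    using assms(4) by (auto intro: bounded_imp_bdd_above bounded_imp_bdd_below)
  define a b where "a = Inf C" and "b = Sup C"
  have 1: "C \<subseteq> {a<..<b}"
  proof
    fix x assume x: "x \<in> C"
    then obtain e where e: "e > 0" "\<And>y. dist y x < e \<Longrightarrow> y \<in> C"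
      using assms(1) unfolding open_dist by blast
    have "x + e/2 \<in> C" "x - e/2 \<in> C" using e by (auto simp: dist_real_def)
    then have "x + e/2 \<le> b" "a \<le> x - e/2"
      unfolding a_def b_def using ne by (auto intro: cSup_upper cInf_lower)
    then show "x \<in> {a<..<b}" using e(1) by auto
  qed
  have 2: "{a<..<b} \<subseteq> C"
  proof
    fix x assume x: "x \<in> {a<..<b}"
    obtain u where u: "u \<in> C" "u < x"
      using x assms(3) ne unfolding a_def by (metis cInf_less_iff greaterThanLessThan_iff)
    obtain v where v: "v \<in> C" "x < v"
      using x assms(3) ne unfolding b_def by (metis less_cSup_iff greaterThanLessThan_iff)
    show "x \<in> C" using connectedD_interval[OF assms(2) u(1) v(1)] u v by auto
  qed
  from 1 2 have "C = {a<..<b}" by auto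
  with that[of a b] assms(3) show ?thesis by fastforce
qed

lemma component_endpoints_notin:
  fixes U :: "real set"
  assumes "{a<..<b} \<in> components U" "a < b"
  shows "a \<notin> U" "b \<notin> U"
proof -
  have sub: "{a<..<b} \<subseteq> U" using assms(1) by (rule in_components_subset)
  show "a \<notin> U"
  proof
    assume "a \<in> U"
    then have "{a..<b} \<subseteq> U" using sub by (auto simp: le_less)
    then have "{a..<b} \<subseteq> {a<..<b}"
      by (intro components_maximal[OF assms(1)]) (use assms(2) dense[of a b] in auto)
    with assms(2) show False by auto
  qed
  show "b \<notin> U"
  proof
    assume "b \<in> U"
    then have "{a<..b} \<subseteq> U" using sub by (auto simp: le_less)
    then have "{a<..b} \<subseteq> {a<..<b}"
      by (intro components_maximal[OF assms(1)]) (use assms(2) dense[of a b] in auto)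
    with assms(2) show False by auto
  qed
qed

text \<open>If \<open>H c < H x\<close>, take the last point \<open>z\<close> of
  \<open>{x..c}\<close> with \<open>H x \<le> H z\<close>. It lies before \<open>c\<close>, so
  \<open>H\<close> takes a larger value at some \<open>y > z\<close>: for \<open>y \<le> c\<close>
  this contradicts the choice of \<open>z\<close>, for \<open>y > c\<close> the maximality of
  \<open>H c\<close> to the right of \<open>c\<close>.\<close>

lemma rising_sun_le:
  fixes H :: "real \<Rightarrow> real"
  assumes H: "continuous_on UNIV H" and x: "x \<le> c"
    and up: "\<And>z. x \<le> z \<Longrightarrow> z < c \<Longrightarrow> \<exists>y>z. H z < H y"
    and c: "\<And>y. y > c \<Longrightarrow> H y \<le> H c"
  shows "H x \<le> H c"
proof (rule ccontr)
  assume "\<not> H x \<le> H c"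
  then have less: "H c < H x" by simp
  define Z where "Z = {x..c} \<inter> {z. H x \<le> H z}"
  have "closed {z. H x \<le> H z}"
    using H by (intro closed_Collect_le continuous_on_const)
  then have "compact Z" unfolding Z_def by (intro compact_Int_closed) auto
  moreover have "x \<in> Z" using x by (auto simp: Z_def)
  ultimately obtain z where z: "z \<in> Z" "\<And>t. t \<in> Z \<Longrightarrow> t \<le> z"
    using compact_attains_sup[of Z] by blast
  have "z < c" using z(1) less unfolding Z_def by (cases "z = c") auto
  then obtain y where y: "y > z" "H z < H y" using up[of z] z(1) by (auto simp: Z_def)
  have "H x < H y" using y z(1) by (auto simp: Z_def)
  show False
  proof (cases "y \<le> c")
    case True
    then have "y \<in> Z" using y z(1) \<open>H x < H y\<close> by (auto simp: Z_def)
    with z(2) y(1) show False by fastforce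
  next
    case False
    with c[of y] less \<open>H x < H y\<close> show False by auto
  qed
qed

text \<open>The set where the one-sided maximal function of \<^term>\<open>\<phi> :: real \<Rightarrow> ennreal\<close> exceeds \<^term>\<open>l :: real\<close>; see \<open>rs_set_Mplus\<close>.\<close>

definition rs_set :: "(real \<Rightarrow> ennreal) \<Rightarrow> real \<Rightarrow> real set" where
  "rs_set \<phi> l = {x. \<exists>y>x. ennreal (l * (y - x)) < (\<integral>\<^sup>+t\<in>{x..y}. \<phi> t \<partial>lebesgue)}"

lemma sets_lebesgue_intervals[measurable]:
  fixes a b :: real
  shows "{a..b} \<in> sets lebesgue" "{a<..<b} \<in> sets lebesgue" "{a<..b} \<in> sets lebesgue"
    "{a..<b} \<in> sets lebesgue" "{..a} \<in> sets lebesgue" "{..<a} \<in> sets lebesgue"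
    "{a..} \<in> sets lebesgue" "{a<..} \<in> sets lebesgue"
  by auto

lemma rs_set_mono:
  assumes "\<And>t. \<phi> t \<le> \<psi> t"
  shows "rs_set \<phi> l \<subseteq> rs_set \<psi> l"
proof -
  have "(\<integral>\<^sup>+t\<in>A. \<phi> t \<partial>lebesgue) \<le> (\<integral>\<^sup>+t\<in>A. \<psi> t \<partial>lebesgue)" for A :: "real set"
    by (intro nn_integral_mono mult_right_mono assms) auto
  then show ?thesis unfolding rs_set_def by (blast intro: order.strict_trans2)
qed

lemma AE_lebesgue_neq: "AE t in lebesgue. t \<noteq> (a::real)"
  using AE_completion[OF AE_lborel_singleton[of a]] .

lemma nn_integral_Icc_split:
  fixes \<phi> :: "real \<Rightarrow> ennreal"
  assumes "\<phi> \<in> borel_measurable lebesgue" "x \<le> y" "y \<le> z"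
  shows "(\<integral>\<^sup>+t\<in>{x..z}. \<phi> t \<partial>lebesgue) = (\<integral>\<^sup>+t\<in>{x..y}. \<phi> t \<partial>lebesgue) + (\<integral>\<^sup>+t\<in>{y..z}. \<phi> t \<partial>lebesgue)"
proof -
  have [measurable]: "\<phi> \<in> borel_measurable lebesgue" by fact
  have "(\<integral>\<^sup>+t\<in>{x..z}. \<phi> t \<partial>lebesgue)
      = (\<integral>\<^sup>+t. \<phi> t * indicator {x..y} t + \<phi> t * indicator {y..z} t \<partial>lebesgue)"
    by (intro nn_integral_cong_AE eventually_mono[OF AE_lebesgue_neq[of y]])
      (use assms(2,3) in \<open>auto simp: indicator_def\<close>)
  then show ?thesis by (simp add: nn_integral_add)
qed

lemma emeasure_lebesgue_Ioo: "a \<le> b \<Longrightarrow> emeasure lebesgue {a<..<b::real} = ennreal (b - a)"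
  by (simp add: emeasure_completion)

lemma emeasure_lebesgue_Icc: "a \<le> b \<Longrightarrow> emeasure lebesgue {a..b::real} = ennreal (b - a)"
  by (simp add: emeasure_completion)

lemma nn_integral_Icc_eq_Ioo:
  fixes \<phi> :: "real \<Rightarrow> ennreal"
  shows "(\<integral>\<^sup>+t\<in>{a..b}. \<phi> t \<partial>lebesgue) = (\<integral>\<^sup>+t\<in>{a<..<b}. \<phi> t \<partial>lebesgue)"
  by (rule nn_integral_cong_AE)
    (use AE_lebesgue_neq[of a] AE_lebesgue_neq[of b] in \<open>eventually_elim, auto simp: indicator_def\<close>)

locale rising_sun =
  fixes \<phi> :: "real \<Rightarrow> ennreal" and l :: real
  assumes meas[measurable]: "\<phi> \<in> borel_measurable lebesgue"
    and fin: "(\<integral>\<^sup>+t. \<phi> t \<partial>lebesgue) < \<infinity>"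
    and zero: "\<And>t. t > 0 \<Longrightarrow> \<phi> t = 0"
    and l_pos: "0 < l"
begin

text \<open>The primitive of \<phi>, tilted in \<open>H\<close> by the slope \<open>l\<close>. The
  mean of \<phi> over an interval exceeds \<open>l\<close> exactly if \<open>H\<close> is larger at
  the right end than at the left, so \<open>rs_set \<phi> l\<close> is the shaded set of F. Riesz
  for \<open>H\<close>.\<close>

definition "F x = enn2real (\<integral>\<^sup>+t\<in>{..x}. \<phi> t \<partial>lebesgue)"
definition "H x = F x - l * x"

lemma finite_on: "(\<integral>\<^sup>+t\<in>A. \<phi> t \<partial>lebesgue) < \<infinity>"
proof -
  have "(\<integral>\<^sup>+t\<in>A. \<phi> t \<partial>lebesgue) \<le> (\<integral>\<^sup>+t. \<phi> t \<partial>lebesgue)"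
    by (rule nn_integral_mono) (auto simp: indicator_def)
  with fin show ?thesis by order
qed

lemma ennreal_F: "ennreal (F x) = (\<integral>\<^sup>+t\<in>{..x}. \<phi> t \<partial>lebesgue)"
  unfolding F_def using finite_on[of "{..x}"] by (simp add: less_top)

lemma F_nonneg: "0 \<le> F x" by (simp add: F_def)

lemma F_le: "F x \<le> enn2real (\<integral>\<^sup>+t. \<phi> t \<partial>lebesgue)"
  unfolding F_def by (rule enn2real_mono[OF nn_integral_mono]) (use fin in \<open>auto simp: indicator_def\<close>)

lemma integral_eq_F:
  assumes "x \<le> y"
  shows "(\<integral>\<^sup>+t\<in>{x..y}. \<phi> t \<partial>lebesgue) = ennreal (F y - F x)" and "F x \<le> F y"
proof -
  have "(\<integral>\<^sup>+t\<in>{..y}. \<phi> t \<partial>lebesgue)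
      = (\<integral>\<^sup>+t. \<phi> t * indicator {..x} t + \<phi> t * indicator {x..y} t \<partial>lebesgue)"
    by (intro nn_integral_cong_AE eventually_mono[OF AE_lebesgue_neq[of x]])
      (use assms in \<open>auto simp: indicator_def\<close>)
  also have "\<dots> = (\<integral>\<^sup>+t\<in>{..x}. \<phi> t \<partial>lebesgue) + (\<integral>\<^sup>+t\<in>{x..y}. \<phi> t \<partial>lebesgue)"
    by (rule nn_integral_add) auto
  finally have e: "ennreal (F y) = ennreal (F x) + (\<integral>\<^sup>+t\<in>{x..y}. \<phi> t \<partial>lebesgue)"
    by (simp add: ennreal_F)
  obtain I where I: "0 \<le> I" "(\<integral>\<^sup>+t\<in>{x..y}. \<phi> t \<partial>lebesgue) = ennreal I"
    using finite_on[of "{x..y}"] by (metis ennreal_cases infinity_ennreal_def less_irrefl)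
  have "F y = F x + I" using e I F_nonneg[of x] F_nonneg[of y]
    by (simp flip: ennreal_plus)
  with I show "(\<integral>\<^sup>+t\<in>{x..y}. \<phi> t \<partial>lebesgue) = ennreal (F y - F x)" and "F x \<le> F y" by auto
qed

lemma continuous_F: "continuous_on UNIV F"
proof (intro continuous_at_imp_continuous_on ballI, unfold continuous_at_sequentially, intro allI impI)
  fix x and X :: "nat \<Rightarrow> real" assume X: "X \<longlonglongrightarrow> x"
  have "(\<lambda>n. \<integral>\<^sup>+t\<in>{..X n}. \<phi> t \<partial>lebesgue) \<longlonglongrightarrow> (\<integral>\<^sup>+t\<in>{..x}. \<phi> t \<partial>lebesgue)"
  proof (rule nn_integral_dominated_convergence[where w = \<phi>])
    show "AE t in lebesgue. (\<lambda>n. \<phi> t * indicator {..X n} t) \<longlonglongrightarrow> \<phi> t * indicator {..x} t"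
      using AE_lebesgue_neq[of x]
    proof eventually_elim
      case (elim t)
      have "\<forall>\<^sub>F n in sequentially. \<phi> t * indicator {..X n} t = \<phi> t * indicator {..x} t"
      proof (cases "t < x")
        case True
        then have "\<forall>\<^sub>F n in sequentially. t < X n" using X by (rule order_tendstoD(1)[rotated])
        then show ?thesis by eventually_elim (use True in auto)
      next
        case False
        then have "x < t" using elim by auto
        then have "\<forall>\<^sub>F n in sequentially. X n < t" using X by (rule order_tendstoD(2)[rotated])
        then show ?thesis by eventually_elim (use \<open>x < t\<close> in auto)
      qed
      then show ?case by (rule tendsto_eventually)
    qed
    show "AE t in lebesgue. \<phi> t * indicator {..X n} t \<le> \<phi> t" for n
      by (auto simp: indicator_def)
  qed (use fin in auto)
  then show "(F \<circ> X) \<longlonglongrightarrow> F x"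
    unfolding comp_def F_def[of x] using finite_on[of "{..x}"]
    by (subst F_def) (rule tendsto_enn2real, auto)
qed

lemma continuous_H: "continuous_on UNIV H"
  unfolding H_def[abs_def] by (intro continuous_intros continuous_F)

lemma lt_iff_H:
  assumes "x \<le> y"
  shows "ennreal (l * (y - x)) < (\<integral>\<^sup>+t\<in>{x..y}. \<phi> t \<partial>lebesgue) \<longleftrightarrow> H x < H y"
  using integral_eq_F[OF assms] l_pos assms
  by (auto simp: H_def ennreal_less_iff algebra_simps)

lemma le_iff_H:
  assumes "x \<le> y"
  shows "ennreal (l * (y - x)) \<le> (\<integral>\<^sup>+t\<in>{x..y}. \<phi> t \<partial>lebesgue) \<longleftrightarrow> H x \<le> H y"
  using integral_eq_F[OF assms] l_pos assms
  by (auto simp: H_def ennreal_le_iff algebra_simps)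

lemma in_rs_set_iff: "x \<in> rs_set \<phi> l \<longleftrightarrow> (\<exists>y>x. H x < H y)"
  unfolding rs_set_def using lt_iff_H by (auto intro: less_imp_le)

lemma rs_set_negative: "rs_set \<phi> l \<subseteq> {..<0}"
proof (rule subsetI, rule ccontr)
  fix x assume "x \<in> rs_set \<phi> l" "x \<notin> {..<0}"
  then obtain y where y: "y > x" "ennreal (l * (y - x)) < (\<integral>\<^sup>+t\<in>{x..y}. \<phi> t \<partial>lebesgue)" "0 \<le> x"
    by (auto simp: rs_set_def)
  have "(\<integral>\<^sup>+t\<in>{x..y}. \<phi> t \<partial>lebesgue) = (\<integral>\<^sup>+t. 0 \<partial>(lebesgue :: real measure))"
    by (intro nn_integral_cong_AE eventually_mono[OF AE_lebesgue_neq[of 0]])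
      (use \<open>0 \<le> x\<close> zero in \<open>auto simp: indicator_def\<close>)
  with y(2) show False by simp
qed

lemma open_rs_set: "open (rs_set \<phi> l)"
proof -
  have "rs_set \<phi> l = (\<Union>y. {x. H x < H y} \<inter> {..<y})"
    by (auto simp: in_rs_set_iff)
  moreover have "open {x. H x < H y}" for y
    by (intro open_Collect_less continuous_H continuous_on_const)
  ultimately show ?thesis by (simp add: open_UN open_Int)
qed

lemma sets_rs_set[measurable]: "rs_set \<phi> l \<in> sets lebesgue"
  using open_rs_set by auto

lemma notin_rs_setD:
  assumes "b \<notin> rs_set \<phi> l" "b \<le> y"
  shows "(\<integral>\<^sup>+t\<in>{b..y}. \<phi> t \<partial>lebesgue) \<le> ennreal (l * (y - b))"
proof (cases "b < y")
  case True
  with assms lt_iff_H[of b y] in_rs_set_iff[of b] show ?thesis by (metis less_imp_le not_less)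
next
  case False
  with assms have "b = y" by auto
  moreover have "(\<integral>\<^sup>+t\<in>{b..b}. \<phi> t \<partial>lebesgue) = (\<integral>\<^sup>+t. 0 \<partial>(lebesgue :: real measure))"
    by (rule nn_integral_cong_AE) (use AE_lebesgue_neq[of b] in \<open>eventually_elim, auto\<close>)
  ultimately show ?thesis by simp
qed

text \<open>Both endpoints lie outside the set. At \<open>a\<close> this bounds the mean of \<phi>
  over \<open>{a..b}\<close> by \<open>l\<close> from above. At \<open>b\<close> it makes
  \<open>rising_sun_le\<close> applicable, which bounds the mean from below.\<close>

lemma component:
  assumes C: "C \<in> components (rs_set \<phi> l)"
  obtains a b where "a < b" "b \<le> 0" "C = {a<..<b}" "b \<notin> rs_set \<phi> l"
    "(\<integral>\<^sup>+t\<in>{a..b}. \<phi> t \<partial>lebesgue) = ennreal (l * (b - a))"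
proof -
  have oC: "open C" using C open_rs_set open_components by blast
  have cC: "connected C" using C by (rule in_components_connected)
  have nC: "C \<noteq> {}" using C by (rule in_components_nonempty)
  have sC: "C \<subseteq> rs_set \<phi> l" using C by (rule in_components_subset)
  have neg: "C \<subseteq> {..<0}" using sC rs_set_negative by blast
  define b where "b = Sup C"
  have bdd: "bdd_above C" using neg by (meson bdd_above.I2 bdd_above_Iio bdd_above_mono)
  have b0: "b \<le> 0" unfolding b_def using nC neg by (intro cSup_least) auto
  have up: "\<And>x. x \<in> C \<Longrightarrow> x < b"
  proof -
    fix x assume "x \<in> C"
    then obtain e where e: "e > 0" "\<And>y. dist y x < e \<Longrightarrow> y \<in> C"
      using oC unfolding open_dist by blast
    then have "x + e/2 \<in> C" by (auto simp: dist_real_def)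
    then have "x + e/2 \<le> b" unfolding b_def using bdd by (auto intro: cSup_upper)
    then show "x < b" using e(1) by auto
  qed
  have ico: "{x..<b} \<subseteq> C" if "x \<in> C" for x
  proof
    fix t assume t: "t \<in> {x..<b}"
    obtain v where v: "v \<in> C" "t < v"
      using t nC bdd unfolding b_def by (metis less_cSup_iff atLeastLessThan_iff)
    show "t \<in> C" using connectedD_interval[OF cC that v(1)] t v by auto
  qed
  have bO: "b \<notin> rs_set \<phi> l"
  proof
    assume bin: "b \<in> rs_set \<phi> l"
    obtain x where x: "x \<in> C" using nC by auto
    have "{x..b} \<subseteq> C"
    proof (rule components_maximal[OF C])
      show "{x..b} \<subseteq> rs_set \<phi> l" 
      proof
        fix t assume "t \<in> {x..b}"
        then have "t \<in> {x..<b} \<or> t = b" by auto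
        then show "t \<in> rs_set \<phi> l" using ico[OF x] sC bin by blast
      qed
      show "C \<inter> {x..b} \<noteq> {}" using x up[OF x] by force
    qed simp
    then have "b \<in> C" using up[OF x] by auto
    with up show False by blast
  qed
  have Hb: "\<And>y. y > b \<Longrightarrow> H y \<le> H b" using bO in_rs_set_iff[of b] by (meson not_less)
  have Hx: "H x \<le> H b" if "x \<in> C" for x
  proof (rule rising_sun_le[OF continuous_H _ _ Hb])
    show "x \<le> b" using up[OF that] by simp
    fix z assume "x \<le> z" "z < b"
    then have "z \<in> rs_set \<phi> l" using ico[OF that] sC by auto
    then show "\<exists>y>z. H z < H y" by (simp add: in_rs_set_iff)
  qed
  \<comment> \<open>A component might a priori extend to minus infinity. As \<open>F\<close> takes
    values between 0 and the total integral, \<open>H x \<le> H b\<close> limits its length to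
    \<open>?N / l\<close>.\<close>
  let ?N = "enn2real (\<integral>\<^sup>+t. \<phi> t \<partial>lebesgue)"
  have "bounded C"
  proof (rule bounded_subset[OF bounded_closed_interval])
    show "C \<subseteq> {b - ?N / l .. b}"
    proof
      fix x assume x: "x \<in> C"
      have "l * (b - x) \<le> F b - F x" using Hx[OF x] by (simp add: H_def algebra_simps)
      also have "\<dots> \<le> ?N" using F_le[of b] F_nonneg[of x] by linarith
      finally have "b - x \<le> ?N / l" using l_pos by (simp add: field_simps)
      then show "x \<in> {b - ?N / l .. b}" using up[OF x] by auto
    qed
  qed
  then obtain a b' where ab: "a < b'" "C = {a<..<b'}"
    using open_interval_real[OF oC cC nC] by blast
  then have b': "b' = b" unfolding b_def by simp
  note ab = ab[unfolded b']
  have a: "a \<notin> rs_set \<phi> l" using component_endpoints_notin[of a b] C ab by simp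
  \<comment> \<open>The inequality \<open>H x \<le> H b\<close> is known inside the component;
    continuity extends it to the endpoint \<open>a\<close>.\<close>
  have "closure {a<..<b} \<subseteq> {x. H x \<le> H b}"
    using Hx ab(2) by (intro closure_minimal closed_Collect_le continuous_H continuous_on_const) auto
  then have "H a \<le> H b" using ab(1) by (auto simp: subset_iff)
  then have "ennreal (l * (b - a)) \<le> (\<integral>\<^sup>+t\<in>{a..b}. \<phi> t \<partial>lebesgue)"
    using le_iff_H[of a b] ab(1) by simp
  then have "(\<integral>\<^sup>+t\<in>{a..b}. \<phi> t \<partial>lebesgue) = ennreal (l * (b - a))"
    using notin_rs_setD[OF a, of b] ab(1) by (intro antisym) auto
  then show ?thesis by (rule that[OF ab(1) b0 ab(2) bO])
qed

text \<open>The weak type (1,1) bound for the one-sided maximal operator, with constant 1: on each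
  component the integral of \<phi> is exactly \<open>l\<close> times the length.\<close>

lemma emeasure_rs_set_le: "ennreal l * emeasure lebesgue (rs_set \<phi> l) \<le> (\<integral>\<^sup>+t. \<phi> t \<partial>lebesgue)"
proof -
  let ?O = "rs_set \<phi> l"
  have "emeasure (density lebesgue (\<lambda>_. ennreal l)) (\<Union>(components ?O)) \<le> emeasure (density lebesgue \<phi>) (\<Union>(components ?O))"
  proof (rule emeasure_Union_mono)
    show "countable (components ?O)" by (rule countable_components_real[OF open_rs_set])
    show "disjoint (components ?O)" by (rule disjoint_components)
    fix C assume C: "C \<in> components ?O"
    then have "open C" using open_rs_set open_components by blast
    then show m: "C \<in> sets (density lebesgue (\<lambda>_. ennreal l))" by auto
    from component[OF C] obtain a b where ab: "a < b" "C = {a<..<b}"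
       "(\<integral>\<^sup>+t\<in>{a..b}. \<phi> t \<partial>lebesgue) = ennreal (l * (b - a))" by metis
    show "emeasure (density lebesgue (\<lambda>_. ennreal l)) C \<le> emeasure (density lebesgue \<phi>) C"
      using ab l_pos m by (simp add: emeasure_density nn_integral_cmult_indicator
          nn_integral_Icc_eq_Ioo emeasure_lebesgue_Ioo ennreal_mult)
  qed auto
  then have "ennreal l * emeasure lebesgue ?O \<le> (\<integral>\<^sup>+t\<in>?O. \<phi> t \<partial>lebesgue)"
    by (simp add: Union_components emeasure_density nn_integral_cmult_indicator)
  also have "\<dots> \<le> (\<integral>\<^sup>+t. \<phi> t \<partial>lebesgue)" by (rule nn_integral_mono) (auto simp: indicator_def)
  finally show ?thesis .
qed

end

text \<open>A substitute for one-sided Lebesgue differentiation. A subset \<open>Y\<close> of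
  positive finite measure is covered tightly by an open set; started near the left end of
  \<open>Y\<close> in a component, the hypothesis shows that \<open>Y\<close> fills at most the
  proportion \<open>th\<close> of that component. Summing over the components contradicts the
  tightness of the cover.\<close>

lemma null_sets_if_one_sided_density_less:
  fixes Z :: "real set" and th :: real
  assumes Z: "Z \<in> sets lebesgue" and th: "0 < th" "th < 1"
    and d: "\<And>x y. x \<in> Z \<Longrightarrow> x < y \<Longrightarrow> emeasure lebesgue (Z \<inter> {x..y}) \<le> ennreal (th * (y - x))"
  shows "Z \<in> null_sets lebesgue"
proof -
  have null: "Y \<in> null_sets lebesgue"
    if Y: "Y \<in> sets lebesgue" "emeasure lebesgue Y < \<infinity>" and sub: "Y \<subseteq> Z" for Y
  proof (rule ccontr)
    assume "Y \<notin> null_sets lebesgue"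
    then obtain e where e: "0 < e" "emeasure lebesgue Y = ennreal e"
      using Y by (cases "emeasure lebesgue Y") (auto simp: null_sets_def le_less)
    \<comment> \<open>With this excess, th * (e + \<epsilon>) = e - e * (1 - th)^2, which cannot
      exceed \<open>e\<close>.\<close>
    define \<epsilon> where "\<epsilon> = (1 - th) * e"
    have "\<epsilon> > 0" using e th by (simp add: \<epsilon>_def)
    obtain U where U: "open U" "Y \<subseteq> U" "emeasure lebesgue (U - Y) < ennreal \<epsilon>"
      using sets_lebesgue_outer_open[OF Y(1) \<open>\<epsilon> > 0\<close>] by metis
    have dY: "emeasure lebesgue (Y \<inter> {x..y}) \<le> ennreal (th * (y - x))" if "x \<in> Y" "x < y" for x y
    proof -
      have "emeasure lebesgue (Y \<inter> {x..y}) \<le> emeasure lebesgue (Z \<inter> {x..y})"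
        using sub Z by (intro emeasure_mono) auto
      with d[of x y] that sub show ?thesis by force
    qed
    have C: "emeasure lebesgue (Y \<inter> C) \<le> ennreal th * emeasure lebesgue C" if C: "C \<in> components U" for C
    proof (cases "emeasure lebesgue C = \<infinity>")
      case True then show ?thesis using th by (simp add: ennreal_mult_top)
    next
      case False
      have oC: "open C" using C U open_components by blast
      have cC: "connected C" using C by (rule in_components_connected)
      have nC: "C \<noteq> {}" using C by (rule in_components_nonempty)
      have "bounded C"
      proof -
        obtain c where c: "0 \<le> c" "emeasure lebesgue C = ennreal c" using False by (cases "emeasure lebesgue C") auto
        have "dist x y \<le> c" if "x \<in> C" "y \<in> C" "x \<le> y" for x y
        proof -
          have "{x..y} \<subseteq> C" using connectedD_interval[OF cC that(1,2)] by auto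
          then have "emeasure lebesgue {x..y} \<le> emeasure lebesgue C" using oC by (intro emeasure_mono) auto
          then show ?thesis using c that by (simp add: emeasure_lebesgue_Icc dist_real_def)
        qed
        then have "\<forall>x\<in>C. \<forall>y\<in>C. dist x y \<le> c" by (metis dist_commute linear)
        then show ?thesis by (meson bounded_two_points)
      qed
      then obtain a b where ab: "a < b" "C = {a<..<b}" using open_interval_real[OF oC cC nC] by blast
      show ?thesis
      proof (cases "Y \<inter> C = {}")
        case ne: False
        have bb: "bdd_below (Y \<inter> C)" using ab by (auto intro!: bdd_belowI[of _ a])
        define x0 where "x0 = Inf (Y \<inter> C)"
        \<comment> \<open>The infimum \<open>x0\<close> need not belong to \<open>Y\<close>, so the
          hypothesis is applied at a point \<open>x\<close> of \<open>Y\<close> within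
          \<open>k\<close> of it; the gap \<open>{x0..x}\<close> costs at most \<open>k\<close>,
          which is arbitrary.\<close>
        have "emeasure lebesgue (Y \<inter> C) \<le> ennreal (th * (b - a)) + ennreal k" if "k > 0" for k
        proof -
          have "\<exists>x\<in>Y \<inter> C. x < x0 + k"
            unfolding x0_def by (rule cInf_lessD[OF ne]) (use that in simp)
          then obtain x where x: "x \<in> Y \<inter> C" "x < x0 + k" by blast
          have x0: "x0 \<le> x" unfolding x0_def by (rule cInf_lower[OF x(1) bb])
          have "emeasure lebesgue (Y \<inter> C) \<le> emeasure lebesgue ((Y \<inter> {x..b}) \<union> {x0..x})"
          proof (rule emeasure_mono)
            show "Y \<inter> C \<subseteq> Y \<inter> {x..b} \<union> {x0..x}"
            proof
              fix t assume t: "t \<in> Y \<inter> C"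
              then have "x0 \<le> t" unfolding x0_def by (rule cInf_lower[OF _ bb])
              with t ab show "t \<in> Y \<inter> {x..b} \<union> {x0..x}" by auto
            qed
          qed (use Y in auto)
          also have "\<dots> \<le> emeasure lebesgue (Y \<inter> {x..b}) + emeasure lebesgue {x0..x}"
            using Y by (intro emeasure_subadditive) auto
          also have "\<dots> \<le> ennreal (th * (b - a)) + ennreal k"
          proof (rule add_mono)
            have "emeasure lebesgue (Y \<inter> {x..b}) \<le> ennreal (th * (b - x))" using x ab by (intro dY) auto
            also have "\<dots> \<le> ennreal (th * (b - a))" using x ab th by (intro ennreal_leI) auto
            finally show "emeasure lebesgue (Y \<inter> {x..b}) \<le> ennreal (th * (b - a))" .
            show "emeasure lebesgue {x0..x} \<le> ennreal k"
              using x x0 by (simp add: emeasure_lebesgue_Icc ennreal_leI)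
          qed
          finally show ?thesis .
        qed
        then have "emeasure lebesgue (Y \<inter> C) \<le> ennreal (th * (b - a))"
          by (rule ennreal_le_epsilon) auto
        then show ?thesis using ab th by (simp add: emeasure_lebesgue_Ioo ennreal_mult)
      qed simp
    qed
    have "emeasure (density lebesgue (indicator Y)) (\<Union>(components U))
        \<le> emeasure (density lebesgue (\<lambda>_. ennreal th)) (\<Union>(components U))"
    proof (rule emeasure_Union_mono)
      show "countable (components U)" by (rule countable_components_real[OF U(1)])
      show "disjoint (components U)" by (rule disjoint_components)
      fix C assume C': "C \<in> components U"
      then have "open C" using U open_components by blast
      then show m: "C \<in> sets (density lebesgue (indicator Y))" by auto
      have "(\<integral>\<^sup>+t. indicator Y t * indicator C t \<partial>lebesgue) = emeasure lebesgue (Y \<inter> C)"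
        using m Y by (simp flip: indicator_inter_arith)
      then show "emeasure (density lebesgue (indicator Y)) C \<le> emeasure (density lebesgue (\<lambda>_. ennreal th)) C"
        using m Y C[OF C'] by (simp add: emeasure_density nn_integral_cmult_indicator)
    qed auto
    moreover have "(\<integral>\<^sup>+t. indicator Y t * indicator U t \<partial>lebesgue) = emeasure lebesgue Y"
      using Y U by (simp add: Int_absorb2 flip: indicator_inter_arith)
    ultimately have "emeasure lebesgue Y \<le> ennreal th * emeasure lebesgue U"
      using U Y by (simp add: Union_components emeasure_density nn_integral_cmult_indicator)
    also have "emeasure lebesgue U = emeasure lebesgue Y + emeasure lebesgue (U - Y)"
      using U Y by (subst plus_emeasure) (auto simp: Un_absorb1)
    also have "ennreal th * \<dots> < ennreal th * (ennreal e + ennreal \<epsilon>)"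
      using U(3) e th by (intro ennreal_mult_strict_left_mono) (auto simp: ennreal_add_left_cancel_less)
    also have "\<dots> = ennreal (th * (e + \<epsilon>))"
      using e th \<open>\<epsilon> > 0\<close> by (simp add: ennreal_mult flip: ennreal_plus)
    also have "\<dots> \<le> ennreal e"
    proof (rule ennreal_leI)
      have "e - th * (e + \<epsilon>) = e * (1 - th)^2" by (simp add: \<epsilon>_def power2_eq_square algebra_simps)
      moreover have "0 \<le> e * (1 - th)^2" using e by simp
      ultimately show "th * (e + \<epsilon>) \<le> e" by linarith
    qed
    finally show False using e by simp
  qed
  \<comment> \<open>The contradiction needs a set of finite measure, hence the exhaustion by bounded
    intervals.\<close>
  have eq: "Z = (\<Union>n::nat. Z \<inter> {- real n..real n})"
  proof (intro equalityI subsetI)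
    fix z assume "z \<in> Z"
    moreover obtain n :: nat where "\<bar>z\<bar> \<le> real n" using real_arch_simple by blast
    ultimately show "z \<in> (\<Union>n::nat. Z \<inter> {- real n..real n})" by (auto simp: abs_le_iff intro!: exI[of _ n])
  qed auto
  have "Z \<inter> {- real n..real n} \<in> null_sets lebesgue" for n
  proof (rule null)
    have "emeasure lebesgue (Z \<inter> {- real n..real n}) \<le> emeasure lebesgue {- real n..real n}"
      by (rule emeasure_mono) auto
    then show "emeasure lebesgue (Z \<inter> {- real n..real n}) < \<infinity>"
      by (simp add: emeasure_lebesgue_Icc order_le_less_trans)
  qed (use Z in auto)
  then show ?thesis by (subst eq) (rule null_sets_UN)
qed

subsection \<open>Hoelder's inequality and bounded functions with compact support\<close>

lemma ennpow_ennreal: "0 \<le> x \<Longrightarrow> ennpow (ennreal x) a = ennreal (x powr a)"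
  by (simp add: ennpow_def)

lemma ennpow_top [simp]: "ennpow top a = top" "ennpow \<infinity> a = \<infinity>"
  by (simp_all add: ennpow_def)

lemma ennpow_0 [simp]: "ennpow 0 a = 0"
  by (simp add: ennpow_def)

lemma ennpow_1 [simp]: "ennpow x 1 = x"
  by (cases x) (auto simp: ennpow_ennreal)

lemma ennpow_mono: "x \<le> y \<Longrightarrow> 0 \<le> a \<Longrightarrow> ennpow x a \<le> ennpow y a"
  by (cases x; cases y) (auto simp: ennpow_ennreal top_unique intro!: ennreal_leI powr_mono2)

lemma ennpow_ennpow: "0 < a \<Longrightarrow> ennpow (ennpow x a) b = ennpow x (a * b)"
  by (cases x) (auto simp: ennpow_ennreal powr_powr)

lemma ennpow_inverse_cancel: "0 < a \<Longrightarrow> ennpow (ennpow x (1 / a)) a = x"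
  "0 < a \<Longrightarrow> ennpow (ennpow x a) (1 / a) = x"
  by (simp_all add: ennpow_ennpow)

lemma ennpow_mono_iff: "0 < a \<Longrightarrow> ennpow x a \<le> ennpow y a \<longleftrightarrow> x \<le> y"
  by (metis ennpow_inverse_cancel(2) ennpow_mono less_imp_le zero_less_divide_1_iff)

lemma ennpow_less_iff: "0 < a \<Longrightarrow> ennpow x a < ennpow y a \<longleftrightarrow> x < y"
  using ennpow_mono_iff[of a y x] by (auto simp: not_le[symmetric])

lemma ennpow_eq_0_iff: "0 < a \<Longrightarrow> ennpow x a = 0 \<longleftrightarrow> x = 0"
  using ennpow_mono_iff[of a x 0] by simp

lemma ennpow_less_top_iff: "ennpow x a < top \<longleftrightarrow> x < top"
  by (cases x) (auto simp: ennpow_ennreal)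

lemma ennpow_mult: "0 < a \<Longrightarrow> ennpow (x * y) a = ennpow x a * ennpow y a"
proof (cases "x = top \<or> y = top")
  case True
  assume "0 < a"
  with True show ?thesis
    by (cases "x = 0"; cases "y = 0")
      (auto simp: ennreal_top_mult ennreal_mult_top ennpow_eq_0_iff)
next
  case False
  then show ?thesis
    by (cases x; cases y) (auto simp: ennpow_ennreal powr_mult simp flip: ennreal_mult)
qed

lemma measurable_ennpow [measurable]:
  "f \<in> borel_measurable M \<Longrightarrow> (\<lambda>x. ennpow (f x) a) \<in> borel_measurable M"
  unfolding ennpow_def by simp

lemma ennpow_root_bound:
  assumes "0 < p" "0 \<le> B" "ennpow x (1 / p) \<le> ennreal B * ennpow y (1 / p)"
  shows "x \<le> ennreal (B powr p) * y"
  using ennpow_mono[OF assms(3), of p] assms(1,2)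
  by (simp add: ennpow_mult ennpow_inverse_cancel ennpow_ennreal)

text \<open>In the extended half-line the degenerate cases are separate: a vanishing factor makes
  the product vanish almost everywhere, and an infinite factor next to a nonzero one makes the right
  side infinite. Otherwise Young's inequality is integrated after normalization.\<close>

lemma nn_integral_Holder:
  fixes f g :: "'m \<Rightarrow> real"
  assumes [measurable]: "f \<in> borel_measurable M" "g \<in> borel_measurable M"
    and nn: "\<And>x. 0 \<le> f x" "\<And>x. 0 \<le> g x" and p: "1 < p" and q: "1 / p + 1 / q = 1"
  shows "(\<integral>\<^sup>+x. ennreal (f x * g x) \<partial>M)
    \<le> ennpow (\<integral>\<^sup>+x. ennreal (f x powr p) \<partial>M) (1 / p) * ennpow (\<integral>\<^sup>+x. ennreal (g x powr q) \<partial>M) (1 / q)"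
    (is "?L \<le> ennpow ?A _ * ennpow ?B _")
proof -
  have "1 / p < 1" "0 < 1 / p" using p by auto
  then have iq: "0 < 1 / q" "1 / q < 1" using q by linarith+
  have q1: "1 < q" using iq by (simp add: divide_less_eq)
  consider "?A = 0 \<or> ?B = 0" | "?A \<noteq> 0" "?B \<noteq> 0" "?A = top \<or> ?B = top"
    | "?A \<noteq> 0" "?B \<noteq> 0" "?A \<noteq> top" "?B \<noteq> top" by blast
  then show ?thesis
  proof cases
    case 1
    then have "AE x in M. f x powr p = 0 \<or> g x powr q = 0"
      by (auto simp: nn_integral_0_iff_AE intro: eventually_mono)
    then have "AE x in M. ennreal (f x * g x) = 0"
      by (rule eventually_mono) (use p q1 in auto)
    then have "?L = 0" by (subst nn_integral_0_iff_AE) auto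
    then show ?thesis by simp
  next
    case 2
    have "ennpow ?A (1 / p) \<noteq> 0" "ennpow ?B (1 / q) \<noteq> 0"
      using 2 p iq by (auto simp: ennpow_eq_0_iff)
    with 2(3) show ?thesis by (auto simp: ennreal_top_mult ennreal_mult_top)
  next
    case 3
    obtain A where A: "0 < A" "?A = ennreal A" using 3 by (cases ?A) (auto simp: le_less)
    obtain B where B: "0 < B" "?B = ennreal B" using 3 by (cases ?B) (auto simp: le_less)
    define a where "a = A powr (1 / p)"
    define b where "b = B powr (1 / q)"
    have ab: "0 < a" "0 < b" using A B by (auto simp: a_def b_def)
    have aA: "a powr p = A" "b powr q = B" using A B p q1 by (auto simp: a_def b_def powr_powr)
    \<comment> \<open>The coefficients of Young's inequality for \<open>f x / a\<close> and
      \<open>g x / b\<close>, multiplied by \<open>a * b\<close>. After integration they give a * b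
      * (1 / p + 1 / q) = a * b, the product of the two norms.\<close>
    define u where "u = a * b / (p * A)"
    define v where "v = a * b / (q * B)"
    have uv: "0 \<le> u" "0 \<le> v" using ab A B p q1 by (auto simp: u_def v_def)
    have "u * A + v * B = a * b * (1 / p + 1 / q)"
      using A B by (simp add: u_def v_def distrib_left)
    then have uvAB: "u * A + v * B = a * b" using q by simp
    have pt: "f x * g x \<le> u * f x powr p + v * g x powr q" for x
    proof -
      have "(f x / a) * (g x / b) \<le> (f x / a) powr p / p + (g x / b) powr q / q"
        by (rule Youngs_inequality) (use p q1 q nn ab in auto)
      also have "\<dots> = f x powr p / (p * A) + g x powr q / (q * B)"
        using nn ab by (simp add: powr_divide aA mult.commute)
      finally have "(a * b) * ((f x / a) * (g x / b)) \<le> (a * b) * (f x powr p / (p * A) + g x powr q / (q * B))"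
        by (rule mult_left_mono) (use ab in simp)
      moreover have "(a * b) * ((f x / a) * (g x / b)) = f x * g x" using ab by simp
      ultimately show ?thesis by (simp add: u_def v_def distrib_left)
    qed
    have "?L \<le> (\<integral>\<^sup>+x. ennreal u * ennreal (f x powr p) + ennreal v * ennreal (g x powr q) \<partial>M)"
    proof (rule nn_integral_mono)
      fix x
      have "ennreal (f x * g x) \<le> ennreal (u * f x powr p + v * g x powr q)"
        by (rule ennreal_leI[OF pt])
      then show "ennreal (f x * g x) \<le> ennreal u * ennreal (f x powr p) + ennreal v * ennreal (g x powr q)"
        using uv by (simp add: ennreal_mult')
    qed
    also have "\<dots> = ennreal u * ?A + ennreal v * ?B"
      by (simp add: nn_integral_add nn_integral_cmult)
    also have "\<dots> = ennreal (u * A + v * B)"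
      using uv A B by (simp add: ennreal_mult)
    also have "\<dots> = ennreal (a * b)" by (simp only: uvAB)
    finally show ?thesis using A B ab by (simp add: ennpow_ennreal a_def b_def ennreal_mult)
  qed
qed

section \<open>Lebesgue spaces, essential support and the class \<open>Linf_c\<close>\<close>

lemma Lp_norm_less_top_iff:
  "Lp_norm p f < \<infinity> \<longleftrightarrow> (\<integral>\<^sup>+t. ennreal (norm (f t) powr p) \<partial>lebm) < \<infinity>"
  unfolding Lp_norm_def by (simp add: ennpow_less_top_iff)

lemma Int_space_lebm: "A \<in> sets lebesgue \<Longrightarrow> A \<inter> space lebm \<in> sets lebm"
  by (auto simp: sets_restrict_space_iff space_restrict_space)

text \<open>Each point outside the support has a neighbourhood on which \<open>f\<close> vanishes
  almost everywhere, and it may be shrunk to one with rational endpoints. Thus only countably many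
  null sets are discarded.\<close>

lemma AE_zero_outside_ess_supp: "AE t in lebm. t \<notin> ess_supp f \<longrightarrow> f t = 0"
proof -
  define Q where "Q = {(a, b). a \<in> \<rat> \<and> b \<in> \<rat> \<and> (AE s in lebm. a < s \<and> s < b \<longrightarrow> f s = 0)}"
  have "countable Q"
    by (rule countable_subset[of _ "\<rat> \<times> \<rat>"]) (auto simp: Q_def intro: countable_rat)
  then have "AE s in lebm. \<forall>(a, b)\<in>Q. a < s \<and> s < b \<longrightarrow> f s = 0"
    by (subst AE_ball_countable) (auto simp: Q_def)
  then show ?thesis
    using AE_space
  proof eventually_elim
    case (elim t)
    show ?case
    proof
      assume t: "t \<notin> ess_supp f"
      then obtain e where e: "e > 0" "AE s in lebm. \<bar>s - t\<bar> < e \<longrightarrow> f s = 0"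
        using elim(2) by (auto simp: ess_supp_def space_restrict_space)
      obtain a where a: "a \<in> \<rat>" "t - e < a" "a < t" using Rats_dense_in_real[of "t - e" t] e by auto
      obtain b where b: "b \<in> \<rat>" "t < b" "b < t + e" using Rats_dense_in_real[of t "t + e"] e by auto
      have "AE s in lebm. a < s \<and> s < b \<longrightarrow> f s = 0"
        using e(2) by eventually_elim (use a b in auto)
      then have "(a, b) \<in> Q" using a b by (auto simp: Q_def)
      with elim(1) a b show "f t = 0" by auto
    qed
  qed
qed

lemma notin_ess_suppI:
  assumes "open U" "t \<in> U" "AE s in lebm. s \<in> U \<longrightarrow> f s = 0"
  shows "t \<notin> ess_supp f"
proof -
  obtain e where e: "e > 0" "\<And>s. dist s t < e \<Longrightarrow> s \<in> U" using assms(1,2) unfolding open_dist by blast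
  have "AE s in lebm. \<bar>s - t\<bar> < e \<longrightarrow> f s = 0"
    using assms(3) by eventually_elim (use e in \<open>auto simp: dist_real_def\<close>)
  with e(1) show ?thesis by (auto simp: ess_supp_def)
qed

lemma closed_ess_supp: "closed (ess_supp f)"
proof -
  have "open (- ess_supp f)"
    unfolding open_dist
  proof
    fix t assume t: "t \<in> - ess_supp f"
    show "\<exists>e>0. \<forall>y. dist y t < e \<longrightarrow> y \<in> - ess_supp f"
    proof (cases "t \<le> 0")
      case True
      then obtain e where e: "e > 0" "AE s in lebm. \<bar>s - t\<bar> < e \<longrightarrow> f s = 0"
        using t by (auto simp: ess_supp_def)
      have "y \<in> - ess_supp f" if "dist y t < e" for y
        using notin_ess_suppI[of "ball t e" y f] e(2) that by (auto simp: dist_real_def abs_minus_commute)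
      with e(1) show ?thesis by blast
    next
      case False
      then have "y \<in> - ess_supp f" if "dist y t < t" for y
        using that by (auto simp: ess_supp_def dist_real_def)
      with False show ?thesis by (intro exI[of _ t]) auto
    qed
  qed
  then show ?thesis by (simp add: closed_def)
qed

text \<open>The essential support is always closed and contained in \<open>Rm\<close>, so its
  compactness only means that \<open>f\<close> vanishes almost everywhere far to the left.\<close>

lemma Linf_c_iff:
  "f \<in> Linf_c \<longleftrightarrow> strongly_measurable lebm f \<and> (\<exists>B. AE t in lebm. norm (f t) \<le> B) \<and>
     (\<exists>R. AE t in lebm. t < - R \<longrightarrow> f t = 0)"
proof -
  have "compact (ess_supp f) \<longleftrightarrow> (\<exists>R. AE t in lebm. t < - R \<longrightarrow> f t = 0)"
  proof
    assume "compact (ess_supp f)"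
    then obtain R where R: "\<And>t. t \<in> ess_supp f \<Longrightarrow> norm t \<le> R"
      using compact_imp_bounded bounded_iff by metis
    have "AE t in lebm. t < - R \<longrightarrow> f t = 0"
      using AE_zero_outside_ess_supp[of f] by eventually_elim (use R in force)
    then show "\<exists>R. AE t in lebm. t < - R \<longrightarrow> f t = 0" ..
  next
    assume "\<exists>R. AE t in lebm. t < - R \<longrightarrow> f t = 0"
    then obtain R where R: "AE t in lebm. t < - R \<longrightarrow> f t = 0" ..
    have "ess_supp f \<subseteq> {-R..0}"
    proof
      fix t assume t: "t \<in> ess_supp f"
      then have "t \<le> 0" by (auto simp: ess_supp_def)
      moreover have "\<not> t < - R"
        using notin_ess_suppI[of "{..< - R}" t f] R t by auto
      ultimately show "t \<in> {-R..0}" by auto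
    qed
    then show "compact (ess_supp f)"
      using closed_ess_supp by (metis compact_Icc compact_Int_closed inf.absorb_iff2)
  qed
  then show ?thesis by (simp add: Linf_c_def)
qed

lemma Linf_cE:
  assumes "f \<in> Linf_c"
  obtains B R where "strongly_measurable lebm f" "0 \<le> B" "0 \<le> R"
    "AE t in lebm. norm (f t) \<le> B * indicator {-R..0} t"
proof -
  obtain B R where sm: "strongly_measurable lebm f" and BR: "AE t in lebm. norm (f t) \<le> B" "AE t in lebm. t < - R \<longrightarrow> f t = 0"
    using assms by (auto simp: Linf_c_iff)
  have "AE t in lebm. norm (f t) \<le> max 0 B * indicator {- max 0 R..0} t"
    using BR AE_space
  proof eventually_elim
    case (elim t)
    then have "0 \<le> B" using norm_ge_zero[of "f t"] by linarith
    with elim show ?case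
      by (cases "t < - R") (auto simp: indicator_def space_restrict_space max_def)
  qed
  with that[OF sm, of "max 0 B" "max 0 R"] show ?thesis by auto
qed

lemma Linf_cI:
  assumes "strongly_measurable lebm f" "AE t in lebm. norm (f t) \<le> B * indicator {-R..0} t"
  shows "f \<in> Linf_c"
proof -
  have "AE t in lebm. norm (f t) \<le> \<bar>B\<bar>" using assms(2) 
  proof eventually_elim
    case (elim t)
    then show ?case by (cases "t \<in> {-R..0}") auto
  qed
  moreover have "AE t in lebm. t < - R \<longrightarrow> f t = 0"
    using assms(2) by eventually_elim (auto simp: indicator_def split: if_splits)
  ultimately show ?thesis using assms(1) by (auto simp: Linf_c_iff)
qed

lemma Linf_c_norm_measurable:
  "f \<in> Linf_c \<Longrightarrow> (\<lambda>t. norm (f t)) \<in> borel_measurable lebm"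
  by (auto simp: Linf_c_def intro!: strongly_measurable_norm complete_measure_lebm)

lemma Linf_c_powr_integrable:
  assumes "f \<in> Linf_c" "0 < p"
  shows "(\<integral>\<^sup>+t. ennreal (norm (f t) powr p) \<partial>lebm) < \<infinity>"
proof -
  obtain B R where BR: "0 \<le> B" "0 \<le> R" "AE t in lebm. norm (f t) \<le> B * indicator {-R..0} t"
    using assms(1) by (elim Linf_cE)
  have "(\<integral>\<^sup>+t. ennreal (norm (f t) powr p) \<partial>lebm) \<le> (\<integral>\<^sup>+t. ennreal (B powr p) * indicator {-R..0} t \<partial>lebm)"
  proof (rule nn_integral_mono_AE, use BR(3) in eventually_elim)
    case (elim t)
    have "norm (f t) powr p \<le> (B * indicator {-R..0} t) powr p"
      using elim assms(2) by (intro powr_mono2) auto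
    then show ?case by (auto simp: indicator_def ennreal_leI split: if_splits)
  qed
  also have "\<dots> = (\<integral>\<^sup>+t. ennreal (B powr p) * indicator {-R..0} t \<partial>lebesgue)"
    unfolding nn_integral_lebm by (intro nn_integral_cong) (auto simp: indicator_def)
  also have "\<dots> = ennreal (B powr p) * ennreal R"
    using BR by (subst nn_integral_cmult_indicator) (auto simp: emeasure_completion)
  also have "\<dots> < \<infinity>" by (simp add: ennreal_mult_less_top)
  finally show ?thesis .
qed

lemma Linf_c_integrable: "f \<in> Linf_c \<Longrightarrow> (\<integral>\<^sup>+t. ennreal (norm (f t)) \<partial>lebm) < \<infinity>"
  using Linf_c_powr_integrable[of f 1] by simp

lemma Linf_c_subset_Lp: "0 < p \<Longrightarrow> Linf_c \<subseteq> Lp p"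
  using Linf_c_powr_integrable unfolding Lp_def Lp_norm_less_top_iff
  by (auto elim: Linf_cE)

lemma Linf_c_indicator:
  assumes "f \<in> Linf_c" "A \<in> sets lebesgue"
  shows "(\<lambda>t. indicator A t *\<^sub>R f t) \<in> Linf_c"
proof -
  obtain B R where BR: "strongly_measurable lebm f" "AE t in lebm. norm (f t) \<le> B * indicator {-R..0} t" "0 \<le> B"
    using assms(1) by (elim Linf_cE)
  show ?thesis
  proof (rule Linf_cI)
    show "strongly_measurable lebm (\<lambda>t. indicator A t *\<^sub>R f t)"
      using assms(2) by (intro strongly_measurable_indicator_scaleR BR(1) Int_space_lebm)
    show "AE t in lebm. norm (indicator A t *\<^sub>R f t) \<le> B * indicator {-R..0} t"
      using BR(2) by eventually_elim (use BR(3) in \<open>auto simp: indicator_def\<close>)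
  qed
qed

lemma Linf_c_add:
  assumes "f \<in> Linf_c" "g \<in> Linf_c"
  shows "(\<lambda>t. f t + g t) \<in> Linf_c"
proof -
  obtain B R where 1: "strongly_measurable lebm f" "AE t in lebm. norm (f t) \<le> B * indicator {-R..0} t" "0 \<le> B" "0 \<le> R"
    using assms(1) by (elim Linf_cE)
  obtain B' R' where 2: "strongly_measurable lebm g" "AE t in lebm. norm (g t) \<le> B' * indicator {-R'..0} t" "0 \<le> B'" "0 \<le> R'"
    using assms(2) by (elim Linf_cE)
  show ?thesis
  proof (rule Linf_cI)
    show "strongly_measurable lebm (\<lambda>t. f t + g t)" by (intro strongly_measurable_add 1 2)
    show "AE t in lebm. norm (f t + g t) \<le> (B + B') * indicator {- max R R'..0} t"
      using 1(2) 2(2)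
    proof eventually_elim
      case (elim t)
      have "norm (f t + g t) \<le> B * indicator {-R..0} t + B' * indicator {-R'..0} t"
        using norm_triangle_ineq[of "f t" "g t"] elim by linarith
      also have "\<dots> \<le> (B + B') * indicator {- max R R'..0} t"
        using 1(3) 2(3) by (auto simp: indicator_def max_def)
      finally show ?case .
    qed
  qed
qed

lemma Linf_c_scaleR:
  assumes "f \<in> Linf_c" shows "(\<lambda>t. c *\<^sub>R f t) \<in> Linf_c"
proof -
  obtain B R where BR: "strongly_measurable lebm f" "AE t in lebm. norm (f t) \<le> B * indicator {-R..0} t" "0 \<le> B"
    using assms(1) by (elim Linf_cE)
  show ?thesis
  proof (rule Linf_cI)
    show "strongly_measurable lebm (\<lambda>t. c *\<^sub>R f t)"
      by (intro strongly_measurable_compose_linear[OF _ BR(1)] bounded_linear_scaleR_right)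
    show "AE t in lebm. norm (c *\<^sub>R f t) \<le> (\<bar>c\<bar> * B) * indicator {-R..0} t"
      using BR(2)
    proof eventually_elim
      case (elim t)
      have "norm (c *\<^sub>R f t) = \<bar>c\<bar> * norm (f t)" by simp
      also have "\<dots> \<le> \<bar>c\<bar> * (B * indicator {-R..0} t)" using elim by (rule mult_left_mono) simp
      finally show ?case by (simp add: mult.assoc)
    qed
  qed
qed

lemma Linf_c_diff:
  assumes "f \<in> Linf_c" "g \<in> Linf_c"
  shows "(\<lambda>t. f t - g t) \<in> Linf_c"
  using Linf_c_add[OF assms(1) Linf_c_scaleR[OF assms(2), of "-1"]] by simp

lemma Linf_c_indicator_const:
  assumes "a \<le> b"
  shows "(\<lambda>t. indicator {a<..<b} t *\<^sub>R c) \<in> Linf_c"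
proof (rule Linf_cI)
  show "strongly_measurable lebm (\<lambda>t. indicator {a<..<b} t *\<^sub>R c)"
    by (rule strongly_measurable_indicator_scaleR[OF strongly_measurable_const])
      (rule Int_space_lebm, simp)
  show "AE t in lebm. norm (indicator {a<..<b} t *\<^sub>R c) \<le> norm c * indicator {- (-a)..0} t"
    using AE_space by eventually_elim (auto simp: indicator_def space_restrict_space)
qed

lemma Linf_c_zero: "(\<lambda>t. 0) \<in> Linf_c"
  by (rule Linf_cI[of _ 0 0]) (use strongly_measurable_const in simp_all)

subsection \<open>Kernel estimates\<close>

lemma nn_integral_lebm_subset:
  "A \<subseteq> Rm \<Longrightarrow> (\<integral>\<^sup>+t\<in>A. f t \<partial>lebesgue) = (\<integral>\<^sup>+t\<in>A. f t \<partial>lebm)"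
  unfolding nn_integral_lebm by (intro nn_integral_cong) (auto simp: indicator_def)

lemma measurable_indicator_lebm:
  "A \<in> sets lebesgue \<Longrightarrow> (indicator A :: real \<Rightarrow> 'b::{zero_neq_one,topological_space}) \<in> borel_measurable lebm"
  by (rule measurable_restrict_space1) simp

text \<open>Lebesgue measure on the plane is the completion of the product measure. Preimages of
  Lebesgue sets under a projection are therefore measurable because null sets pull back to null
  strips.\<close>

lemma measurable_fst_lebesgue: "fst \<in> (lebesgue :: (real \<times> real) measure) \<rightarrow>\<^sub>M (lebesgue :: real measure)"
  and measurable_snd_lebesgue: "snd \<in> (lebesgue :: (real \<times> real) measure) \<rightarrow>\<^sub>M (lebesgue :: real measure)"
  and null_sets_fst: "A \<in> null_sets (lebesgue :: real measure) \<Longrightarrow> A \<times> (UNIV :: real set) \<in> null_sets lebesgue"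
proof -
  have m: "fst \<in> (lebesgue :: (real \<times> real) measure) \<rightarrow>\<^sub>M (lborel :: real measure)"
    "snd \<in> (lebesgue :: (real \<times> real) measure) \<rightarrow>\<^sub>M (lborel :: real measure)"
    by (auto intro!: measurable_completion simp: borel_prod[symmetric])
  have n1: "A \<times> (UNIV :: real set) \<in> null_sets lborel" if "A \<in> null_sets lborel" for A :: "real set"
    using that by (auto simp: null_sets_def lborel_prod[symmetric] lborel.emeasure_pair_measure_Times simp del: sets_lborel)
  have n2: "(UNIV :: real set) \<times> A \<in> null_sets lborel" if "A \<in> null_sets lborel" for A :: "real set"
    using that by (auto simp: null_sets_def lborel_prod[symmetric] lborel.emeasure_pair_measure_Times simp del: sets_lborel)
  have v: "fst -` A = A \<times> (UNIV :: real set)" "snd -` A = (UNIV :: real set) \<times> A" for A :: "real set" by auto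
  show "fst \<in> (lebesgue :: (real \<times> real) measure) \<rightarrow>\<^sub>M (lebesgue :: real measure)"
  proof (rule completion.measurable_completion2[OF m(1)], rule subsetI)
    fix A :: "real set" assume A: "A \<in> null_sets lborel"
    have "emeasure (distr (lebesgue :: (real \<times> real) measure) lborel fst) A
        = emeasure lebesgue (fst -` A \<inter> space (lebesgue :: (real \<times> real) measure))"
      by (rule emeasure_distr[OF m(1) null_setsD2[OF A]])
    also have "\<dots> = 0" using null_sets_completionI[OF n1[OF A]] by (simp add: v null_sets_def)
    finally show "A \<in> null_sets (distr (lebesgue :: (real \<times> real) measure) lborel fst)" using A by (simp add: null_sets_def)
  qed
  show "snd \<in> (lebesgue :: (real \<times> real) measure) \<rightarrow>\<^sub>M (lebesgue :: real measure)"
  proof (rule completion.measurable_completion2[OF m(2)], rule subsetI)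
    fix A :: "real set" assume A: "A \<in> null_sets lborel"
    have "emeasure (distr (lebesgue :: (real \<times> real) measure) lborel snd) A
        = emeasure lebesgue (snd -` A \<inter> space (lebesgue :: (real \<times> real) measure))"
      by (rule emeasure_distr[OF m(2) null_setsD2[OF A]])
    also have "\<dots> = 0" using null_sets_completionI[OF n2[OF A]] by (simp add: v null_sets_def)
    finally show "A \<in> null_sets (distr (lebesgue :: (real \<times> real) measure) lborel snd)" using A by (simp add: null_sets_def)
  qed
  show "A \<times> (UNIV :: real set) \<in> null_sets lebesgue" if A: "A \<in> null_sets lebesgue"
  proof -
    obtain N where N: "N \<in> null_sets lborel" "A \<subseteq> N" using A by (auto simp: null_sets_completion_iff2)
    then have "A \<times> (UNIV :: real set) \<subseteq> N \<times> UNIV" by auto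
    with n1[OF N(1)] show ?thesis by (auto simp: null_sets_completion_iff2)
  qed
qed

text \<open>Measurability of \<open>h\<close> keeps the approximants simple; the third hypothesis
  says that preimages of null sets are negligible, so that almost everywhere convergence survives
  the substitution.\<close>

lemma strongly_measurable_compose_measurable:
  fixes f :: "'n \<Rightarrow> 'b::real_normed_vector"
  assumes f: "strongly_measurable N f" and h: "h \<in> M \<rightarrow>\<^sub>M N"
    and ae: "\<And>P. (AE x in N. P x) \<Longrightarrow> (AE x in M. P (h x))"
  shows "strongly_measurable M (\<lambda>x. f (h x))"
proof -
  obtain u where u: "\<And>i. simple_function N (u i)" "AE x in N. (\<lambda>i. u i x) \<longlonglongrightarrow> f x"
    using f unfolding strongly_measurable_def by blast
  have "simple_function M (\<lambda>x. u i (h x))" for i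
    unfolding simple_function_def
  proof
    have sub: "(\<lambda>x. u i (h x)) ` space M \<subseteq> u i ` space N"
      using measurable_space[OF h] by auto
    show "finite ((\<lambda>x. u i (h x)) ` space M)"
      by (rule finite_subset[OF sub]) (use u(1)[of i] in \<open>auto simp: simple_function_def\<close>)
    show "\<forall>x\<in>(\<lambda>x. u i (h x)) ` space M. (\<lambda>x. u i (h x)) -` {x} \<inter> space M \<in> sets M"
    proof
      fix y assume "y \<in> (\<lambda>x. u i (h x)) ` space M"
      then have "u i -` {y} \<inter> space N \<in> sets N"
        using u(1)[of i] sub by (auto simp: simple_function_def)
      from measurable_sets[OF h this]
      show "(\<lambda>x. u i (h x)) -` {y} \<inter> space M \<in> sets M"
        by (rule back_subst[of "\<lambda>A. A \<in> sets M"]) (use measurable_space[OF h] in auto)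
    qed
  qed
  then show ?thesis unfolding strongly_measurable_def using ae[OF u(2)] by (intro exI[of _ "\<lambda>i x. u i (h x)"]) auto
qed

abbreviation lebm2 :: "(real \<times> real) measure" where
  "lebm2 \<equiv> lebesgue_on (Rm \<times> Rm)"

lemma Rm2_sets: "Rm \<times> Rm \<in> sets (lebesgue :: (real \<times> real) measure)"
  by (simp add: borel_closed closed_Times)

lemma measurable_fst_lebm: "fst \<in> lebm2 \<rightarrow>\<^sub>M lebm"
  by (rule measurable_restrict_space3[OF measurable_fst_lebesgue]) auto

lemma measurable_snd_lebm: "snd \<in> lebm2 \<rightarrow>\<^sub>M lebm"
  by (rule measurable_restrict_space3[OF measurable_snd_lebesgue]) auto

lemma AE_fst_lebm:
  assumes "AE t in lebm. P t" shows "AE x in lebm2. P (fst x)"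
proof -
  have "AE t in lebesgue. t \<le> 0 \<longrightarrow> P t" using assms by (simp add: AE_lebm_iff)
  then obtain N where N: "N \<in> null_sets lebesgue" "{t. \<not> (t \<le> 0 \<longrightarrow> P t)} \<subseteq> N"
    by (auto simp: completion.AE_iff_null_sets)
  have "AE x in lebesgue. x \<notin> N \<times> (UNIV :: real set)" by (rule AE_not_in[OF null_sets_fst[OF N(1)]])
  then have "AE x in lebesgue. x \<in> Rm \<times> Rm \<longrightarrow> P (fst x)"
    by eventually_elim (use N(2) in auto)
  then show ?thesis by (subst AE_restrict_space_iff) (use Rm2_sets in auto)
qed

text \<open>A function measurable for the completion agrees with a Borel function off a Borel null
  set \<open>N\<close>. Almost every section of \<open>N\<close> in either direction is null, so
  both iterated integrals equal those of the Borel function.\<close>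

lemma Tonelli_lebesgue:
  fixes F :: "real \<times> real \<Rightarrow> ennreal"
  assumes F: "F \<in> borel_measurable lebesgue"
  shows "(\<integral>\<^sup>+t. (\<integral>\<^sup>+s. F (t, s) \<partial>lebesgue) \<partial>lebesgue) = (\<integral>\<^sup>+s. (\<integral>\<^sup>+t. F (t, s) \<partial>lebesgue) \<partial>lebesgue)"
proof -
  obtain F' where F': "F' \<in> borel_measurable lborel" "AE x in lborel. F x = F' x"
    using completion_ex_borel_measurable[OF F] by blast
  have [measurable]: "F' \<in> borel_measurable (lborel \<Otimes>\<^sub>M lborel)" using F'(1) by (simp add: lborel_prod)
  obtain N where N: "N \<in> null_sets (lborel \<Otimes>\<^sub>M lborel)" "{x. F x \<noteq> F' x} \<subseteq> N"
    using F'(2) by (auto elim!: AE_E simp: lborel_prod null_sets_def)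
  have [measurable]: "N \<in> sets (lborel \<Otimes>\<^sub>M lborel)" using N(1) by auto
  have FN: "F x = F' x" if "x \<notin> N" for x using N(2) that by blast
  have "AE x in lborel \<Otimes>\<^sub>M lborel. x \<notin> N" by (rule AE_not_in[OF N(1)])
  then have a1: "AE t in lborel. AE s in lborel. (t, s) \<notin> N" by (rule lborel_pair.AE_pair)
  have "space (lborel \<Otimes>\<^sub>M lborel) - N \<in> sets (lborel \<Otimes>\<^sub>M lborel)"
    using N(1) by (intro sets.compl_sets) auto
  then have "{x \<in> space (lborel \<Otimes>\<^sub>M lborel). (fst x, snd x) \<notin> N} \<in> sets (lborel \<Otimes>\<^sub>M lborel)"
    by (simp only: set_diff_eq prod.collapse)
  from lborel_pair.AE_commute[OF this] a1
  have a2: "AE s in lborel. AE t in lborel. (t, s) \<notin> N" by blast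
  have "(\<integral>\<^sup>+t. (\<integral>\<^sup>+s. F (t, s) \<partial>lebesgue) \<partial>lebesgue) = (\<integral>\<^sup>+t. (\<integral>\<^sup>+s. F' (t, s) \<partial>lborel) \<partial>lborel)"
    unfolding nn_integral_completion
  proof (rule nn_integral_cong_AE, use a1 in eventually_elim)
    case (elim t)
    show ?case by (rule nn_integral_cong_AE, use elim in eventually_elim) (simp add: FN)
  qed
  also have "\<dots> = (\<integral>\<^sup>+s. (\<integral>\<^sup>+t. F' (t, s) \<partial>lborel) \<partial>lborel)"
    by (rule lborel_pair.Fubini'[symmetric]) simp
  also have "\<dots> = (\<integral>\<^sup>+s. (\<integral>\<^sup>+t. F (t, s) \<partial>lebesgue) \<partial>lebesgue)"
    unfolding nn_integral_completion
  proof (rule nn_integral_cong_AE, use a2 in eventually_elim)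
    case (elim s)
    show ?case by (rule nn_integral_cong_AE, use elim in eventually_elim) (simp add: FN)
  qed
  finally show ?thesis .
qed

lemma Tonelli_lebm:
  fixes F :: "real \<times> real \<Rightarrow> ennreal"
  assumes F: "F \<in> borel_measurable lebm2"
  shows "(\<integral>\<^sup>+t. (\<integral>\<^sup>+s. F (t, s) \<partial>lebm) \<partial>lebm) = (\<integral>\<^sup>+s. (\<integral>\<^sup>+t. F (t, s) \<partial>lebm) \<partial>lebm)"
proof -
  define G where "G x = F x * indicator (Rm \<times> Rm) x" for x
  have G: "G \<in> borel_measurable lebesgue"
    using F unfolding G_def by (subst (asm) borel_measurable_restrict_space_iff_ennreal) (use Rm2_sets in auto)
  have 1: "(\<integral>\<^sup>+s. F (t, s) \<partial>lebm) * indicator Rm t = (\<integral>\<^sup>+s. G (t, s) \<partial>lebesgue)" for t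
    unfolding nn_integral_lebm by (cases "t \<in> Rm") (auto simp: G_def indicator_def intro!: nn_integral_cong)
  have 2: "(\<integral>\<^sup>+t. F (t, s) \<partial>lebm) * indicator Rm s = (\<integral>\<^sup>+t. G (t, s) \<partial>lebesgue)" for s
    unfolding nn_integral_lebm by (cases "s \<in> Rm") (auto simp: G_def indicator_def intro!: nn_integral_cong)
  show ?thesis
    using Tonelli_lebesgue[OF G] by (simp add: nn_integral_lebm[of "\<lambda>t. \<integral>\<^sup>+s. F (t, s) \<partial>lebm"]
      nn_integral_lebm[of "\<lambda>s. \<integral>\<^sup>+t. F (t, s) \<partial>lebm"] 1 2)
qed

lemma nn_integral_Un_le_suminf:
  fixes f :: "'m \<Rightarrow> ennreal"
  assumes [measurable]: "f \<in> borel_measurable M" "\<And>i::nat. A i \<in> sets M"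
  shows "(\<integral>\<^sup>+x\<in>(\<Union>i. A i). f x \<partial>M) \<le> (\<Sum>i. \<integral>\<^sup>+x\<in>A i. f x \<partial>M)"
proof -
  have "emeasure (density M f) (\<Union>i. A i) \<le> (\<Sum>i. emeasure (density M f) (A i))"
    by (rule emeasure_subadditive_countably) auto
  then show ?thesis by (simp add: emeasure_density)
qed

text \<open>The exponents start at 1, as in \<open>D_const\<close> and \<open>D'_const\<close>;
  hence the dyadic shells cover exactly the distances above \<open>2 * h\<close>.\<close>

lemma ex_dyadic:
  fixes x h :: real
  assumes "0 < h" "2 * h < x"
  shows "\<exists>m. 2 ^ (Suc m) * h < x \<and> x \<le> 2 ^ (Suc m + 1) * h"
proof -
  obtain n where n: "x / h < 2 ^ n" using real_arch_pow[of 2 "x / h"] by auto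
  then have ex: "\<exists>n. x \<le> 2 ^ n * h" using assms(1) by (auto simp: field_simps intro: less_imp_le)
  define k where "k = (LEAST n. x \<le> 2 ^ n * h)"
  have k: "x \<le> 2 ^ k * h" unfolding k_def using ex by (rule LeastI_ex)
  have "\<not> x \<le> 2 ^ 0 * h" "\<not> x \<le> 2 ^ 1 * h" using assms by auto
  with k have "k \<noteq> 0" "k \<noteq> 1" by (metis, metis)
  then obtain m where m: "k = Suc (Suc m)" by (metis One_nat_def not0_implies_Suc)
  have "\<not> x \<le> 2 ^ (Suc m) * h"
    using not_less_Least[of "Suc m" "\<lambda>n. x \<le> 2 ^ n * h"] m unfolding k_def by auto
  with k m show ?thesis by (intro exI[of _ m]) auto
qed

section \<open>Consequences of the kernel conditions for \<open>T\<close>\<close>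

locale sio =
  fixes T :: "(real \<Rightarrow> 'x::banach) \<Rightarrow> (real \<Rightarrow> 'y::banach)"
    and K :: "real \<Rightarrow> real \<Rightarrow> ('x \<Rightarrow>\<^sub>L 'y)"
    and p0 r :: real
  assumes p0: "1 < p0"
    and SIO: "singular_integral_operator p0 T K"
    and supp: "\<forall>t\<in>Rm. \<forall>s\<in>Rm. \<not> t < s \<longrightarrow> K t s = 0"
    and r: "1 < r"
    and D_fin: "D_const 1 K < \<infinity>"
    and D'_fin: "D'_const r K < \<infinity>"
begin

definition "D = enn2real (D_const 1 K)"
definition "D' = enn2real (D'_const r K)"

lemma D: "D_const 1 K = ennreal D" "0 \<le> D" and D': "D'_const r K = ennreal D'" "0 \<le> D'"
  using D_fin D'_fin by (auto simp: D_def D'_def)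

lemma kernel: "is_kernel K" and bdd_lin: "bounded_linear_Lp p0 T"
  and rep: "f \<in> Linf_c \<Longrightarrow> \<exists>g. (AE t in lebm. g t = T f t) \<and>
        (\<forall>t\<in>Rm - ess_supp f. has_banach_integral lebm (\<lambda>s. blinfun_apply (K t s) (f s)) (g t))"
  using SIO unfolding singular_integral_operator_def by blast+

lemma K_diff_measurable_t:
  assumes "s \<in> Rm" "s' \<in> Rm"
  shows "(\<lambda>t. norm (K t s - K t s')) \<in> borel_measurable lebm"
  using kernel assms unfolding is_kernel_def
  by (intro strongly_measurable_norm complete_measure_lebm strongly_measurable_diff) auto

lemma K_diff_measurable_s:
  assumes "t \<in> Rm" "t' \<in> Rm"
  shows "(\<lambda>s. norm (K t s - K t' s)) \<in> borel_measurable lebm"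
  using kernel assms unfolding is_kernel_def
  by (intro strongly_measurable_norm complete_measure_lebm strongly_measurable_diff) auto

text \<open>For exponent 1 the powers of \<open>h\<close> and of 2 in \<open>D_const\<close> equal
  1, and the shells \<open>I_set (Suc m) s h\<close> cover everything to the left of
  \<open>s - 2 * h\<close>. What remains is the classical Hoermander condition.\<close>

lemma D_bound:
  assumes "s < 0" "0 < h"
  shows "(\<integral>\<^sup>+t\<in>{..<s - 2 * h}. ennreal (norm (K t s - K t (s - h))) \<partial>lebm) \<le> ennreal D"
proof -
  note [measurable] = K_diff_measurable_t[of s "s - h"]
  have I: "I_set m s h = {s - 2 ^ (m + 1) * h..<s - 2 ^ m * h}" for m
    using assms by (auto simp: I_set_def intro: order_trans[of _ "s - 2 ^ m * h"] simp: less_le_trans)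
  have Is: "I_set m s h \<in> sets lebm" for m
  proof -
    have "I_set m s h = I_set m s h \<inter> space lebm" by (auto simp: I_set_def space_restrict_space)
    then show ?thesis using Int_space_lebm[of "I_set m s h"] by (simp add: I)
  qed
  have "{..<s - 2 * h} \<subseteq> (\<Union>m. I_set (Suc m) s h)"
  proof
    fix t assume "t \<in> {..<s - 2 * h}"
    then have "2 * h < s - t" "t \<le> 0" using assms by auto
    then show "t \<in> (\<Union>m. I_set (Suc m) s h)"
      using ex_dyadic[OF assms(2), of "s - t"] by (auto simp: I_set_def)
  qed
  then have "(\<integral>\<^sup>+t\<in>{..<s - 2 * h}. ennreal (norm (K t s - K t (s - h))) \<partial>lebm)
     \<le> (\<integral>\<^sup>+t\<in>(\<Union>m. I_set (Suc m) s h). ennreal (norm (K t s - K t (s - h))) \<partial>lebm)"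
    by (intro nn_integral_mono mult_left_mono) (auto simp: indicator_def)
  also have "\<dots> \<le> (\<Sum>m. \<integral>\<^sup>+t\<in>I_set (Suc m) s h. ennreal (norm (K t s - K t (s - h))) \<partial>lebm)"
    using assms Is by (intro nn_integral_Un_le_suminf) auto
  also have "\<dots> = (\<Sum>m. \<integral>\<^sup>+t\<in>I_set (Suc m) s h. ennreal (norm (K t s - K t (s - h))) \<partial>lebesgue)"
    by (intro suminf_cong nn_integral_lebm_subset[symmetric]) (auto simp: I_set_def)
  also have "\<dots> \<le> D_const 1 K"
    unfolding D_const_def using assms by (intro SUP_upper2[of "(s, h)"]) auto
  finally show ?thesis by (simp add: D)
qed

text \<open>The kernel only sees the future: for \<open>t > c\<close>, the integrand vanishes for
  \<open>s < c\<close> because \<open>K t s = 0\<close> and beyond because \<open>b s = 0\<close>.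
  This serves for atoms and also for removing the part of \<open>f\<close> to the left of a
  point.\<close>

lemma atom_right:
  assumes b: "b \<in> Linf_c" and z: "AE t in lebm. c \<le> t \<longrightarrow> b t = 0"
  shows "AE t in lebm. c < t \<longrightarrow> T b t = 0"
proof -
  obtain g where g: "AE t in lebm. g t = T b t"
    "\<And>t. t \<in> Rm - ess_supp b \<Longrightarrow> has_banach_integral lebm (\<lambda>s. blinfun_apply (K t s) (b s)) (g t)"
    using rep[OF b] by blast
  have g0: "g t = 0" if t: "t \<in> Rm" "c < t" for t
  proof (rule has_banach_integral_unique_0[OF complete_measure_lebm g(2)])
    have "AE s in lebm. s \<in> {c<..} \<longrightarrow> b s = 0" using z by eventually_elim auto
    then show "t \<in> Rm - ess_supp b" using notin_ess_suppI[of "{c<..}" t b] t by auto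
    show "AE s in lebm. blinfun_apply (K t s) (b s) = 0"
      using z AE_space
    proof eventually_elim
      case (elim s)
      show ?case
      proof (cases "s < c")
        case True
        then have "K t s = 0" using supp t elim(2) by (auto simp: space_restrict_space)
        then show ?thesis by simp
      qed (use elim in \<open>auto\<close>)
    qed
  qed
  show ?thesis using g(1) AE_space by eventually_elim (auto simp: space_restrict_space g0)
qed

text \<open>The mean value zero allows \<open>K t a\<close> to be subtracted from
  \<open>K t s\<close>. After an interchange of the integrals, \<open>D_bound\<close> applies for
  each fixed \<open>s\<close> with step \<open>s - a\<close>.\<close>

lemma atom_left:
  assumes b: "b \<in> Linf_c" and ac: "a < c" "c \<le> 0" and z: "AE t in lebm. t \<notin> {a<..<c} \<longrightarrow> b t = 0"
    and b0: "has_banach_integral lebm b 0"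
  shows "(\<integral>\<^sup>+t\<in>{..<2 * a - c}. ennreal (norm (T b t)) \<partial>lebm) \<le> ennreal D * (\<integral>\<^sup>+t. ennreal (norm (b t)) \<partial>lebm)"
proof -
  obtain g where g: "AE t in lebm. g t = T b t"
    "\<And>t. t \<in> Rm - ess_supp b \<Longrightarrow> has_banach_integral lebm (\<lambda>s. blinfun_apply (K t s) (b s)) (g t)"
    using rep[OF b] by blast
  define F where "F = (\<lambda>x. ennreal (norm (K (fst x) (snd x) - K (fst x) a) * norm (b (snd x)))
      * indicator {..<2 * a - c} (fst x) * indicator {a<..<c} (snd x))"
  have a0: "a \<in> Rm" using ac by auto
  have gb: "ennreal (norm (g t)) \<le> (\<integral>\<^sup>+s. ennreal (norm (K t s - K t a) * norm (b s)) * indicator {a<..<c} s \<partial>lebm)"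
    if t: "t < 2 * a - c" for t
  proof -
    have ta: "t \<in> Rm" "t < a" using t ac by auto
    have "AE s in lebm. s \<in> {..<a} \<longrightarrow> b s = 0" using z by eventually_elim auto
    then have "t \<in> Rm - ess_supp b" using notin_ess_suppI[of "{..<a}" t b] ta by auto
    from g(2)[OF this] have 1: "has_banach_integral lebm (\<lambda>s. blinfun_apply (K t s) (b s)) (g t)" .
    have 2: "has_banach_integral lebm (\<lambda>s. blinfun_apply (K t a) (b s)) (blinfun_apply (K t a) 0)"
      by (rule has_banach_integral_bounded_linear[OF complete_measure_lebm _ b0]) (rule blinfun.bounded_linear_right)
    have "has_banach_integral lebm (\<lambda>s. blinfun_apply (K t s) (b s) - blinfun_apply (K t a) (b s)) (g t)"
      using has_banach_integral_diff[OF complete_measure_lebm 1 2] by (simp add: blinfun.zero_right)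
    then have "ennreal (norm (g t)) \<le> (\<integral>\<^sup>+s. ennreal (norm (blinfun_apply (K t s) (b s) - blinfun_apply (K t a) (b s))) \<partial>lebm)"
      by (rule has_banach_integral_norm_le[OF complete_measure_lebm])
    also have "\<dots> \<le> (\<integral>\<^sup>+s. ennreal (norm (K t s - K t a) * norm (b s)) * indicator {a<..<c} s \<partial>lebm)"
    proof (rule nn_integral_mono_AE, use z in eventually_elim)
      case (elim s)
      have "norm (blinfun_apply (K t s) (b s) - blinfun_apply (K t a) (b s)) \<le> norm (K t s - K t a) * norm (b s)"
        by (metis blinfun.diff_left norm_blinfun)
      with elim show ?case by (cases "s \<in> {a<..<c}") (auto intro: ennreal_leI simp: blinfun.zero_right)
    qed
    finally show ?thesis .
  qed
  have "(\<integral>\<^sup>+t\<in>{..<2 * a - c}. ennreal (norm (T b t)) \<partial>lebm) \<le> (\<integral>\<^sup>+t. (\<integral>\<^sup>+s. F (t, s) \<partial>lebm) \<partial>lebm)"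
  proof (rule nn_integral_mono_AE, use g(1) in eventually_elim)
    case (elim t)
    then show ?case using gb[of t] by (cases "t < 2 * a - c") (auto simp: F_def)
  qed
  also have "\<dots> = (\<integral>\<^sup>+s. (\<integral>\<^sup>+t. F (t, s) \<partial>lebm) \<partial>lebm)"
  proof (rule Tonelli_lebm)
    have "strongly_measurable lebm2 (\<lambda>x. K (fst x) (snd x))"
      using kernel by (simp add: is_kernel_def case_prod_beta')
    \<comment> \<open>As a function of two variables this is the section of \<open>K\<close> at
      \<open>a\<close> composed with a projection; its measurability is the section condition in
      \<open>is_kernel\<close>.\<close>
    moreover have "strongly_measurable lebm2 (\<lambda>x. K (fst x) a)"
      by (rule strongly_measurable_compose_measurable[OF _ measurable_fst_lebm AE_fst_lebm])
        (use kernel a0 in \<open>auto simp: is_kernel_def\<close>)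
    ultimately have 1: "(\<lambda>x. norm (K (fst x) (snd x) - K (fst x) a)) \<in> borel_measurable lebm2"
      by (intro strongly_measurable_norm complete_measure_lebesgue_on Rm2_sets strongly_measurable_diff)
    have 2: "(\<lambda>x. norm (b (snd x))) \<in> borel_measurable lebm2"
      using measurable_compose[OF measurable_snd_lebm Linf_c_norm_measurable[OF b]] .
    have 3: "(\<lambda>x. indicator {..<2 * a - c} (fst x) :: ennreal) \<in> borel_measurable lebm2"
      by (rule measurable_compose[OF measurable_fst_lebm measurable_indicator_lebm]) simp
    have 4: "(\<lambda>x. indicator {a<..<c} (snd x) :: ennreal) \<in> borel_measurable lebm2"
      by (rule measurable_compose[OF measurable_snd_lebm measurable_indicator_lebm]) simp
    show "F \<in> borel_measurable lebm2" unfolding F_def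
      by (intro borel_measurable_times_ennreal measurable_compose[OF _ measurable_ennreal]
          borel_measurable_times 1 2 3 4)
  qed
  also have "\<dots> \<le> (\<integral>\<^sup>+s. ennreal D * ennreal (norm (b s)) \<partial>lebm)"
  proof (rule nn_integral_mono)
    fix s
    show "(\<integral>\<^sup>+t. F (t, s) \<partial>lebm) \<le> ennreal D * ennreal (norm (b s))"
    proof (cases "s \<in> {a<..<c}")
      case True
      then have s: "s < 0" "0 < s - a" using ac by auto
      note [measurable] = K_diff_measurable_t[of s a]
      have "(\<integral>\<^sup>+t. F (t, s) \<partial>lebm) = (\<integral>\<^sup>+t. ennreal (norm (b s)) * (ennreal (norm (K t s - K t a)) * indicator {..<2 * a - c} t) \<partial>lebm)"
        using True by (intro nn_integral_cong) (auto simp: F_def ennreal_mult mult_ac)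
      also have "\<dots> = ennreal (norm (b s)) * (\<integral>\<^sup>+t\<in>{..<2 * a - c}. ennreal (norm (K t s - K t a)) \<partial>lebm)"
        
        by (intro nn_integral_cmult borel_measurable_times_ennreal measurable_compose[OF _ measurable_ennreal]
            K_diff_measurable_t measurable_indicator_lebm) (use a0 s in auto)
      also have "\<dots> \<le> ennreal (norm (b s)) * ennreal D"
      proof (rule mult_left_mono)
        \<comment> \<open>Since \<open>s < c\<close>, the range \<open>t < 2 * a - c\<close> is
          contained in \<open>t < 2 * a - s\<close>, which is
          \<open>s - 2 * (s - a)\<close>.\<close>
        have "(\<integral>\<^sup>+t\<in>{..<2 * a - c}. ennreal (norm (K t s - K t a)) \<partial>lebm)
          \<le> (\<integral>\<^sup>+t\<in>{..<s - 2 * (s - a)}. ennreal (norm (K t s - K t (s - (s - a)))) \<partial>lebm)"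
          using True by (intro nn_integral_mono) (auto simp: indicator_def)
        also have "\<dots> \<le> ennreal D" by (rule D_bound[OF s])
        finally show "(\<integral>\<^sup>+t\<in>{..<2 * a - c}. ennreal (norm (K t s - K t a)) \<partial>lebm) \<le> ennreal D" .
      qed simp
      finally show ?thesis by (simp add: mult.commute)
    qed (auto simp: F_def)
  qed
  also have "\<dots> = ennreal D * (\<integral>\<^sup>+t. ennreal (norm (b t)) \<partial>lebm)"
    using Linf_c_norm_measurable[OF b] by (intro nn_integral_cmult) simp
  finally show ?thesis .
qed

text \<open>Hoelder's inequality on the dyadic shells around \<open>u\<close> with step
  \<open>v - u\<close>. The mean of the power of \<open>f\<close> over a shell is controlled from
  \<open>z\<close>, and the radius to the power 1 - 1 / r that it contributes is precisely the
  weight of this shell in \<open>D'_const\<close>.\<close>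

lemma tail_bound:
  assumes f: "f \<in> Linf_c" and G: "0 \<le> G"
    and max: "\<And>k. 0 < k \<Longrightarrow> (\<integral>\<^sup>+s\<in>{z..z+k}. ennreal (norm (f s) powr (r / (r - 1))) \<partial>lebm) \<le> ennreal (k * G powr (r / (r - 1)))"
    and uv: "z < u" "u < z + L" "u < v" "v < z + 2 * L" "v < 0"
  shows "(\<integral>\<^sup>+s\<in>{z + 5 * L<..}. ennreal (norm (K u s - K v s) * norm (f s)) \<partial>lebm) \<le> ennreal (4 * D' * G)"
proof -
  define q where "q = r / (r - 1)"
  have q: "1 < q" "1 / r + 1 / q = 1" "1 / q = 1 - 1 / r" using r by (auto simp: q_def field_simps)
  have L: "0 < L" using uv by linarith
  define h where "h = v - u"
  have h: "0 < h" "u + h = v" using uv by (auto simp: h_def)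
  define J where "J m = J_set (Suc m) u h" for m
  have Js: "J m \<in> sets lebm" for m
  proof -
    have "J m = {u + 2 ^ Suc m * h<..u + 2 ^ (Suc m + 1) * h} \<inter> space lebm"
      by (auto simp: J_def J_set_def space_restrict_space)
    then show ?thesis using Int_space_lebm by simp
  qed
  have uv0: "u \<in> Rm" "v \<in> Rm" using uv by auto
  note [measurable] = K_diff_measurable_s[OF uv0] Linf_c_norm_measurable[OF f] Js
    measurable_indicator_lebm[OF sets_lebesgue_intervals(8)]
  let ?F = "\<lambda>s. ennreal (norm (K u s - K v s) * norm (f s)) * indicator {z + 5 * L<..} s"
  define N where "N m = ennpow (\<integral>\<^sup>+s\<in>J m. ennreal (norm (K u s - K v s) powr r) \<partial>lebm) (1 / r)" for m
  have each: "(\<integral>\<^sup>+s\<in>J m. ?F s \<partial>lebm) \<le> ennreal (4 * G * h powr (1 - 1 / r)) * (ennreal (2 powr (real (Suc m) * (1 - 1 / r))) * N m)" for m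
  proof -
    define f1 where "f1 s = norm (K u s - K v s) * indicator (J m) s" for s
    define f2 where "f2 s = norm (f s) * indicator (J m \<inter> {z + 5 * L<..}) s" for s
    have e1: "(\<integral>\<^sup>+s. ennreal (f1 s powr r) \<partial>lebm) = (\<integral>\<^sup>+s\<in>J m. ennreal (norm (K u s - K v s) powr r) \<partial>lebm)"
      using r by (intro nn_integral_cong) (auto simp: f1_def indicator_def)
    have "(\<integral>\<^sup>+s\<in>J m. ?F s \<partial>lebm) = (\<integral>\<^sup>+s. ennreal (f1 s * f2 s) \<partial>lebm)"
      by (intro nn_integral_cong) (auto simp: f1_def f2_def indicator_def)
    also have "\<dots> \<le> ennpow (\<integral>\<^sup>+s. ennreal (f1 s powr r) \<partial>lebm) (1 / r) * ennpow (\<integral>\<^sup>+s. ennreal (f2 s powr q) \<partial>lebm) (1 / q)"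
    proof (rule nn_integral_Holder[OF _ _ _ _ r q(2)])
      show "f1 \<in> borel_measurable lebm" unfolding f1_def
        by (intro borel_measurable_times K_diff_measurable_s[OF uv0] borel_measurable_indicator Js)
      have "f2 = (\<lambda>s. norm (f s) * (indicator (J m) s * indicator {z + 5 * L<..} s))"
        by (auto simp: f2_def indicator_inter_arith)
      then show "f2 \<in> borel_measurable lebm" by simp
    qed (auto simp: f1_def f2_def)
    also have "\<dots> \<le> N m * ennreal (4 * G * h powr (1 - 1 / r) * 2 powr (real (Suc m) * (1 - 1 / r)))"
      unfolding N_def e1
    proof (rule mult_left_mono)
     show "ennpow (\<integral>\<^sup>+s. ennreal (f2 s powr q) \<partial>lebm) (1 / q) \<le> ennreal (4 * G * h powr (1 - 1 / r) * 2 powr (real (Suc m) * (1 - 1 / r)))"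
    proof (cases "J m \<inter> {z + 5 * L<..} = {}")
      case True
      then have "f2 = (\<lambda>s. 0)" by (auto simp: f2_def)
      then show ?thesis by simp
    next
      case False
      \<comment> \<open>A shell that meets the tail has outer radius above 4 * L, hence above
        \<open>u - z\<close>. The interval of twice this radius starting at \<open>z\<close>
        therefore contains the part of the shell in the tail.\<close>
      then obtain s where "s \<in> J m" "z + 5 * L < s" by auto
      then have "z + 5 * L - u < 2 ^ (Suc m + 1) * h" by (auto simp: J_def J_set_def)
      then have k1: "u - z \<le> 2 ^ (Suc m + 1) * h" using uv by linarith
      define k where "k = 2 * (2 ^ (Suc m + 1) * h)"
      have k0: "0 < k" using h by (simp add: k_def)
      have "(\<integral>\<^sup>+s. ennreal (f2 s powr q) \<partial>lebm) \<le> (\<integral>\<^sup>+s\<in>{z..z+k}. ennreal (norm (f s) powr q) \<partial>lebm)"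
      proof (rule nn_integral_mono)
        fix s
        show "ennreal (f2 s powr q) \<le> ennreal (norm (f s) powr q) * indicator {z..z+k} s"
        proof (cases "s \<in> J m \<inter> {z + 5 * L<..}")
          case True
          then have "z \<le> s" "s - u \<le> 2 ^ (Suc m + 1) * h" using L by (auto simp: J_def J_set_def)
          then have "s \<in> {z..z+k}" using k1 by (auto simp: k_def)
          then show ?thesis using True by (simp add: f2_def)
        qed (simp add: f2_def)
      qed
      also have "\<dots> \<le> ennreal (k * G powr q)" unfolding q_def by (rule max[OF k0])
      finally have "ennpow (\<integral>\<^sup>+s. ennreal (f2 s powr q) \<partial>lebm) (1 / q) \<le> ennpow (ennreal (k * G powr q)) (1 / q)"
        by (rule ennpow_mono) (use q(1) in simp)
      also have "\<dots> = ennreal (k powr (1 / q) * G)"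
        using k0 q(1) G by (simp add: ennpow_ennreal powr_mult powr_powr)
      also have "k powr (1 / q) = 4 powr (1 / q) * (2 powr (real (Suc m) * (1 / q)) * h powr (1 / q))"
      proof -
        have "k = 4 * (2 powr (real (Suc m)) * h)" by (simp add: k_def powr_realpow powr_add)
        then show ?thesis using h by (simp add: powr_mult powr_powr)
      qed
      also have "ennreal (4 powr (1 / q) * (2 powr (real (Suc m) * (1 / q)) * h powr (1 / q)) * G)
        \<le> ennreal (4 * (2 powr (real (Suc m) * (1 / q)) * h powr (1 / q)) * G)"
      proof (intro ennreal_leI mult_right_mono G)
        \<comment> \<open>Since \<open>k\<close> is 4 * 2 ^ Suc m * h, the factor 4 remains next to
          the powers that appear in \<open>D'_const\<close>; replacing its root by 4 gives the
          constant of the lemma.\<close>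
        have "(4::real) powr (1 / q) \<le> 4 powr 1" using q(1) by (intro powr_mono) auto
        then show "(4::real) powr (1 / q) \<le> 4" by simp
      qed auto
      finally show ?thesis by (simp add: q(3) mult_ac)
    qed
    qed simp
    finally show ?thesis
      using G by (simp add: ennreal_mult mult_ac)
  qed
  have "(\<integral>\<^sup>+s. ?F s \<partial>lebm) \<le> (\<integral>\<^sup>+s\<in>(\<Union>m. J m). ?F s \<partial>lebm)"
  proof (rule nn_integral_mono)
    fix s assume "s \<in> space lebm"
    then have s: "s \<le> 0" by (simp add: space_restrict_space)
    show "?F s \<le> ?F s * indicator (\<Union>m. J m) s"
    proof (cases "z + 5 * L < s")
      case True
      \<comment> \<open>Tail points are more than 4 * L to the right of \<open>u\<close>, while
        \<open>v - u\<close> is less than 2 * L; so the shells cover the tail.\<close>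
      then have "2 * h < s - u" using uv by (simp add: h_def)
      then have "s \<in> (\<Union>m. J m)" using ex_dyadic[OF h(1), of "s - u"] s by (auto simp: J_def J_set_def)
      then show ?thesis by simp
    qed simp
  qed
  also have "\<dots> \<le> (\<Sum>m. \<integral>\<^sup>+s\<in>J m. ?F s \<partial>lebm)"
    by (rule nn_integral_Un_le_suminf) measurable
  also have "\<dots> \<le> (\<Sum>m. ennreal (4 * G * h powr (1 - 1 / r)) * (ennreal (2 powr (real (Suc m) * (1 - 1 / r))) * N m))"
    by (intro suminf_le each) auto
  also have "\<dots> = ennreal (4 * G * h powr (1 - 1 / r)) * (\<Sum>m. ennreal (2 powr (real (Suc m) * (1 - 1 / r))) * N m)"
    by (rule ennreal_suminf_cmult)
  also have "\<dots> = ennreal (4 * G) * (ennreal (h powr (1 - 1 / r)) * (\<Sum>m. ennreal (2 powr (real (Suc m) * (1 - 1 / r))) * N m))"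
    using G by (simp add: ennreal_mult mult.assoc)
  also have "\<dots> \<le> ennreal (4 * G) * D'_const r K"
  proof (rule mult_left_mono)
    have N: "N m = ennpow (\<integral>\<^sup>+s\<in>J_set (Suc m) u h. ennreal (norm (K u s - K (u + h) s) powr r) \<partial>lebesgue) (1 / r)" for m
      unfolding N_def J_def h(2) by (subst nn_integral_lebm_subset) (auto simp: J_set_def)
    show "ennreal (h powr (1 - 1 / r)) * (\<Sum>m. ennreal (2 powr (real (Suc m) * (1 - 1 / r))) * N m) \<le> D'_const r K"
      unfolding D'_const_def N using uv h by (intro SUP_upper2[of "(u, h)"]) auto
  qed simp
  also have "\<dots> = ennreal (4 * D' * G)" using G D' by (simp add: ennreal_mult mult_ac)
  finally show ?thesis .
qed

end

subsection \<open>The weak type (1,1) bound\<close>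

lemma Markov_bound:
  assumes [measurable]: "u \<in> borel_measurable M" and "(\<integral>\<^sup>+x. u x \<partial>M) \<le> ennreal k" "0 < c" "0 \<le> k"
  shows "emeasure M {x \<in> space M. ennreal c < u x} \<le> ennreal (k / c)"
proof -
  have "ennreal c * emeasure M {x \<in> space M. ennreal c < u x} = (\<integral>\<^sup>+x. ennreal c * indicator {x \<in> space M. ennreal c < u x} x \<partial>M)"
    by (rule nn_integral_cmult_indicator[symmetric]) measurable
  also have "\<dots> \<le> (\<integral>\<^sup>+x. u x \<partial>M)"
    by (rule nn_integral_mono) (auto simp: indicator_def)
  also have "\<dots> \<le> ennreal k" by fact
  finally have "ennreal (1 / c) * (ennreal c * emeasure M {x \<in> space M. ennreal c < u x}) \<le> ennreal (1 / c) * ennreal k"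
    by (rule mult_left_mono) simp
  then show ?thesis
    using assms(3,4) by (simp add: mult.assoc[symmetric] flip: ennreal_mult)
qed

lemma finite_subfamily_exhausting:
  assumes c: "countable \<C>" and m: "\<And>C. C \<in> \<C> \<Longrightarrow> C \<in> sets M"
    and fin: "emeasure M (\<Union>\<C>) < \<infinity>" and e: "0 < (e::ennreal)"
  obtains \<Q> where "finite \<Q>" "\<Q> \<subseteq> \<C>" "emeasure M (\<Union>\<C> - \<Union>\<Q>) < e"
proof (cases "\<C> = {}")
  case True
  with that[of "{}"] e show ?thesis by simp
next
  case False
  define q where "q = from_nat_into \<C>"
  have q: "range q = \<C>" unfolding q_def by (rule range_from_nat_into[OF False c])
  define A where "A n = \<Union>\<C> - \<Union>(q ` {..n})" for n
  have qm: "q i \<in> sets M" for i using m q by auto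
  have U: "\<Union>\<C> \<in> sets M" using c m by auto
  have "(\<lambda>n. emeasure M (A n)) \<longlonglongrightarrow> emeasure M (\<Inter>n. A n)"
  proof (rule Lim_emeasure_decseq)
    show "range A \<subseteq> sets M" using U qm by (auto simp: A_def)
    show "decseq A" by (rule decseq_SucI) (auto simp: A_def)
    fix n
    have "emeasure M (A n) \<le> emeasure M (\<Union>\<C>)" using U by (intro emeasure_mono) (auto simp: A_def)
    with fin show "emeasure M (A n) \<noteq> \<infinity>" by (auto simp: top_unique)
  qed
  moreover have "(\<Inter>n. A n) = {}"
  proof -
    have False if "x \<in> (\<Inter>n. A n)" for x
    proof -
      have "x \<in> \<Union>\<C>" using that by (auto simp: A_def)
      then obtain i where "x \<in> q i" using q by auto
      moreover have "x \<in> A i" using that by blast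
      ultimately show False by (auto simp: A_def)
    qed
    then show ?thesis by blast
  qed
  ultimately have "(\<lambda>n. emeasure M (A n)) \<longlonglongrightarrow> 0" by simp
  then have "\<forall>\<^sub>F n in sequentially. emeasure M (A n) < e" using e by (rule order_tendstoD)
  then obtain n where "emeasure M (A n) < e" by (auto simp: eventually_sequentially)
  with that[of "q ` {..n}"] q show ?thesis by (auto simp: A_def)
qed

text \<open>Off \<open>rs_set \<phi> l\<close> all averages to the right are at most
  \<open>l\<close>, so the set where \<phi> is at least \<open>l * c n\<close> has one-sided density
  at most \<open>1 / c n\<close> there. It is null by the density lemma, and \<open>c n\<close>
  decreases to 1.\<close>

lemma (in rising_sun) AE_le_off: "AE t in lebesgue. t \<notin> rs_set \<phi> l \<longrightarrow> \<phi> t \<le> ennreal l"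
proof -
  define c where "c n = 1 + 1 / (real n + 1)" for n
  have c: "1 < c n" for n by (simp add: c_def)
  define Z where "Z n = {t. ennreal (l * c n) \<le> \<phi> t} - rs_set \<phi> l" for n
  have Zm: "Z n \<in> sets lebesgue" for n
  proof -
    have "{t \<in> space lebesgue. ennreal (l * c n) \<le> \<phi> t} \<in> sets lebesgue" by measurable
    then show ?thesis unfolding Z_def by auto
  qed
  have "Z n \<in> null_sets lebesgue" for n
  proof (rule null_sets_if_one_sided_density_less[OF Zm, of "1 / c n"])
    fix x y assume x: "x \<in> Z n" "x < y"
    have "ennreal (l * c n) * emeasure lebesgue (Z n \<inter> {x..y}) = (\<integral>\<^sup>+t. ennreal (l * c n) * indicator (Z n \<inter> {x..y}) t \<partial>lebesgue)"
      using Zm by (intro nn_integral_cmult_indicator[symmetric]) auto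
    also have "\<dots> \<le> (\<integral>\<^sup>+t\<in>{x..y}. \<phi> t \<partial>lebesgue)"
      by (rule nn_integral_mono) (auto simp: indicator_def Z_def)
    also have "\<dots> \<le> ennreal (l * (y - x))"
      using x by (intro notin_rs_setD) (auto simp: Z_def)
    finally have "ennreal (1 / (l * c n)) * (ennreal (l * c n) * emeasure lebesgue (Z n \<inter> {x..y})) \<le> ennreal (1 / (l * c n)) * ennreal (l * (y - x))"
      by (rule mult_left_mono) simp
    then show "emeasure lebesgue (Z n \<inter> {x..y}) \<le> ennreal (1 / c n * (y - x))"
      using l_pos c[of n] x(2) by (simp add: mult.assoc[symmetric] flip: ennreal_mult)
  qed (use c[of n] in auto)
  then have "AE t in lebesgue. \<forall>n. t \<notin> Z n" by (simp add: AE_all_countable AE_not_in)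
  then show ?thesis
  proof eventually_elim
    case (elim t)
    show ?case
    proof (intro impI, rule ccontr)
      assume t: "t \<notin> rs_set \<phi> l" "\<not> \<phi> t \<le> ennreal l"
      have "(\<lambda>n. ennreal (l * c n)) \<longlonglongrightarrow> ennreal (l * (1 + 0))"
        unfolding c_def by (intro tendsto_ennrealI tendsto_intros)
          (use LIMSEQ_inverse_real_of_nat in \<open>simp add: inverse_eq_divide add.commute\<close>)
      then have "\<forall>\<^sub>F n in sequentially. ennreal (l * c n) < \<phi> t"
        using t(2) by (intro order_tendstoD) auto
      then obtain n where "ennreal (l * c n) < \<phi> t" by (auto simp: eventually_sequentially)
      then have "t \<in> Z n" using t(1) by (auto simp: Z_def)
      with elim show False by blast
    qed
  qed
qed

lemma has_banach_integral_indicator: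
  fixes c :: "'b::real_normed_vector"
  assumes A: "A \<in> sets M" "emeasure M A < \<infinity>"
  shows "has_banach_integral M (\<lambda>t. indicator A t *\<^sub>R c) (measure M A *\<^sub>R c)"
proof -
  have r: "Bochner_Integration.simple_bochner_integrable M (indicator A :: _ \<Rightarrow> real)"
  proof (rule simple_bochner_integrable.intros)
    have "{y \<in> space M. (indicator A y :: real) \<noteq> 0} = A"
      using sets.sets_into_space[OF A(1)] by (auto simp: indicator_def)
    then show "emeasure M {y \<in> space M. (indicator A y :: real) \<noteq> 0} \<noteq> \<infinity>" using A by auto
  qed (use A in simp)
  have "ennreal (Bochner_Integration.simple_bochner_integral M (indicator A :: _ \<Rightarrow> real)) = (\<integral>\<^sup>+x. ennreal (indicator A x) \<partial>M)"
    by (rule simple_bochner_integral_eq_nn_integral[OF r]) simp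
  also have "\<dots> = ennreal (measure M A)" using A by (simp add: ennreal_indicator emeasure_eq_ennreal_measure less_top)
  finally have i: "Bochner_Integration.simple_bochner_integral M (indicator A :: _ \<Rightarrow> real) = measure M A"
    by (subst (asm) ennreal_inj) (auto intro: simple_bochner_integral_nonneg)
  have s: "Bochner_Integration.simple_bochner_integrable M (\<lambda>t. indicator A t *\<^sub>R c)"
    using simple_bochner_integrable_compose2[of "\<lambda>a b. a *\<^sub>R c", OF _ r r] by simp
  have "Bochner_Integration.simple_bochner_integral M (\<lambda>t. indicator A t *\<^sub>R c) = measure M A *\<^sub>R c"
    using simple_bochner_integral_linear[OF bounded_linear.linear[OF bounded_linear_scaleR_left[of c]] r] i by simp
  with s show ?thesis unfolding has_banach_integral_def
    by (intro conjI exI[of _ "\<lambda>i t. indicator A t *\<^sub>R c"] strongly_measurable_simple simple_bochner_integrable_imp) auto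
qed

section \<open>Elementary properties of \<open>T\<close> on \<open>Linf_c\<close>\<close>

context sio
begin

lemma p0_pos: "0 < p0" using p0 by simp

lemma Linf_c_Lp: "f \<in> Linf_c \<Longrightarrow> f \<in> Lp p0"
  using Linf_c_subset_Lp[OF p0_pos] by blast

lemma T_measurable:
  assumes "f \<in> Linf_c" shows "(\<lambda>t. norm (T f t)) \<in> borel_measurable lebm"
proof -
  have "T f \<in> Lp p0" using bdd_lin Linf_c_Lp[OF assms] by (auto simp: bounded_linear_Lp_def)
  then show ?thesis by (auto simp: Lp_def intro!: strongly_measurable_norm complete_measure_lebm)
qed

lemma T_finite:
  assumes "f \<in> Linf_c" shows "(\<integral>\<^sup>+t. ennreal (norm (T f t) powr p0) \<partial>lebm) < \<infinity>"
proof -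
  have "T f \<in> Lp p0" using bdd_lin Linf_c_Lp[OF assms] by (auto simp: bounded_linear_Lp_def)
  then show ?thesis unfolding Lp_def Lp_norm_less_top_iff by blast
qed

lemma T_bound:
  obtains B where "0 \<le> B" "\<And>f. f \<in> Linf_c \<Longrightarrow>
    (\<integral>\<^sup>+t. ennreal (norm (T f t) powr p0) \<partial>lebm) \<le> ennreal B * (\<integral>\<^sup>+t. ennreal (norm (f t) powr p0) \<partial>lebm)"
proof -
  obtain B where B: "0 \<le> B" "\<And>f. f \<in> Lp p0 \<Longrightarrow> Lp_norm p0 (T f) \<le> ennreal B * Lp_norm p0 f"
    using bdd_lin by (auto simp: bounded_linear_Lp_def)
  show ?thesis
  proof (rule that)
    show "0 \<le> B powr p0" by simp
    fix f :: "real \<Rightarrow> 'x" assume "f \<in> Linf_c"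
    then show "(\<integral>\<^sup>+t. ennreal (norm (T f t) powr p0) \<partial>lebm) \<le> ennreal (B powr p0) * (\<integral>\<^sup>+t. ennreal (norm (f t) powr p0) \<partial>lebm)"
      using B(2)[OF Linf_c_Lp] unfolding Lp_norm_def by (intro ennpow_root_bound[OF p0_pos B(1)])
  qed
qed

lemma T_add:
  assumes "f \<in> Linf_c" "g \<in> Linf_c"
  shows "AE t in lebm. T (\<lambda>s. f s + g s) t = T f t + T g t"
  using bdd_lin Linf_c_Lp[OF assms(1)] Linf_c_Lp[OF assms(2)] by (auto simp: bounded_linear_Lp_def)

lemma T_AE_zero:
  assumes f: "f \<in> Linf_c" and z: "AE t in lebm. f t = 0"
  shows "AE t in lebm. T f t = 0"
proof -
  obtain B where B: "0 \<le> B" "\<And>f. f \<in> Linf_c \<Longrightarrow>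
    (\<integral>\<^sup>+t. ennreal (norm (T f t) powr p0) \<partial>lebm) \<le> ennreal B * (\<integral>\<^sup>+t. ennreal (norm (f t) powr p0) \<partial>lebm)"
    using T_bound by blast
  have "(\<integral>\<^sup>+t. ennreal (norm (f t) powr p0) \<partial>lebm) = (\<integral>\<^sup>+t. 0 \<partial>lebm)"
    by (rule nn_integral_cong_AE, use z in eventually_elim) (use p0 in simp)
  then have "(\<integral>\<^sup>+t. ennreal (norm (T f t) powr p0) \<partial>lebm) = 0" using B(2)[OF f] by simp
  moreover note [measurable] = T_measurable[OF f]
  ultimately have "AE t in lebm. ennreal (norm (T f t) powr p0) = 0"
    by (subst (asm) nn_integral_0_iff_AE) auto
  then show ?thesis by (rule eventually_mono) (auto simp: ennreal_eq_0_iff)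
qed

lemma T_sum:
  assumes "finite I" "\<And>i. i \<in> I \<Longrightarrow> f i \<in> Linf_c"
  shows "(\<lambda>s. \<Sum>i\<in>I. f i s) \<in> Linf_c \<and> (AE t in lebm. T (\<lambda>s. \<Sum>i\<in>I. f i s) t = (\<Sum>i\<in>I. T (f i) t))"
  using assms
proof (induction I)
  case empty
  then show ?case using T_AE_zero[OF Linf_c_zero] by (auto intro: Linf_c_zero)
next
  case (insert j I)
  then have IH: "(\<lambda>s. \<Sum>i\<in>I. f i s) \<in> Linf_c" "AE t in lebm. T (\<lambda>s. \<Sum>i\<in>I. f i s) t = (\<Sum>i\<in>I. T (f i) t)"
    and fj: "f j \<in> Linf_c" by auto
  have "AE t in lebm. T (\<lambda>s. \<Sum>i\<in>insert j I. f i s) t = (\<Sum>i\<in>insert j I. T (f i) t)"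
    using T_add[OF fj IH(1)] IH(2) by eventually_elim (use insert in simp)
  moreover have "(\<lambda>s. \<Sum>i\<in>insert j I. f i s) \<in> Linf_c"
    using Linf_c_add[OF fj IH(1)] insert by simp
  ultimately show ?case by blast
qed

end

lemma measurable_ennreal_powr:
  fixes h :: "'m \<Rightarrow> real"
  shows "h \<in> borel_measurable M \<Longrightarrow> (\<lambda>t. ennreal (h t powr p)) \<in> borel_measurable M"
  by (intro measurable_compose[OF _ measurable_ennreal] powr_real_measurable borel_measurable_const)

lemma greater_sets:
  fixes h :: "'m \<Rightarrow> 'b::{second_countable_topology, linorder_topology}"
  shows "h \<in> borel_measurable M \<Longrightarrow> {x \<in> space M. c < h x} \<in> sets M"
  by measurable

context sio
begin

text \<open>The three terms of the constant: the good part has an integral of three equal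
  contributions and is handled by the bound \<open>B\<close> and Markov's inequality at
  \<open>l / 2\<close>; the intervals doubled to the left have total length at most 2 * n / l; the
  atoms have total mass at most 2 * n, which \<open>D\<close> and Markov's inequality at
  \<open>l / 2\<close> turn into 4 * D * n / l.\<close>

lemma weak_type_aux:
  assumes B: "0 \<le> B" "\<And>f. f \<in> Linf_c \<Longrightarrow>
      (\<integral>\<^sup>+t. ennreal (norm (T f t) powr p0) \<partial>lebm) \<le> ennreal B * (\<integral>\<^sup>+t. ennreal (norm (f t) powr p0) \<partial>lebm)"
    and f: "f \<in> Linf_c" and l: "0 < l" and n: "(\<integral>\<^sup>+t. ennreal (norm (f t)) \<partial>lebm) = ennreal n" "0 < n"
  shows "emeasure lebm {t \<in> space lebm. l < norm (T f t)} \<le> ennreal ((3 * B * 2 powr p0 + 2 + 4 * D) * n / l)"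
proof -
  define \<phi> where "\<phi> t = ennreal (norm (f t)) * indicator Rm t" for t
  have \<phi>_meas: "\<phi> \<in> borel_measurable lebesgue"
    using Linf_c_norm_measurable[OF f] unfolding \<phi>_def
    by (subst borel_measurable_restrict_space_iff_ennreal[symmetric]) auto
  have \<phi>_int: "(\<integral>\<^sup>+t. \<phi> t \<partial>lebesgue) = ennreal n"
    using n(1) by (simp add: \<phi>_def nn_integral_lebm)
  interpret rs: rising_sun \<phi> l
    by unfold_locales (use \<phi>_meas \<phi>_int l in \<open>auto simp: \<phi>_def\<close>)
  define U where "U = rs_set \<phi> l"
  have U_neg: "U \<subseteq> {..<0}" unfolding U_def by (rule rs.rs_set_negative)
  have oU: "open U" unfolding U_def by (rule rs.open_rs_set)
  have U_le: "ennreal l * emeasure lebesgue U \<le> ennreal n"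
    using rs.emeasure_rs_set_le \<phi>_int by (simp add: U_def)
  have Ul: "emeasure lebesgue U \<le> ennreal (n / l)"
  proof -
    have "ennreal (1 / l) * (ennreal l * emeasure lebesgue U) \<le> ennreal (1 / l) * ennreal n"
      by (rule mult_left_mono[OF U_le]) simp
    then show ?thesis using l n by (simp add: mult.assoc[symmetric] flip: ennreal_mult)
  qed
  then have U_fin: "emeasure lebesgue U < \<infinity>" using order_le_less_trans by fastforce
  obtain M R where M: "AE t in lebm. norm (f t) \<le> M * indicator {-R..0} t" "0 \<le> M" using f by (elim Linf_cE)
  \<comment> \<open>The size allowed for the discarded part of \<open>U\<close>, on which the good
    part is only bounded by \<open>M\<close>: its contribution is then at most that of the other
    terms. The summand 1 covers \<open>M = 0\<close>.\<close>
  define e where "e = l powr (p0 - 1) * n / (M powr p0 + 1)"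
  have e: "0 < e" "M powr p0 * e \<le> l powr (p0 - 1) * n"
  proof -
    have "0 < M powr p0 + 1" by (rule add_nonneg_pos) auto
    then show "0 < e" using l n by (simp add: e_def)
    have "M powr p0 * e = (l powr (p0 - 1) * n) * (M powr p0 / (M powr p0 + 1))" by (simp add: e_def)
    also have "\<dots> \<le> (l powr (p0 - 1) * n) * 1"
      using l n \<open>0 < M powr p0 + 1\<close> by (intro mult_left_mono) auto
    finally show "M powr p0 * e \<le> l powr (p0 - 1) * n" by simp
  qed
  have cm: "C \<in> sets lebesgue" if "C \<in> components U" for C
    using open_components[OF oU that] by auto
  (* Additivity of T needs a finite sum of atoms; the part of f on the remaining components is
     bounded and supported on a small set, so that it can be added to the good part. *)
  obtain \<Q> where Q: "finite \<Q>" "\<Q> \<subseteq> components U" "emeasure lebesgue (U - \<Union>\<Q>) < ennreal e"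
    using finite_subfamily_exhausting[of "components U" lebesgue "ennreal e"]
      countable_components_real[OF oU] cm U_fin e(1) by (auto simp: Union_components)
  have QU: "\<Union>\<Q> \<subseteq> U" using Q(2) Union_components by blast
  have Qdis: "disjoint \<Q>" by (rule pairwise_subset[OF disjoint_components Q(2)])
  have ex: "\<exists>ab. fst ab < snd ab \<and> snd ab \<le> 0 \<and> C = {fst ab<..<snd ab} \<and>
      (\<integral>\<^sup>+t\<in>{fst ab..snd ab}. \<phi> t \<partial>lebesgue) = ennreal (l * (snd ab - fst ab))" if "C \<in> \<Q>" for C
  proof -
    have "C \<in> components (rs_set \<phi> l)" using that Q(2) U_def by auto
    from rs.component[OF this] obtain a b where "a < b" "b \<le> 0" "C = {a<..<b}"
      "(\<integral>\<^sup>+t\<in>{a..b}. \<phi> t \<partial>lebesgue) = ennreal (l * (b - a))" by metis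
    then show ?thesis by (intro exI[of _ "(a, b)"]) simp
  qed
  have "\<exists>f. \<forall>C\<in>\<Q>. fst (f C) < snd (f C) \<and> snd (f C) \<le> 0 \<and> C = {fst (f C)<..<snd (f C)} \<and>
      (\<integral>\<^sup>+t\<in>{fst (f C)..snd (f C)}. \<phi> t \<partial>lebesgue) = ennreal (l * (snd (f C) - fst (f C)))"
    by (rule bchoice) (intro ballI ex)
  then obtain ab where ab: "\<And>C. C \<in> \<Q> \<Longrightarrow> fst (ab C) < snd (ab C) \<and> snd (ab C) \<le> 0 \<and> C = {fst (ab C)<..<snd (ab C)} \<and>
      (\<integral>\<^sup>+t\<in>{fst (ab C)..snd (ab C)}. \<phi> t \<partial>lebesgue) = ennreal (l * (snd (ab C) - fst (ab C)))" by blast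
  define a where "a C = fst (ab C)" for C
  define b where "b C = snd (ab C)" for C
  have ab: "a C < b C" "b C \<le> 0" "C = {a C<..<b C}" "(\<integral>\<^sup>+t\<in>{a C..b C}. \<phi> t \<partial>lebesgue) = ennreal (l * (b C - a C))"
    if "C \<in> \<Q>" for C using ab[OF that] unfolding a_def b_def by blast+
  have memC: "t \<in> C \<longleftrightarrow> a C < t \<and> t < b C" if "C \<in> \<Q>" for C t
    using arg_cong[OF ab(3)[OF that], of "\<lambda>A. t \<in> A"] by (simp only: greaterThanLessThan_iff)
  have Cm[measurable]: "C \<in> sets lebesgue" if "C \<in> \<Q>" for C using cm Q(2) that by auto
  have CRm: "C \<subseteq> Rm" if "C \<in> \<Q>" for C 
    using ab(2)[OF that] by (auto simp: memC[OF that])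
  have Cem: "emeasure lebesgue C = ennreal (b C - a C)" if "C \<in> \<Q>" for C
    using arg_cong[OF ab(3)[OF that], of "emeasure lebesgue"] ab(1)[OF that]
    by (simp only: emeasure_lebesgue_Ioo less_imp_le)
  have Csets: "C \<in> sets lebm" if "C \<in> \<Q>" for C
    using Int_space_lebm[OF Cm[OF that]] CRm[OF that] by (simp add: space_restrict_space Int_absorb2)
  have Clebm: "emeasure lebm C = ennreal (b C - a C)" "measure lebm C = b C - a C" if "C \<in> \<Q>" for C
  proof -
    show "emeasure lebm C = ennreal (b C - a C)"
      using Cem[OF that] CRm[OF that] by (subst emeasure_restrict_space) auto
    then show "measure lebm C = b C - a C" using ab(1)[OF that] by (simp add: measure_def)
  qed
  have C\<phi>: "(\<integral>\<^sup>+t. ennreal (norm (f t)) * indicator C t \<partial>lebm) = ennreal (l * (b C - a C))" if C: "C \<in> \<Q>" for C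
  proof -
    have "(\<integral>\<^sup>+t. ennreal (norm (f t)) * indicator C t \<partial>lebm) = (\<integral>\<^sup>+t\<in>{a C<..<b C}. \<phi> t \<partial>lebesgue)"
      
      unfolding nn_integral_lebm by (auto intro!: nn_integral_cong simp: \<phi>_def indicator_def memC[OF C])
    then show ?thesis using ab(4)[OF C] by (simp add: nn_integral_Icc_eq_Ioo)
  qed
  have sumC: "(\<Sum>C\<in>\<Q>. ennreal (b C - a C)) \<le> emeasure lebesgue U"
  proof -
    have "(\<Sum>C\<in>\<Q>. emeasure lebesgue C) = emeasure lebesgue (\<Union>\<Q>)"
      
      using sum_emeasure[of "\<lambda>C. C" \<Q> lebesgue] Q(1) Cm Qdis
      by (simp add: disjoint_family_on_def disjoint_def image_subset_iff subset_iff)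
    also have "\<dots> \<le> emeasure lebesgue U" using QU oU by (intro emeasure_mono) auto
    finally show ?thesis by (simp add: Cem)
  qed
  define L where "L = (\<Sum>C\<in>\<Q>. b C - a C)"
  have L0: "0 \<le> L" unfolding L_def using ab(1) by (intro sum_nonneg) (auto intro: less_imp_le)
  have L: "L \<le> n / l"
  proof -
    have "ennreal L = (\<Sum>C\<in>\<Q>. ennreal (b C - a C))"
      unfolding L_def using ab(1) by (subst sum_ennreal) (auto intro: less_imp_le)
    with sumC Ul have "ennreal L \<le> ennreal (n / l)" by simp
    then show ?thesis using n l by (simp add: ennreal_le_iff)
  qed

  define fC where "fC C t = indicator C t *\<^sub>R f t" for C t
  have fC: "fC C \<in> Linf_c" if "C \<in> \<Q>" for C
    unfolding fC_def using Linf_c_indicator[OF f Cm[OF that]] .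
  have "\<exists>y. has_banach_integral lebm (fC C) y" if "C \<in> \<Q>" for C
    using fC[OF that] Linf_c_integrable[OF fC[OF that]]
    by (intro has_banach_integral_exists complete_measure_lebm) (auto simp: Linf_c_def)
  then obtain y where y: "\<And>C. C \<in> \<Q> \<Longrightarrow> has_banach_integral lebm (fC C) (y C)" by metis
  have y_le: "norm (y C) \<le> l * (b C - a C)" if C: "C \<in> \<Q>" for C
  proof -
    have "ennreal (norm (y C)) \<le> (\<integral>\<^sup>+t. ennreal (norm (fC C t)) \<partial>lebm)"
      by (rule has_banach_integral_norm_le[OF complete_measure_lebm y[OF C]])
    also have "\<dots> = (\<integral>\<^sup>+t. ennreal (norm (f t)) * indicator C t \<partial>lebm)"
      by (intro nn_integral_cong) (auto simp: fC_def indicator_def)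
    also have "\<dots> = ennreal (l * (b C - a C))" by (rule C\<phi>[OF C])
    finally show ?thesis using l ab(1)[OF C] by (simp add: ennreal_le_iff)
  qed
  define m where "m C = (1 / (b C - a C)) *\<^sub>R y C" for C
  have m_le: "norm (m C) \<le> l" if C: "C \<in> \<Q>" for C
    using y_le[OF C] ab(1)[OF C] by (simp add: m_def field_simps)
  define bb where "bb C t = fC C t - indicator C t *\<^sub>R m C" for C t
  have bb: "bb C \<in> Linf_c" if C: "C \<in> \<Q>" for C
  proof -
    have "(\<lambda>t. indicator {a C<..<b C} t *\<^sub>R m C) = (\<lambda>t. indicator C t *\<^sub>R m C)"
      by (auto simp: fun_eq_iff indicator_def memC[OF C])
    then have "(\<lambda>t. indicator C t *\<^sub>R m C) \<in> Linf_c"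
      using Linf_c_indicator_const[of "a C" "b C" "m C"] ab(1)[OF C] by (simp only: less_imp_le)
    then show ?thesis unfolding bb_def by (rule Linf_c_diff[OF fC[OF C]])
  qed
  have bb0: "has_banach_integral lebm (bb C) 0" if C: "C \<in> \<Q>" for C
  proof -
    have "has_banach_integral lebm (\<lambda>t. indicator C t *\<^sub>R m C) (measure lebm C *\<^sub>R m C)"
      by (rule has_banach_integral_indicator) (use Csets[OF C] Clebm[OF C] in auto)
    moreover have "measure lebm C *\<^sub>R m C = y C" using Clebm[OF C] ab(1)[OF C] by (simp add: m_def)
    ultimately have "has_banach_integral lebm (bb C) (y C - y C)"
      unfolding bb_def using has_banach_integral_diff[OF complete_measure_lebm y[OF C]] by fastforce
    then show ?thesis by simp
  qed
  have bb_int: "(\<integral>\<^sup>+t. ennreal (norm (bb C t)) \<partial>lebm) \<le> ennreal (2 * l * (b C - a C))" if C: "C \<in> \<Q>" for C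
  proof -
    have [measurable]: "(\<lambda>t. ennreal (norm (f t))) \<in> borel_measurable lebm" "C \<in> sets lebm"
      using Linf_c_norm_measurable[OF f] Csets[OF C] by auto
    have "(\<integral>\<^sup>+t. ennreal (norm (bb C t)) \<partial>lebm) \<le> (\<integral>\<^sup>+t. ennreal (norm (f t)) * indicator C t + ennreal l * indicator C t \<partial>lebm)"
    proof (rule nn_integral_mono)
      fix t
      have "norm (f t - m C) \<le> norm (f t) + l" using norm_triangle_ineq4[of "f t" "m C"] m_le[OF C] by linarith
      then have "ennreal (norm (f t - m C)) \<le> ennreal (norm (f t)) + ennreal l" using l by (simp flip: ennreal_plus)
      then show "ennreal (norm (bb C t)) \<le> ennreal (norm (f t)) * indicator C t + ennreal l * indicator C t"
        by (auto simp: bb_def fC_def indicator_def)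
    qed
    also have "\<dots> = (\<integral>\<^sup>+t. ennreal (norm (f t)) * indicator C t \<partial>lebm) + ennreal l * emeasure lebm C"
      by (subst nn_integral_add) (auto simp: nn_integral_cmult_indicator)
    also have "\<dots> = ennreal (2 * l * (b C - a C))"
      using l ab(1)[OF C] by (simp add: C\<phi>[OF C] Clebm[OF C] flip: ennreal_mult ennreal_plus)
    finally show ?thesis .
  qed

  define S where "S t = (\<Sum>C\<in>\<Q>. bb C t)" for t
  define G where "G t = f t - S t" for t
  have S: "S \<in> Linf_c" "AE t in lebm. T S t = (\<Sum>C\<in>\<Q>. T (bb C) t)"
    unfolding S_def[abs_def] using T_sum[OF Q(1), of bb] bb by auto
  have G: "G \<in> Linf_c" unfolding G_def[abs_def] by (rule Linf_c_diff[OF f S(1)])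
  have TGS: "AE t in lebm. T f t = T G t + T S t"
    using T_add[OF G S(1)] by (simp add: G_def)
  have S_in: "S t = f t - m C" if C: "C \<in> \<Q>" "t \<in> C" for t C
  proof -
    have "bb C' t = 0" if "C' \<in> \<Q>" "C' \<noteq> C" for C'
    proof -
      have "t \<notin> C'" using Qdis C that by (auto simp: disjoint_def)
      then show ?thesis by (simp add: bb_def fC_def)
    qed
    then have "S t = bb C t" unfolding S_def using Q(1) C(1) by (subst sum.remove) (auto intro!: sum.neutral)
    then show ?thesis using C by (simp add: bb_def fC_def)
  qed
  have S_out: "S t = 0" if "t \<notin> \<Union>\<Q>" for t
    unfolding S_def using that by (intro sum.neutral) (auto simp: bb_def fC_def indicator_def)
  have lp: "l powr p0 = l powr (p0 - 1) * l" using l by (simp add: powr_diff)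
  \<comment> \<open>Three regions: on a chosen component \<open>G\<close> is a mean value of norm at
    most \<open>l\<close>; on the discarded components it is \<open>f\<close>, bounded by
    \<open>M\<close>; off \<open>U\<close> it is \<open>f\<close> with norm at most
    \<open>l\<close>, so one factor \<open>norm (f t)\<close> can be kept and the others replaced by
    \<open>l\<close>.\<close>
  have G_pt: "AE t in lebm. ennreal (norm (G t) powr p0) \<le> ennreal (l powr (p0 - 1)) * ennreal (norm (f t))
      + ennreal (l powr p0) * indicator U t + ennreal (M powr p0) * indicator (U - \<Union>\<Q>) t"
  proof -
    have off: "AE t in lebm. t \<notin> U \<longrightarrow> norm (f t) \<le> l"
      unfolding AE_lebm_iff using rs.AE_le_off
      by eventually_elim (use l in \<open>auto simp: \<phi>_def U_def ennreal_le_iff\<close>)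
    show ?thesis using off M(1)
    proof eventually_elim
      case (elim t)
      consider "t \<in> \<Union>\<Q>" | "t \<in> U - \<Union>\<Q>" | "t \<notin> U" by blast
      then show ?case
      proof cases
        case 1
        then obtain C where C: "C \<in> \<Q>" "t \<in> C" by auto
        have "norm (G t) powr p0 \<le> l powr p0"
          using m_le[OF C(1)] p0 by (intro powr_mono2) (auto simp: G_def S_in[OF C])
        then show ?thesis using 1 QU by (auto intro!: add_increasing ennreal_leI simp: subset_iff)
      next
        case 2
        have "norm (f t) \<le> M" using elim(2) M(2) by (cases "t \<in> {-R..0}") auto
        then have "norm (G t) powr p0 \<le> M powr p0"
          using p0 2 by (intro powr_mono2) (auto simp: G_def S_out)
        then show ?thesis using 2 by (auto intro!: add_increasing ennreal_leI)
      next
        case 3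
        then have Gf: "G t = f t" using QU S_out[of t] by (auto simp: G_def)
        have fl: "norm (f t) \<le> l" using elim(1) 3 by simp
        have "norm (f t) powr p0 \<le> l powr (p0 - 1) * norm (f t)"
        proof (cases "norm (f t) = 0")
          case False
          then have "norm (f t) powr p0 = norm (f t) powr (p0 - 1) * norm (f t)" by (simp add: powr_diff)
          also have "\<dots> \<le> l powr (p0 - 1) * norm (f t)" using fl p0 by (intro mult_right_mono powr_mono2) auto
          finally show ?thesis .
        qed simp
        then show ?thesis using 3 by (simp add: Gf ennreal_leI flip: ennreal_mult')
      qed
    qed
  qed
  have G_int: "(\<integral>\<^sup>+t. ennreal (norm (G t) powr p0) \<partial>lebm) \<le> ennreal (3 * l powr (p0 - 1) * n)"
  proof -
    have Us: "U \<in> sets lebm" "U - \<Union>\<Q> \<in> sets lebm"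
    proof -
      have "U \<inter> space lebm \<in> sets lebm" using oU by (intro Int_space_lebm) auto
      moreover have "U \<inter> space lebm = U" using U_neg by (auto simp: space_restrict_space)
      ultimately show 1: "U \<in> sets lebm" by simp
      show "U - \<Union>\<Q> \<in> sets lebm" using 1 Q(1) Csets by (intro sets.Diff sets.finite_Union) auto
    qed
    have le: "emeasure lebm U \<le> ennreal (n / l)" "emeasure lebm (U - \<Union>\<Q>) \<le> ennreal e"
    proof -
      have "emeasure lebm A = emeasure lebesgue A" if "A \<subseteq> U" for A
        using that U_neg by (intro emeasure_restrict_space) auto
      then show "emeasure lebm U \<le> ennreal (n / l)" "emeasure lebm (U - \<Union>\<Q>) \<le> ennreal e"
        using Ul Q(3) by auto
    qed
    have fm: "(\<lambda>t. ennreal (norm (f t))) \<in> borel_measurable lebm"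
      using Linf_c_norm_measurable[OF f] by simp
    have fi: "(\<integral>\<^sup>+t. ennreal (l powr (p0 - 1)) * ennreal (norm (f t)) \<partial>lebm) = ennreal (l powr (p0 - 1)) * ennreal n"
      by (simp only: nn_integral_cmult[OF fm] n(1))
    have fm': "(\<lambda>t. ennreal (l powr (p0 - 1)) * ennreal (norm (f t))) \<in> borel_measurable lebm"
      by (intro borel_measurable_times_ennreal fm) simp
    have "(\<integral>\<^sup>+t. ennreal (norm (G t) powr p0) \<partial>lebm) \<le> (\<integral>\<^sup>+t. ennreal (l powr (p0 - 1)) * ennreal (norm (f t))
      + ennreal (l powr p0) * indicator U t + ennreal (M powr p0) * indicator (U - \<Union>\<Q>) t \<partial>lebm)"
      by (rule nn_integral_mono_AE[OF G_pt])
    also have "\<dots> = ennreal (l powr (p0 - 1)) * ennreal n + ennreal (l powr p0) * emeasure lebm U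
        + ennreal (M powr p0) * emeasure lebm (U - \<Union>\<Q>)"
      
    proof -
      have 1: "(\<lambda>t. ennreal (l powr p0) * indicator U t) \<in> borel_measurable lebm"
        "(\<lambda>t. ennreal (M powr p0) * indicator (U - \<Union>\<Q>) t) \<in> borel_measurable lebm"
        by (intro borel_measurable_times_ennreal borel_measurable_const borel_measurable_indicator Us)+
      show ?thesis
        by (simp only: nn_integral_add[OF borel_measurable_add[OF fm' 1(1)] 1(2)] nn_integral_add[OF fm' 1(1)]
            nn_integral_cmult_indicator[OF Us(1)] nn_integral_cmult_indicator[OF Us(2)] fi)
    qed
    also have "\<dots> \<le> ennreal (l powr (p0 - 1)) * ennreal n + ennreal (l powr p0) * ennreal (n / l)
        + ennreal (M powr p0) * ennreal e"
      by (intro add_mono mult_left_mono le) auto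
    also have "\<dots> = ennreal (l powr (p0 - 1) * n + l powr p0 * (n / l) + M powr p0 * e)"
      using l n e by (simp flip: ennreal_mult ennreal_plus)
    also have "\<dots> \<le> ennreal (3 * l powr (p0 - 1) * n)"
      using e(2) l by (intro ennreal_leI) (simp add: lp mult.commute)
    finally show ?thesis .
  qed

  \<comment> \<open>Each interval is enlarged to the left only, by its own length: to the right of
    \<open>b C\<close> the image of the atom vanishes.\<close>
  define Om where "Om = (\<Union>C\<in>\<Q>. {2 * a C - b C..b C})"
  have Om: "emeasure lebesgue Om \<le> ennreal (2 * n / l)"
  proof -
    have "emeasure lebesgue Om \<le> (\<Sum>C\<in>\<Q>. emeasure lebesgue {2 * a C - b C..b C})"
      unfolding Om_def by (rule emeasure_subadditive_finite) (use Q(1) in auto)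
    also have "\<dots> = (\<Sum>C\<in>\<Q>. ennreal (2 * (b C - a C)))"
      by (intro sum.cong refl, subst emeasure_lebesgue_Icc) (use ab(1) in \<open>auto intro: less_imp_le simp: field_simps\<close>)
    also have "\<dots> = ennreal (2 * L)"
      unfolding L_def using ab(1) by (subst sum_ennreal) (auto simp: sum_distrib_left intro: less_imp_le)
    also have "\<dots> \<le> ennreal (2 * n / l)" using L by (intro ennreal_leI) simp
    finally show ?thesis .
  qed
  have Oms: "Om \<in> sets lebesgue" unfolding Om_def using Q(1) by (intro sets.finite_UN) auto
  have Tbb_meas: "(\<lambda>t. ennreal (norm (T (bb C) t))) \<in> borel_measurable lebm" if "C \<in> \<Q>" for C
    using T_measurable[OF bb[OF that]] by simp
  have S_int: "(\<integral>\<^sup>+t. ennreal (norm (T S t)) * indicator (- Om) t \<partial>lebm) \<le> ennreal (2 * D * n)"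
  proof -
    have "(\<integral>\<^sup>+t. ennreal (norm (T S t)) * indicator (- Om) t \<partial>lebm)
      \<le> (\<integral>\<^sup>+t. (\<Sum>C\<in>\<Q>. ennreal (norm (T (bb C) t)) * indicator {..<2 * a C - b C} t) \<partial>lebm)"
    proof (rule nn_integral_mono_AE)
      have right: "AE t in lebm. \<forall>C\<in>\<Q>. b C < t \<longrightarrow> T (bb C) t = 0"
      proof (rule AE_finite_allI[OF Q(1)])
        fix C assume C: "C \<in> \<Q>"
        have "bb C t = 0" if "t \<notin> {a C<..<b C}" for t
          using that memC[OF C, of t] by (auto simp: bb_def fC_def)
        then show "AE t in lebm. b C < t \<longrightarrow> T (bb C) t = 0"
          using bb[OF C] by (intro atom_right) auto
      qed
      show "AE t in lebm. ennreal (norm (T S t)) * indicator (- Om) t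
        \<le> (\<Sum>C\<in>\<Q>. ennreal (norm (T (bb C) t)) * indicator {..<2 * a C - b C} t)"
        using right S(2)
      proof eventually_elim
        case (elim t)
        show ?case
        proof (cases "t \<in> Om")
          case False
          have "ennreal (norm (T S t)) \<le> ennreal (\<Sum>C\<in>\<Q>. norm (T (bb C) t))"
            unfolding elim(2) by (intro ennreal_leI norm_sum)
          also have "\<dots> = (\<Sum>C\<in>\<Q>. ennreal (norm (T (bb C) t)))" by (rule sum_ennreal[symmetric]) simp
          also have "\<dots> \<le> (\<Sum>C\<in>\<Q>. ennreal (norm (T (bb C) t)) * indicator {..<2 * a C - b C} t)"
          proof (rule sum_mono)
            fix C assume C: "C \<in> \<Q>"
            with False have "t < 2 * a C - b C \<or> b C < t" by (auto simp: Om_def)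
            then show "ennreal (norm (T (bb C) t)) \<le> ennreal (norm (T (bb C) t)) * indicator {..<2 * a C - b C} t"
              using elim(1) C by auto
          qed
          finally show ?thesis using False by simp
        qed simp
      qed
    qed
    also have "\<dots> = (\<Sum>C\<in>\<Q>. \<integral>\<^sup>+t\<in>{..<2 * a C - b C}. ennreal (norm (T (bb C) t)) \<partial>lebm)"
      by (intro nn_integral_sum borel_measurable_times_ennreal Tbb_meas measurable_indicator_lebm) auto
    also have "\<dots> \<le> (\<Sum>C\<in>\<Q>. ennreal (D * (2 * l * (b C - a C))))"
    proof (rule sum_mono)
      fix C assume C: "C \<in> \<Q>"
      have "bb C t = 0" if "t \<notin> {a C<..<b C}" for t
        using that memC[OF C, of t] by (auto simp: bb_def fC_def)
      then have "(\<integral>\<^sup>+t\<in>{..<2 * a C - b C}. ennreal (norm (T (bb C) t)) \<partial>lebm)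
        \<le> ennreal D * (\<integral>\<^sup>+t. ennreal (norm (bb C t)) \<partial>lebm)"
        using ab(1,2)[OF C] bb[OF C] bb0[OF C] by (intro atom_left) auto
      also have "\<dots> \<le> ennreal D * ennreal (2 * l * (b C - a C))"
        by (rule mult_left_mono[OF bb_int[OF C]]) simp
      finally show "(\<integral>\<^sup>+t\<in>{..<2 * a C - b C}. ennreal (norm (T (bb C) t)) \<partial>lebm) \<le> ennreal (D * (2 * l * (b C - a C)))"
        using D by (simp add: ennreal_mult')
    qed
    also have "\<dots> = ennreal (D * (2 * l * L))"
      unfolding L_def using ab(1) D l by (subst sum_ennreal) (auto simp: sum_distrib_left intro!: mult_nonneg_nonneg intro: less_imp_le)
    also have "\<dots> \<le> ennreal (2 * D * n)"
    proof (rule ennreal_leI)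
      have "L * l \<le> n" using L l by (simp add: field_simps)
      then have "(2 * D) * (L * l) \<le> (2 * D) * n" using D by (intro mult_left_mono) auto
      then show "D * (2 * l * L) \<le> 2 * D * n" by (simp add: mult_ac)
    qed
    finally show ?thesis .
  qed

  let ?A = "{t \<in> space lebm. ennreal ((l / 2) powr p0) < ennreal (norm (T G t) powr p0)}"
  let ?B = "{t \<in> space lebm. ennreal (l / 2) < ennreal (norm (T S t)) * indicator (- Om) t}"
  have Ommeas: "(\<lambda>t. indicator (- Om) t :: ennreal) \<in> borel_measurable lebm"
    using Oms by (intro measurable_indicator_lebm) (auto simp: Compl_in_sets_lebesgue)
  have TS_meas: "(\<lambda>t. ennreal (norm (T S t)) * indicator (- Om) t) \<in> borel_measurable lebm"
    by (intro borel_measurable_times_ennreal Ommeas measurable_compose[OF T_measurable[OF S(1)] measurable_ennreal])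
  have A: "emeasure lebm ?A \<le> ennreal (B * (3 * l powr (p0 - 1) * n) / (l / 2) powr p0)"
  proof (rule Markov_bound[OF measurable_ennreal_powr[OF T_measurable[OF G]]])
    have "(\<integral>\<^sup>+t. ennreal (norm (T G t) powr p0) \<partial>lebm) \<le> ennreal B * (\<integral>\<^sup>+t. ennreal (norm (G t) powr p0) \<partial>lebm)"
      by (rule B(2)[OF G])
    also have "\<dots> \<le> ennreal B * ennreal (3 * l powr (p0 - 1) * n)" by (rule mult_left_mono[OF G_int]) simp
    finally show "(\<integral>\<^sup>+t. ennreal (norm (T G t) powr p0) \<partial>lebm) \<le> ennreal (B * (3 * l powr (p0 - 1) * n))"
      using B(1) by (simp add: ennreal_mult')
  qed (use l n B(1) in auto)
  have A_eq: "B * (3 * l powr (p0 - 1) * n) / (l / 2) powr p0 = 3 * B * 2 powr p0 * n / l"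
    using l by (simp add: powr_divide lp field_simps)
  have Bb: "emeasure lebm ?B \<le> ennreal (2 * D * n / (l / 2))"
    by (rule Markov_bound[OF TS_meas S_int]) (use l n D in auto)
  have OmR: "emeasure lebm (Om \<inter> space lebm) \<le> ennreal (2 * n / l)"
  proof -
    have "emeasure lebm (Om \<inter> space lebm) = emeasure lebesgue (Om \<inter> Rm)"
      by (subst emeasure_restrict_space) (auto simp: space_restrict_space)
    also have "\<dots> \<le> emeasure lebesgue Om" using Oms by (intro emeasure_mono) auto
    finally show ?thesis using Om by simp
  qed
  have Oms': "Om \<inter> space lebm \<in> sets lebm" by (rule Int_space_lebm[OF Oms])
  have As: "?A \<in> sets lebm" by (rule greater_sets[OF measurable_ennreal_powr[OF T_measurable[OF G]]])
  have Bs: "?B \<in> sets lebm" by (rule greater_sets[OF TS_meas])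
  have "emeasure lebm {t \<in> space lebm. l < norm (T f t)} \<le> emeasure lebm (?A \<union> ?B \<union> (Om \<inter> space lebm))"
  proof (rule emeasure_mono_AE)
    show "AE t in lebm. t \<in> {t \<in> space lebm. l < norm (T f t)} \<longrightarrow> t \<in> ?A \<union> ?B \<union> (Om \<inter> space lebm)"
      using TGS
    proof eventually_elim
      case (elim t)
      show ?case
      proof
        assume t: "t \<in> {t \<in> space lebm. l < norm (T f t)}"
        then have "l / 2 < norm (T G t) \<or> l / 2 < norm (T S t)"
          using norm_triangle_ineq[of "T G t" "T S t"] elim by auto
        moreover have "t \<in> ?A" if "l / 2 < norm (T G t)"
          using that t l p0 by (auto simp: ennreal_less_iff intro!: powr_less_mono2)
        ultimately show "t \<in> ?A \<union> ?B \<union> (Om \<inter> space lebm)"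
          using t l by (cases "t \<in> Om") (auto simp: ennreal_less_iff)
      qed
    qed
    show "?A \<union> ?B \<union> (Om \<inter> space lebm) \<in> sets lebm" using As Bs Oms' by auto
  qed
  also have "\<dots> \<le> emeasure lebm ?A + emeasure lebm ?B + emeasure lebm (Om \<inter> space lebm)"
    using As Bs Oms' by (intro order_trans[OF emeasure_subadditive] add_mono) auto
  also have "\<dots> \<le> ennreal (3 * B * 2 powr p0 * n / l) + ennreal (2 * D * n / (l / 2)) + ennreal (2 * n / l)"
    using A Bb OmR unfolding A_eq by (intro add_mono)
  also have "\<dots> = ennreal ((3 * B * 2 powr p0 + 2 + 4 * D) * n / l)"
    using B(1) D l n by (simp add: field_simps flip: ennreal_plus)
  finally show ?thesis .
qed

lemma weak_type:
  obtains C where "0 < C" "\<And>f l. f \<in> Linf_c \<Longrightarrow> 0 < l \<Longrightarrow>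
    emeasure lebm {t \<in> space lebm. l < norm (T f t)} \<le> ennreal (C / l) * (\<integral>\<^sup>+t. ennreal (norm (f t)) \<partial>lebm)"
proof -
  obtain B where B: "0 \<le> B" "\<And>f. f \<in> Linf_c \<Longrightarrow>
    (\<integral>\<^sup>+t. ennreal (norm (T f t) powr p0) \<partial>lebm) \<le> ennreal B * (\<integral>\<^sup>+t. ennreal (norm (f t) powr p0) \<partial>lebm)"
    using T_bound by blast
  let ?C = "3 * B * 2 powr p0 + 2 + 4 * D"
  have C: "0 < ?C" using B(1) D(2) by (simp add: add_nonneg_pos add_pos_nonneg)
  show ?thesis
  proof (rule that[OF C])
    fix f :: "real \<Rightarrow> 'x" and l :: real assume f: "f \<in> Linf_c" and l: "0 < l"
    obtain n where n: "(\<integral>\<^sup>+t. ennreal (norm (f t)) \<partial>lebm) = ennreal n" "0 \<le> n"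
      using Linf_c_integrable[OF f] by (cases "\<integral>\<^sup>+t. ennreal (norm (f t)) \<partial>lebm") auto
    show "emeasure lebm {t \<in> space lebm. l < norm (T f t)} \<le> ennreal (?C / l) * (\<integral>\<^sup>+t. ennreal (norm (f t)) \<partial>lebm)"
    \<comment> \<open>A zero integral would leave no room for the discarded part of
      \<open>U\<close>; in that case \<open>T f\<close> vanishes almost everywhere.\<close>
    proof (cases "n = 0")
      case True
      then have "(\<integral>\<^sup>+t. ennreal (norm (f t)) \<partial>lebm) = 0" using n(1) by simp
      then have "AE t in lebm. ennreal (norm (f t)) = 0"
        by (rule nn_integral_0_iff_AE[THEN iffD1, rotated]) (use Linf_c_norm_measurable[OF f] in simp)
      then have "AE t in lebm. f t = 0" by (rule eventually_mono) (auto simp: ennreal_eq_0_iff)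
      note zero = T_AE_zero[OF f this]
      have "{t \<in> space lebm. l < norm (T f t)} \<in> sets lebm" by (rule greater_sets[OF T_measurable[OF f]])
      moreover have "AE t in lebm. t \<notin> {t \<in> space lebm. l < norm (T f t)}"
        using zero by (rule eventually_mono) (use l in simp)
      ultimately have "{t \<in> space lebm. l < norm (T f t)} \<in> null_sets lebm"
        by (subst AE_iff_null_sets) auto
      then show ?thesis by (simp add: null_sets_def)
    next
      case False
      then have "0 < n" using n by simp
      from weak_type_aux[OF B f l n(1) this] show ?thesis
        using n C l by (simp add: field_simps flip: ennreal_mult)
    qed
  qed
qed

end

subsection \<open>The local good-lambda inequality\<close>

context sio
begin

definition q where "q = r / (r - 1)"

lemma q: "1 < q" "0 < q" "1 / q + 1 / r = 1" "1 / r + 1 / q = 1"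
proof -
  show "1 < q" using r by (simp add: q_def)
  then show "0 < q" by simp
  show "1 / q + 1 / r = 1" "1 / r + 1 / q = 1" using r by (auto simp: q_def field_simps)
qed

definition level :: "(real \<Rightarrow> 'x) \<Rightarrow> real \<Rightarrow> real set" where
  "level f l = {t \<in> space lebm. l < norm (T f t)}"

text \<open>The sets O(l) of the introduction.\<close>

definition maj_set :: "(real \<Rightarrow> 'x) \<Rightarrow> real \<Rightarrow> real set" where
  "maj_set f l = rs_set (indicator (level f l)) (1 / 2)"

text \<open>The function whose one-sided maximal function occurs on the right of the theorem,
  extended by 0. \<open>rs_set (fq f) (G powr q)\<close> is the set where this maximal function
  exceeds \<open>G powr q\<close>, see \<open>rs_set_Mplus\<close>.\<close>

definition fq :: "(real \<Rightarrow> 'x) \<Rightarrow> real \<Rightarrow> ennreal" where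
  "fq f t = ennreal (norm (f t) powr q) * indicator Rm t"

lemma sets_lebm_lebesgue: "A \<in> sets lebm \<Longrightarrow> A \<in> sets lebesgue"
  by (simp add: sets_restrict_space_iff)

lemma emeasure_lebm: "A \<subseteq> Rm \<Longrightarrow> emeasure lebm A = emeasure lebesgue A"
  by (rule emeasure_restrict_space) auto

lemma level_subset: "level f l \<subseteq> Rm" by (auto simp: level_def space_restrict_space)

lemma level_antimono: "l \<le> l' \<Longrightarrow> level f l' \<subseteq> level f l" by (auto simp: level_def)

lemma level_sets_lebm: "f \<in> Linf_c \<Longrightarrow> level f l \<in> sets lebm"
  unfolding level_def by (rule greater_sets[OF T_measurable])

lemma level_sets: "f \<in> Linf_c \<Longrightarrow> level f l \<in> sets lebesgue"
  by (rule sets_lebm_lebesgue[OF level_sets_lebm])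

lemma emeasure_level_finite:
  assumes f: "f \<in> Linf_c" and l: "0 < l"
  shows "emeasure lebesgue (level f l) < \<infinity>"
proof -
  have "emeasure lebesgue (level f l) = emeasure lebm (level f l)" by (rule emeasure_lebm[OF level_subset, symmetric])
  also have "\<dots> \<le> emeasure lebm {t \<in> space lebm. ennreal (l powr p0) < ennreal (norm (T f t) powr p0)}"
  proof (rule emeasure_mono)
    show "level f l \<subseteq> {t \<in> space lebm. ennreal (l powr p0) < ennreal (norm (T f t) powr p0)}"
      using l p0 by (auto simp: level_def ennreal_less_iff intro!: powr_less_mono2)
    show "{t \<in> space lebm. ennreal (l powr p0) < ennreal (norm (T f t) powr p0)} \<in> sets lebm"
      by (rule greater_sets[OF measurable_ennreal_powr[OF T_measurable[OF f]]])
  qed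
  also have "\<dots> < \<infinity>"
  proof -
    obtain k where k: "0 \<le> k" "(\<integral>\<^sup>+t. ennreal (norm (T f t) powr p0) \<partial>lebm) = ennreal k"
      using T_finite[OF f] by (cases "\<integral>\<^sup>+t. ennreal (norm (T f t) powr p0) \<partial>lebm") auto
    have "emeasure lebm {t \<in> space lebm. ennreal (l powr p0) < ennreal (norm (T f t) powr p0)} \<le> ennreal (k / l powr p0)"
      using k l by (intro Markov_bound measurable_ennreal_powr T_measurable f) auto
    also have "\<dots> < \<infinity>" by simp
    finally show ?thesis .
  qed
  finally show ?thesis .
qed

lemma rising_sun_indicator:
  assumes "A \<in> sets lebesgue" "A \<subseteq> Rm" "emeasure lebesgue A < \<infinity>"
  shows "rising_sun (indicator A) (1 / 2)"
proof
  show "(\<integral>\<^sup>+t. indicator A t \<partial>lebesgue) < \<infinity>" using assms by simp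
  show "indicator A t = (0::ennreal)" if "0 < t" for t using assms(2) that by (auto simp: indicator_def)
qed (use assms(1) in auto)

lemma rising_sun_level: "f \<in> Linf_c \<Longrightarrow> 0 < l \<Longrightarrow> rising_sun (indicator (level f l)) (1 / 2)"
  by (intro rising_sun_indicator level_sets level_subset emeasure_level_finite)

lemma maj_set_antimono: "l \<le> l' \<Longrightarrow> maj_set f l' \<subseteq> maj_set f l"
  unfolding maj_set_def by (rule rs_set_mono) (use level_antimono in \<open>auto simp: indicator_def\<close>)

lemma rising_sun_fq:
  assumes "f \<in> Linf_c" "0 < G"
  shows "rising_sun (fq f) G"
proof
  show "fq f \<in> borel_measurable lebesgue"
    using measurable_ennreal_powr[OF Linf_c_norm_measurable[OF assms(1)], of q] unfolding fq_def[abs_def]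
    by (subst borel_measurable_restrict_space_iff_ennreal[symmetric]) auto
  show "(\<integral>\<^sup>+t. fq f t \<partial>lebesgue) < \<infinity>"
    using Linf_c_powr_integrable[OF assms(1) q(2)] by (simp add: fq_def nn_integral_lebm)
qed (use assms in \<open>auto simp: fq_def\<close>)

lemma fq_integral: "(\<integral>\<^sup>+t\<in>A. fq f t \<partial>lebesgue) = (\<integral>\<^sup>+t\<in>A. ennreal (norm (f t) powr q) \<partial>lebm)"
  unfolding nn_integral_lebm by (intro nn_integral_cong) (auto simp: fq_def mult_ac)

text \<open>Outside the rising sun set all averages of \<open>fq f\<close> starting at
  \<open>z\<close> are at most \<open>G powr q\<close>. Hoelder's inequality against the indicator
  of the interval turns this into a bound for the averages of the norm.\<close>

lemma local_L1_bound:
  assumes f: "f \<in> Linf_c" and G: "0 < G" and z: "z \<notin> rs_set (fq f) (G powr q)" and k: "0 < k"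
  shows "(\<integral>\<^sup>+s\<in>{z..z+k}. ennreal (norm (f s)) \<partial>lebm) \<le> ennreal (k * G)"
    and "(\<integral>\<^sup>+s\<in>{z..z+k}. ennreal (norm (f s) powr q) \<partial>lebm) \<le> ennreal (k * G powr q)"
proof -
  interpret rs: rising_sun "fq f" "G powr q" using f G by (intro rising_sun_fq) auto
  have "(\<integral>\<^sup>+t\<in>{z..z+k}. fq f t \<partial>lebesgue) \<le> ennreal (G powr q * (z + k - z))"
    using k by (intro rs.notin_rs_setD[OF z]) auto
  then show 2: "(\<integral>\<^sup>+s\<in>{z..z+k}. ennreal (norm (f s) powr q) \<partial>lebm) \<le> ennreal (k * G powr q)"
    by (simp add: fq_integral mult.commute)
  define f1 where "f1 s = norm (f s) * indicator {z..z+k} s" for s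
  define f2 where "f2 s = (indicator {z..z+k} s :: real)" for s :: real
  have im: "(\<lambda>s. indicator {z..z+k} s :: real) \<in> borel_measurable lebm" by (rule measurable_indicator_lebm) simp
  have "(\<integral>\<^sup>+s\<in>{z..z+k}. ennreal (norm (f s)) \<partial>lebm) = (\<integral>\<^sup>+s. ennreal (f1 s * f2 s) \<partial>lebm)"
    by (intro nn_integral_cong) (auto simp: f1_def f2_def indicator_def)
  also have "\<dots> \<le> ennpow (\<integral>\<^sup>+s. ennreal (f1 s powr q) \<partial>lebm) (1 / q) * ennpow (\<integral>\<^sup>+s. ennreal (f2 s powr r) \<partial>lebm) (1 / r)"
  proof (rule nn_integral_Holder[OF _ _ _ _ q(1) q(3)])
    show "f1 \<in> borel_measurable lebm" unfolding f1_def
      by (intro borel_measurable_times Linf_c_norm_measurable[OF f] im)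
    show "f2 \<in> borel_measurable lebm" unfolding f2_def by (rule im)
  qed (auto simp: f1_def f2_def)
  also have "\<dots> \<le> ennpow (ennreal (k * G powr q)) (1 / q) * ennpow (ennreal k) (1 / r)"
  proof (intro mult_mono ennpow_mono)
    have "(\<integral>\<^sup>+s. ennreal (f1 s powr q) \<partial>lebm) = (\<integral>\<^sup>+s\<in>{z..z+k}. ennreal (norm (f s) powr q) \<partial>lebm)"
      using q by (intro nn_integral_cong) (auto simp: f1_def indicator_def)
    with 2 show "(\<integral>\<^sup>+s. ennreal (f1 s powr q) \<partial>lebm) \<le> ennreal (k * G powr q)" by simp
    have "(\<integral>\<^sup>+s. ennreal (f2 s powr r) \<partial>lebm) \<le> (\<integral>\<^sup>+s. indicator {z..z+k} s \<partial>lebesgue)"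
      unfolding nn_integral_lebm using r by (intro nn_integral_mono) (auto simp: f2_def indicator_def)
    also have "\<dots> = ennreal k" using k by (simp add: emeasure_lebesgue_Icc)
    finally show "(\<integral>\<^sup>+s. ennreal (f2 s powr r) \<partial>lebm) \<le> ennreal k" .
  qed (use q(2) r in auto)
  also have "\<dots> = ennreal ((k powr (1 / q) * k powr (1 / r)) * G)"
    using k G q(2) by (simp add: ennpow_ennreal powr_mult powr_powr mult_ac flip: ennreal_mult)
  also have "k powr (1 / q) * k powr (1 / r) = k"
    using k by (simp only: powr_add[symmetric] q(3)) simp
  finally show "(\<integral>\<^sup>+s\<in>{z..z+k}. ennreal (norm (f s)) \<partial>lebm) \<le> ennreal (k * G)" .
qed

text \<open>The excess \<kappa> * l is spent as follows: a quarter on the image of \<open>f1\<close>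
  at a reference point right of \<open>b\<close>, a quarter on the oscillation of the image of the
  tail, and half on the image of \<open>f1\<close> at the point considered. The mass of
  \<open>f1\<close> is at most 5 * L * G, so the weak type bound at \<kappa> * l / 2 gives 10 * C1 *
  \<gamma> / \<kappa> * L, and passing from the level set to \<open>maj_set\<close> doubles
  it.\<close>

lemma good_lambda_local:
  assumes f: "f \<in> Linf_c" and l: "0 < l" and kap: "0 < \<kappa>" and gam: "0 < \<gamma>"
    and C1: "0 < C1" "\<And>f l. f \<in> Linf_c \<Longrightarrow> 0 < l \<Longrightarrow>
      emeasure lebm {t \<in> space lebm. l < norm (T f t)} \<le> ennreal (C1 / l) * (\<integral>\<^sup>+t. ennreal (norm (f t)) \<partial>lebm)"
    and small: "320 * C1 * \<gamma> \<le> \<kappa>" "16 * D' * \<gamma> \<le> \<kappa>"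
    and zb: "z < b" "b \<le> 0" and bO: "b \<notin> maj_set f l"
    and zm: "z \<notin> rs_set (fq f) ((\<gamma> * l) powr q)"
  shows "emeasure lebesgue ({z..<b} \<inter> maj_set f ((1 + \<kappa>) * l)) \<le> ennreal (20 * C1 * \<gamma> / \<kappa> * (b - z))"
proof -
  define L where "L = b - z"
  have L: "0 < L" "b = z + L" using zb by (auto simp: L_def)
  define G where "G = \<gamma> * l"
  have G: "0 < G" using gam l by (simp add: G_def)
  note zm' = zm[folded G_def]
  define f0 where "f0 s = indicator {..<z} s *\<^sub>R f s" for s
  define f1 where "f1 s = indicator {z..z + 5 * L} s *\<^sub>R f s" for s
  \<comment> \<open>The tail starts so far out that it is separated from all points of
    \<open>(z, z + 2 * L)\<close> by more than 3 * L; this is the geometry required by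
    \<open>tail_bound\<close>.\<close>
  define f2 where "f2 s = indicator {z + 5 * L<..} s *\<^sub>R f s" for s
  have F: "f0 \<in> Linf_c" "f1 \<in> Linf_c" "f2 \<in> Linf_c"
    unfolding f0_def f1_def f2_def using Linf_c_indicator[OF f] by auto
  have sum: "f = (\<lambda>s. f0 s + (f1 s + f2 s))"
    using L by (auto simp: fun_eq_iff f0_def f1_def f2_def indicator_def)
  have T12: "AE t in lebm. z < t \<longrightarrow> T f t = T f1 t + T f2 t"
  proof -
    have "AE t in lebm. T (\<lambda>s. f0 s + (f1 s + f2 s)) t = T f0 t + T (\<lambda>s. f1 s + f2 s) t"
      by (rule T_add[OF F(1) Linf_c_add[OF F(2,3)]])
    moreover have "AE t in lebm. T (\<lambda>s. f1 s + f2 s) t = T f1 t + T f2 t" by (rule T_add[OF F(2,3)])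
    moreover have "AE t in lebm. z < t \<longrightarrow> T f0 t = 0"
      by (rule atom_right[OF F(1)]) (simp add: f0_def)
    ultimately show ?thesis by eventually_elim (simp add: sum[symmetric])
  qed
  have f1_int: "(\<integral>\<^sup>+s. ennreal (norm (f1 s)) \<partial>lebm) \<le> ennreal (5 * L * G)"
  proof -
    have "(\<integral>\<^sup>+s. ennreal (norm (f1 s)) \<partial>lebm) = (\<integral>\<^sup>+s\<in>{z..z + 5 * L}. ennreal (norm (f s)) \<partial>lebm)"
      by (intro nn_integral_cong) (auto simp: f1_def indicator_def)
    also have "\<dots> \<le> ennreal (5 * L * G)" using L(1) by (intro local_L1_bound(1)[OF f G zm']) auto
    finally show ?thesis .
  qed
  have W: "emeasure lebm (level f1 (\<kappa> * l / c)) \<le> ennreal (5 * c * C1 * \<gamma> / \<kappa> * L)" if c: "0 < c" for c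
  proof -
    have "emeasure lebm (level f1 (\<kappa> * l / c)) \<le> ennreal (C1 / (\<kappa> * l / c)) * (\<integral>\<^sup>+t. ennreal (norm (f1 t)) \<partial>lebm)"
      unfolding level_def using kap l c by (intro C1(2) F) auto
    also have "\<dots> \<le> ennreal (C1 / (\<kappa> * l / c)) * ennreal (5 * L * G)" by (rule mult_left_mono[OF f1_int]) simp
    also have "\<dots> = ennreal (5 * c * C1 * \<gamma> / \<kappa> * L)"
      using kap l c C1(1) L G by (simp add: G_def field_simps flip: ennreal_mult)
    finally show ?thesis .
  qed
  have f2_bound: "AE u in lebm. z < u \<and> u < b \<longrightarrow> norm (T f2 u) \<le> (1 + \<kappa> / 2) * l"
  proof (cases "z + 5 * L < 0")
    \<comment> \<open>The tail then lies outside the half-line and is zero almost everywhere. In the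
      other case the reference point in \<open>(b, b + L)\<close> is negative.\<close>
    case False
    have "AE t in lebm. f2 t = 0"
      using AE_space by eventually_elim (use False in \<open>auto simp: f2_def space_restrict_space indicator_def\<close>)
    from T_AE_zero[OF F(3) this] show ?thesis
      by eventually_elim (use kap l in auto)
  next
    case True
    obtain g where g: "AE t in lebm. g t = T f2 t"
      "\<And>t. t \<in> Rm - ess_supp f2 \<Longrightarrow> has_banach_integral lebm (\<lambda>s. blinfun_apply (K t s) (f2 s)) (g t)"
      using rep[OF F(3)] by blast
    have ns: "t \<in> Rm - ess_supp f2" if "t < z + 5 * L" for t
      using notin_ess_suppI[of "{..<z + 5 * L}" t f2] that True by (auto simp: f2_def)
    interpret rl: rising_sun "indicator (level f l)" "1 / 2" by (rule rising_sun_level[OF f l])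
    (* A reference point: the exceptional sets of T f and of T f1 do not fill (b, b + L). *)
    have "\<exists>v. b < v \<and> v < b + L \<and> norm (g v) \<le> (1 + \<kappa> / 4) * l"
    proof (rule ccontr)
      assume no: "\<not> (\<exists>v. b < v \<and> v < b + L \<and> norm (g v) \<le> (1 + \<kappa> / 4) * l)"
      let ?W = "level f1 (\<kappa> * l / 4)"
      have Vlev: "emeasure lebesgue (level f l \<inter> {b..b + L}) \<le> ennreal (L / 2)"
      proof -
        have "(\<integral>\<^sup>+t\<in>{b..b + L}. indicator (level f l) t \<partial>lebesgue) \<le> ennreal (1 / 2 * (b + L - b))"
          using L by (intro rl.notin_rs_setD) (use bO in \<open>auto simp: maj_set_def\<close>)
        then show ?thesis using level_sets[OF f] by (simp flip: indicator_inter_arith)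
      qed
      have V: "{b<..<b + L} \<in> sets lebm" "{b<..<b + L} \<subseteq> Rm"
      proof -
        show 1: "{b<..<b + L} \<subseteq> Rm" using True L by auto
        show "{b<..<b + L} \<in> sets lebm" using 1 by (simp add: sets_restrict_space_iff)
      qed
      have lv: "level f l \<inter> {b..b + L} \<in> sets lebm" "level f l \<inter> {b..b + L} \<subseteq> Rm"
        using level_sets[OF f] level_subset by (auto simp: sets_restrict_space_iff)
      have "ennreal L = emeasure lebm {b<..<b + L}"
        using L V by (simp add: emeasure_lebm emeasure_lebesgue_Ioo)
      also have "\<dots> \<le> emeasure lebm ((level f l \<inter> {b..b + L}) \<union> ?W)"
      proof (rule emeasure_mono_AE)
        show "AE t in lebm. t \<in> {b<..<b + L} \<longrightarrow> t \<in> (level f l \<inter> {b..b + L}) \<union> ?W"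
          using T12 g(1) AE_space
        proof eventually_elim
          case (elim t)
          show ?case
          proof
            assume t: "t \<in> {b<..<b + L}"
            then have "(1 + \<kappa> / 4) * l < norm (g t)" using no by (auto simp: not_le)
            moreover have "g t = T f t - T f1 t" using elim(1,2) t zb by auto
            then have "norm (g t) \<le> norm (T f t) + norm (T f1 t)"
              by (simp only: norm_triangle_ineq4)
            ultimately have "(1 + \<kappa> / 4) * l < norm (T f t) + norm (T f1 t)" by linarith
            then have "l < norm (T f t) \<or> \<kappa> * l / 4 < norm (T f1 t)" by (auto simp: algebra_simps)
            then show "t \<in> (level f l \<inter> {b..b + L}) \<union> ?W" using t elim(3) by (auto simp: level_def)
          qed
        qed
        show "(level f l \<inter> {b..b + L}) \<union> ?W \<in> sets lebm" using lv level_sets_lebm[OF F(2)] by auto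
      qed
      also have "\<dots> \<le> emeasure lebm (level f l \<inter> {b..b + L}) + emeasure lebm ?W"
        using lv level_sets_lebm[OF F(2)] by (intro emeasure_subadditive) auto
      also have "\<dots> \<le> ennreal (L / 2) + ennreal (5 * 4 * C1 * \<gamma> / \<kappa> * L)"
        using Vlev W[of 4] lv(2) by (intro add_mono) (auto simp: emeasure_lebm)
      also have "\<dots> = ennreal (L / 2 + 5 * 4 * C1 * \<gamma> / \<kappa> * L)"
        using L C1 gam kap by (intro ennreal_plus[symmetric]) auto
      finally have "L \<le> L / 2 + 5 * 4 * C1 * \<gamma> / \<kappa> * L"
        using L C1 gam kap by (subst (asm) ennreal_le_iff) auto
      moreover have "5 * 4 * C1 * \<gamma> / \<kappa> \<le> 1 / 4"
        using small(1) kap C1 gam by (simp add: field_simps)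
      then have "5 * 4 * C1 * \<gamma> / \<kappa> * L \<le> 1 / 4 * L" using L by (intro mult_right_mono) auto
      ultimately show False using L by linarith
    qed
    then obtain v where v: "b < v" "v < b + L" "norm (g v) \<le> (1 + \<kappa> / 4) * l" by blast
    \<comment> \<open>The kernel formula holds for the representative \<open>g\<close> at every
      point off the support, so it can be compared at each \<open>u\<close> with the single point
      \<open>v\<close>, which would be meaningless for an equivalence class.\<close>
    have main: "norm (g u) \<le> (1 + \<kappa> / 2) * l" if u: "z < u" "u < b" for u
    proof -
      have uv: "u < z + 5 * L" "v < z + 5 * L" "v < 0" using u v L True by auto
      have "has_banach_integral lebm (\<lambda>s. blinfun_apply (K u s) (f2 s) - blinfun_apply (K v s) (f2 s)) (g u - g v)"
        using uv by (intro has_banach_integral_diff complete_measure_lebm g(2) ns)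
      then have "ennreal (norm (g u - g v)) \<le> (\<integral>\<^sup>+s. ennreal (norm (blinfun_apply (K u s) (f2 s) - blinfun_apply (K v s) (f2 s))) \<partial>lebm)"
        by (rule has_banach_integral_norm_le[OF complete_measure_lebm])
      also have "\<dots> \<le> (\<integral>\<^sup>+s\<in>{z + 5 * L<..}. ennreal (norm (K u s - K v s) * norm (f s)) \<partial>lebm)"
      proof (rule nn_integral_mono)
        fix s
        have "norm (blinfun_apply (K u s) (f s) - blinfun_apply (K v s) (f s)) \<le> norm (K u s - K v s) * norm (f s)"
          by (metis blinfun.diff_left norm_blinfun)
        then show "ennreal (norm (blinfun_apply (K u s) (f2 s) - blinfun_apply (K v s) (f2 s)))
          \<le> ennreal (norm (K u s - K v s) * norm (f s)) * indicator {z + 5 * L<..} s"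
          by (cases "z + 5 * L < s") (auto simp: f2_def ennreal_leI blinfun.zero_right)
      qed
      also have "\<dots> \<le> ennreal (4 * D' * G)"
      proof (rule tail_bound[OF f])
        fix k :: real assume "0 < k"
        then show "(\<integral>\<^sup>+s\<in>{z..z + k}. ennreal (norm (f s) powr (r / (r - 1))) \<partial>lebm) \<le> ennreal (k * G powr (r / (r - 1)))"
          using local_L1_bound(2)[OF f G zm'] by (simp add: q_def)
      qed (use G u v L uv in auto)
      finally have "norm (g u - g v) \<le> 4 * D' * G" using D'(2) G by (simp add: ennreal_le_iff)
      moreover have "4 * D' * G \<le> \<kappa> / 4 * l"
      proof -
        have "16 * D' * \<gamma> * l \<le> \<kappa> * l" using small(2) l by (intro mult_right_mono) auto
        then show ?thesis by (simp add: G_def)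
      qed
      moreover have "norm (g u) \<le> norm (g v) + norm (g u - g v)" by (metis norm_triangle_sub)
      ultimately have "norm (g u) \<le> (1 + \<kappa> / 4) * l + \<kappa> / 4 * l" using v(3) by linarith
      also have "\<dots> = (1 + \<kappa> / 2) * l" by (simp add: algebra_simps)
      finally show ?thesis .
    qed
    show ?thesis using g(1) by eventually_elim (use main in metis)
  qed
  define B' where "B' = level f ((1 + \<kappa>) * l) \<inter> {z<..<b}"
  have l': "0 < (1 + \<kappa>) * l" using l kap by simp
  have B's: "B' \<in> sets lebesgue" "B' \<subseteq> Rm"
    unfolding B'_def using level_sets[OF f] level_subset by auto
  have B'_le: "emeasure lebesgue B' \<le> ennreal (5 * 2 * C1 * \<gamma> / \<kappa> * L)"
  proof -
    have "emeasure lebesgue B' = emeasure lebm B'" by (rule emeasure_lebm[OF B's(2), symmetric])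
    also have "\<dots> \<le> emeasure lebm (level f1 (\<kappa> * l / 2))"
    proof (rule emeasure_mono_AE)
      show "AE t in lebm. t \<in> B' \<longrightarrow> t \<in> level f1 (\<kappa> * l / 2)"
        using T12 f2_bound AE_space
      proof eventually_elim
        case (elim t)
        show ?case
        proof
          assume t: "t \<in> B'"
          then have "(1 + \<kappa>) * l < norm (T f t)" "z < t" "t < b" by (auto simp: B'_def level_def)
          moreover have "norm (T f t) \<le> norm (T f1 t) + norm (T f2 t)"
            using elim(1) \<open>z < t\<close> norm_triangle_ineq[of "T f1 t" "T f2 t"] by simp
          ultimately have "(1 + \<kappa>) * l < norm (T f1 t) + (1 + \<kappa> / 2) * l" using elim(2) by linarith
          then show "t \<in> level f1 (\<kappa> * l / 2)" using elim(3) by (auto simp: level_def algebra_simps)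
        qed
      qed
    qed (rule level_sets_lebm[OF F(2)])
    also have "\<dots> \<le> ennreal (5 * 2 * C1 * \<gamma> / \<kappa> * L)" by (rule W) simp
    finally show ?thesis .
  qed
  have B'_fin: "emeasure lebesgue B' < \<infinity>" using B'_le by (rule order_le_less_trans) simp
  interpret rb: rising_sun "indicator B'" "1 / 2" by (rule rising_sun_indicator[OF B's B'_fin])
  interpret rl: rising_sun "indicator (level f l)" "1 / 2" by (rule rising_sun_level[OF f l])
  interpret rl': rising_sun "indicator (level f ((1 + \<kappa>) * l))" "1 / 2" by (rule rising_sun_level[OF f l'])
  \<comment> \<open>Localization. If an interval that witnesses membership extends beyond
    \<open>b\<close>, its part to the right of \<open>b\<close> is at most half filled, because
    \<open>b\<close> is not in \<open>maj_set f l\<close>. The part to the left must then be more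
    than half filled and is itself a witness, in which only \<open>B'\<close> counts.\<close>
  have sub: "{z..<b} \<inter> maj_set f ((1 + \<kappa>) * l) \<subseteq> rs_set (indicator B') (1 / 2)"
  proof
    fix x assume "x \<in> {z..<b} \<inter> maj_set f ((1 + \<kappa>) * l)"
    then have x: "z \<le> x" "x < b" "x \<in> maj_set f ((1 + \<kappa>) * l)" by auto
    then obtain y where y: "x < y"
      "ennreal (1 / 2 * (y - x)) < (\<integral>\<^sup>+t\<in>{x..y}. indicator (level f ((1 + \<kappa>) * l)) t \<partial>lebesgue)"
      by (auto simp: maj_set_def rs_set_def)
    have eq: "(\<integral>\<^sup>+t\<in>{x..y'}. indicator (level f ((1 + \<kappa>) * l)) t \<partial>lebesgue) = (\<integral>\<^sup>+t\<in>{x..y'}. indicator B' t \<partial>lebesgue)"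
      if "y' \<le> b" for y'
      unfolding nn_integral_Icc_eq_Ioo
      by (intro nn_integral_cong) (use that x in \<open>auto simp: B'_def indicator_def\<close>)
    show "x \<in> rs_set (indicator B') (1 / 2)"
    proof (cases "y \<le> b")
      case True
      with y eq[OF True] show ?thesis by (auto simp: rs_set_def)
    next
      case False
      have "(\<integral>\<^sup>+t\<in>{b..y}. indicator (level f ((1 + \<kappa>) * l)) t \<partial>lebesgue) \<le> (\<integral>\<^sup>+t\<in>{b..y}. indicator (level f l) t \<partial>lebesgue)"
        using level_antimono[of l "(1 + \<kappa>) * l" f] l kap by (intro nn_integral_mono) (auto simp: indicator_def algebra_simps subset_iff)
      also have "\<dots> \<le> ennreal (1 / 2 * (y - b))"
        using False bO by (intro rl.notin_rs_setD) (auto simp: maj_set_def)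
      finally have 1: "(\<integral>\<^sup>+t\<in>{b..y}. indicator (level f ((1 + \<kappa>) * l)) t \<partial>lebesgue) \<le> ennreal (1 / 2 * (y - b))" .
      have "ennreal (1 / 2 * (b - x)) + ennreal (1 / 2 * (y - b)) = ennreal (1 / 2 * (y - x))"
        using x False by (subst ennreal_plus[symmetric]) (auto simp: field_simps)
      also note y(2)
      also have "(\<integral>\<^sup>+t\<in>{x..y}. indicator (level f ((1 + \<kappa>) * l)) t \<partial>lebesgue)
        = (\<integral>\<^sup>+t\<in>{x..b}. indicator (level f ((1 + \<kappa>) * l)) t \<partial>lebesgue) + (\<integral>\<^sup>+t\<in>{b..y}. indicator (level f ((1 + \<kappa>) * l)) t \<partial>lebesgue)"
        using x False by (intro nn_integral_Icc_split rl'.meas) auto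
      also have "\<dots> \<le> (\<integral>\<^sup>+t\<in>{x..b}. indicator B' t \<partial>lebesgue) + ennreal (1 / 2 * (y - b))"
        using 1 eq[of b] by (intro add_mono) auto
      finally have "ennreal (1 / 2 * (b - x)) < (\<integral>\<^sup>+t\<in>{x..b}. indicator B' t \<partial>lebesgue)"
        by (simp add: add.commute[of _ "ennreal (1 / 2 * (y - b))"] ennreal_add_left_cancel_less)
      then show ?thesis using x by (auto simp: rs_set_def)
    qed
  qed
  have "emeasure lebesgue ({z..<b} \<inter> maj_set f ((1 + \<kappa>) * l)) \<le> emeasure lebesgue (rs_set (indicator B') (1 / 2))"
    by (rule emeasure_mono[OF sub rb.sets_rs_set])
  also have "\<dots> = ennreal (2 * (1 / 2)) * emeasure lebesgue (rs_set (indicator B') (1 / 2))" by simp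
  also have "\<dots> = ennreal 2 * (ennreal (1 / 2) * emeasure lebesgue (rs_set (indicator B') (1 / 2)))"
    by (subst ennreal_mult) (auto simp only: mult.assoc)
  also have "\<dots> \<le> ennreal 2 * emeasure lebesgue B'"
    using rb.emeasure_rs_set_le B's(1) by (intro mult_left_mono) auto
  also have "\<dots> \<le> ennreal 2 * ennreal (5 * 2 * C1 * \<gamma> / \<kappa> * L)" by (rule mult_left_mono[OF B'_le]) simp
  also have "\<dots> = ennreal (20 * C1 * \<gamma> / \<kappa> * (b - z))"
    
    by (subst ennreal_mult[symmetric]) (use C1(1) gam kap L(1) in \<open>auto simp: L_def\<close>)
  finally show ?thesis .
qed

end

subsection \<open>Weights and integration of the good-lambda inequality\<close>

lemma less_divide_ennreal:
  assumes "0 < h"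
  shows "ennreal c < a / ennreal h \<longleftrightarrow> ennreal c * ennreal h < a"
proof -
  have "a / ennreal h \<le> ennreal c \<longleftrightarrow> a \<le> ennreal c * ennreal h"
  proof
    assume "a / ennreal h \<le> ennreal c"
    then have "a / ennreal h * ennreal h \<le> ennreal c * ennreal h" by (rule mult_right_mono) simp
    then show "a \<le> ennreal c * ennreal h" using assms by (simp add: ennreal_divide_times divide_mult_eq)
  next
    assume "a \<le> ennreal c * ennreal h"
    then have "a / ennreal h \<le> ennreal c * ennreal h / ennreal h" by (rule divide_right_mono_ennreal)
    then show "a / ennreal h \<le> ennreal c" using assms by (simp add: mult_divide_eq_ennreal)
  qed
  then show ?thesis by (auto simp: not_le[symmetric])
qed

lemma ennreal_greater_iff_ex:
  "(0::ennreal) < y \<longleftrightarrow> (\<exists>n. ennreal (1 / (real n + 1)) < y)"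
proof
  assume y: "0 < y"
  have "(\<lambda>n. ennreal (1 / (real n + 1))) \<longlonglongrightarrow> ennreal 0"
    using LIMSEQ_inverse_real_of_nat by (intro tendsto_ennrealI) (simp add: inverse_eq_divide add.commute)
  then have "\<forall>\<^sub>F n in sequentially. ennreal (1 / (real n + 1)) < y"
    using y by (intro order_tendstoD) auto
  then show "\<exists>n. ennreal (1 / (real n + 1)) < y" by (auto simp: eventually_sequentially)
next
  assume "\<exists>n. ennreal (1 / (real n + 1)) < y"
  then show "0 < y" by (metis order_le_less_trans zero_le)
qed

text \<open>The level 0 is a countable union of positive levels. The rising sun sets describe
  superlevel sets at positive levels only.\<close>

lemma borel_measurable_ennreal_posI:
  fixes f :: "'m \<Rightarrow> ennreal"
  assumes "\<And>c. 0 < c \<Longrightarrow> {x \<in> space M. ennreal c < f x} \<in> sets M"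
  shows "f \<in> borel_measurable M"
proof (rule borel_measurableI_greater)
  fix y :: ennreal
  show "{x \<in> space M. y < f x} \<in> sets M"
  proof (cases y)
    case (real c)
    show ?thesis
    proof (cases "c = 0")
      case True
      have "{x \<in> space M. y < f x} = (\<Union>n. {x \<in> space M. ennreal (1 / (real n + 1)) < f x})"
        using real True ennreal_greater_iff_ex by auto
      also have "\<dots> \<in> sets M" by (intro sets.countable_UN) (auto intro!: assms)
      finally show ?thesis .
    qed (use real assms in auto)
  qed simp
qed

lemma rs_set_Mplus:
  assumes "0 \<le> c"
  shows "ennreal c < Mplus g t \<longleftrightarrow> t \<in> rs_set (\<lambda>s. ennreal \<bar>g s\<bar> * indicator Rm s) c"
proof -
  have "ennreal c < Mplus g t \<longleftrightarrow> (\<exists>h>0. ennreal c * ennreal h < (\<integral>\<^sup>+s\<in>{t..t + h} \<inter> Rm. ennreal \<bar>g s\<bar> \<partial>lebesgue))"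
    unfolding Mplus_def by (auto simp: less_SUP_iff less_divide_ennreal)
  also have "\<dots> \<longleftrightarrow> (\<exists>h>0. ennreal (c * h) < (\<integral>\<^sup>+s\<in>{t..t + h}. ennreal \<bar>g s\<bar> * indicator Rm s \<partial>lebesgue))"
  proof -
    have "(\<integral>\<^sup>+s\<in>{t..t + h} \<inter> Rm. ennreal \<bar>g s\<bar> \<partial>lebesgue) = (\<integral>\<^sup>+s\<in>{t..t + h}. ennreal \<bar>g s\<bar> * indicator Rm s \<partial>lebesgue)" for h
      by (intro nn_integral_cong) (auto simp: indicator_def)
    then show ?thesis using assms by (auto simp: ennreal_mult)
  qed
  also have "\<dots> \<longleftrightarrow> t \<in> rs_set (\<lambda>s. ennreal \<bar>g s\<bar> * indicator Rm s) c"
  proof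
    assume "\<exists>h>0. ennreal (c * h) < (\<integral>\<^sup>+s\<in>{t..t + h}. ennreal \<bar>g s\<bar> * indicator Rm s \<partial>lebesgue)"
    then obtain h where "h > 0" "ennreal (c * h) < (\<integral>\<^sup>+s\<in>{t..t + h}. ennreal \<bar>g s\<bar> * indicator Rm s \<partial>lebesgue)" by blast
    then show "t \<in> rs_set (\<lambda>s. ennreal \<bar>g s\<bar> * indicator Rm s) c"
      unfolding rs_set_def by (intro CollectI exI[of _ "t + h"]) simp
  next
    assume "t \<in> rs_set (\<lambda>s. ennreal \<bar>g s\<bar> * indicator Rm s) c"
    then obtain y where "t < y" "ennreal (c * (y - t)) < (\<integral>\<^sup>+s\<in>{t..y}. ennreal \<bar>g s\<bar> * indicator Rm s \<partial>lebesgue)"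
      by (auto simp: rs_set_def)
    then show "\<exists>h>0. ennreal (c * h) < (\<integral>\<^sup>+s\<in>{t..t + h}. ennreal \<bar>g s\<bar> * indicator Rm s \<partial>lebesgue)"
      by (intro exI[of _ "y - t"]) simp
  qed
  finally show ?thesis .
qed

lemma ennpow_layer:
  assumes p: "0 < p"
  shows "ennpow y p = (\<integral>\<^sup>+l. (if 0 < l \<and> ennreal l < y then ennreal (p * l powr (p - 1)) else 0) \<partial>lborel)"
proof -
  have fin: "(\<integral>\<^sup>+l. (if 0 < l \<and> l < c then ennreal (p * l powr (p - 1)) else 0) \<partial>lborel) = ennreal (c powr p)" if c: "0 \<le> c" for c
  proof -
    have "((\<lambda>l. l powr (p - 1)) has_integral (c powr (p - 1 + 1) / (p - 1 + 1))) {0..c}"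
      by (rule has_integral_powr_from_0) (use p c in auto)
    from has_integral_mult_right[OF this, of p]
    have hi: "((\<lambda>l. p * l powr (p - 1)) has_integral c powr p) {0..c}" using p by simp
    have "(\<integral>\<^sup>+l. (if 0 < l \<and> l < c then ennreal (p * l powr (p - 1)) else 0) \<partial>lborel)
      = (\<integral>\<^sup>+l. ennreal (indicator {0..c} l * (p * l powr (p - 1))) \<partial>lborel)"
      by (intro nn_integral_cong_AE eventually_mono[OF AE_conjI[OF AE_lborel_singleton[of 0] AE_lborel_singleton[of c]]])
        (auto simp: indicator_def)
    also have "\<dots> = ennreal (c powr p)"
      by (rule nn_integral_has_integral_lebesgue[OF _ hi]) (use p in auto)
    finally show ?thesis .
  qed
  show ?thesis
  proof (cases y)
    case (real c)
    then have "(\<integral>\<^sup>+l. (if 0 < l \<and> ennreal l < y then ennreal (p * l powr (p - 1)) else 0) \<partial>lborel)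
      = (\<integral>\<^sup>+l. (if 0 < l \<and> l < c then ennreal (p * l powr (p - 1)) else 0) \<partial>lborel)"
      by (intro nn_integral_cong) (auto simp: ennreal_less_iff)
    then show ?thesis using fin[of c] real by (simp add: ennpow_ennreal)
  next
    case top
    \<comment> \<open>For \<open>y = \<infinity>\<close> the integral dominates that for every
      finite value \<open>c\<close>, hence every \<open>c powr p\<close>.\<close>
    have ge: "ennreal (c powr p) \<le> (\<integral>\<^sup>+l. (if 0 < l \<and> ennreal l < y then ennreal (p * l powr (p - 1)) else 0) \<partial>lborel)" if "0 \<le> c" for c
      unfolding fin[OF that, symmetric] by (intro nn_integral_mono) (auto simp: top)
    have "(\<integral>\<^sup>+l. (if 0 < l \<and> ennreal l < y then ennreal (p * l powr (p - 1)) else 0) \<partial>lborel) = top"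
    proof (rule ccontr)
      assume "\<not> ?thesis"
      then obtain k where k: "0 \<le> k" "(\<integral>\<^sup>+l. (if 0 < l \<and> ennreal l < y then ennreal (p * l powr (p - 1)) else 0) \<partial>lborel) = ennreal k"
        by (cases "\<integral>\<^sup>+l. (if 0 < l \<and> ennreal l < y then ennreal (p * l powr (p - 1)) else 0) \<partial>lborel") auto
      have "ennreal (((k + 1) powr (1 / p)) powr p) \<le> ennreal k" using ge[of "(k + 1) powr (1 / p)"] k by simp
      then show False using k p by (simp add: powr_powr ennreal_le_iff)
    qed
    then show ?thesis using top by simp
  qed
qed

locale layer_cake = sigma_finite_measure M for M :: "'m measure" +
  fixes p :: real
  assumes p: "0 < p"
begin

text \<open>The integrand of the layer cake formula, p * l powr (p - 1) times the distribution
  function of \<open>h\<close>. Written as an integral over \<open>M\<close>, it is an inner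
  integral of Tonelli's theorem, which also yields its measurability in \<open>l\<close>.\<close>

definition "\<Phi> h l = (\<integral>\<^sup>+x. (if 0 < l \<and> ennreal l < h x then ennreal (p * l powr (p - 1)) else 0) \<partial>M)"

lemma measurable_layer:
  assumes [measurable]: "h \<in> borel_measurable M"
  shows "(\<lambda>z. if 0 < snd z \<and> ennreal (snd z) < h (fst z) then ennreal (p * snd z powr (p - 1)) else 0)
    \<in> borel_measurable (M \<Otimes>\<^sub>M lborel)"
proof -
  have 1: "(\<lambda>z. ennreal (p * snd z powr (p - 1))) \<in> borel_measurable (M \<Otimes>\<^sub>M lborel)"
    using measurable_snd[of M lborel]
    by (intro measurable_compose[OF _ measurable_ennreal] borel_measurable_times borel_measurable_const powr_real_measurable) simp_all
  have 2: "{z \<in> space (M \<Otimes>\<^sub>M lborel). 0 < snd z \<and> ennreal (snd z) < h (fst z)} \<in> sets (M \<Otimes>\<^sub>M lborel)"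
    by measurable
  show ?thesis by (rule measurable_If[OF 1 _ 2]) simp
qed

lemma layer:
  assumes h: "h \<in> borel_measurable M"
  shows "(\<integral>\<^sup>+x. ennpow (h x) p \<partial>M) = (\<integral>\<^sup>+l. \<Phi> h l \<partial>lborel)" and "\<Phi> h \<in> borel_measurable lborel"
    and "\<Phi> h l = (if 0 < l then ennreal (p * l powr (p - 1)) * emeasure M {x \<in> space M. ennreal l < h x} else 0)"
proof -
  interpret P: pair_sigma_finite M lborel ..
  define k where "k x l = (if 0 < l \<and> ennreal l < h x then ennreal (p * l powr (p - 1)) else 0)" for x l
  have f: "(\<lambda>(x, l). k x l) \<in> borel_measurable (M \<Otimes>\<^sub>M lborel)"
    unfolding k_def case_prod_beta' by (rule measurable_layer[OF h])
  have \<Phi>k: "\<Phi> h = (\<lambda>l. \<integral>\<^sup>+x. k x l \<partial>M)" by (simp add: \<Phi>_def[abs_def] k_def)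
  have "(\<integral>\<^sup>+x. ennpow (h x) p \<partial>M) = (\<integral>\<^sup>+x. (\<integral>\<^sup>+l. k x l \<partial>lborel) \<partial>M)"
    by (simp only: ennpow_layer[OF p] k_def)
  also have "\<dots> = (\<integral>\<^sup>+l. \<Phi> h l \<partial>lborel)"
    unfolding \<Phi>k by (rule P.Fubini'[OF f, symmetric])
  finally show "(\<integral>\<^sup>+x. ennpow (h x) p \<partial>M) = (\<integral>\<^sup>+l. \<Phi> h l \<partial>lborel)" .
  have "(\<lambda>(l, x). k x l) \<in> borel_measurable (lborel \<Otimes>\<^sub>M M)"
    using measurable_pair_swap[OF f] by (simp only: prod.case)
  from borel_measurable_nn_integral_fst[OF this]
  show "\<Phi> h \<in> borel_measurable lborel" unfolding \<Phi>k by (simp only: prod.case)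
  have s: "{x \<in> space M. ennreal l < h x} \<in> sets M" by (rule greater_sets[OF h])
  have "\<Phi> h l = (\<integral>\<^sup>+x. ennreal (p * l powr (p - 1)) * indicator {x \<in> space M. ennreal l < h x} x \<partial>M)" if "0 < l"
    unfolding \<Phi>_def by (intro nn_integral_cong) (use that in auto)
  then show "\<Phi> h l = (if 0 < l then ennreal (p * l powr (p - 1)) * emeasure M {x \<in> space M. ennreal l < h x} else 0)"
    using nn_integral_cmult_indicator[OF s] by (cases "0 < l") (auto simp: \<Phi>_def)
qed

text \<open>Dilating the level by \<open>c\<close> is the same as dividing the function by
  \<open>c\<close>. In this way the levels \<rho> * l and \<gamma> * l of the good-lambda inequality
  turn into the factors \<rho> powr - p and \<gamma> powr - p after integration.\<close>

lemma scaled: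
  assumes h: "h \<in> borel_measurable M" and c: "0 < c"
  shows "(\<integral>\<^sup>+x. ennpow (ennreal (1 / c) * h x) p \<partial>M) = ennreal (c powr - p) * (\<integral>\<^sup>+x. ennpow (h x) p \<partial>M)"
    and "\<Phi> (\<lambda>x. ennreal (1 / c) * h x) l
      = (if 0 < l then ennreal (p * l powr (p - 1)) * emeasure M {x \<in> space M. ennreal (c * l) < h x} else 0)"
proof -
  have "ennpow (ennreal (1 / c) * h x) p = ennreal (c powr - p) * ennpow (h x) p" for x
    using c p by (simp add: ennpow_mult ennpow_ennreal powr_divide powr_minus_divide)
  then show "(\<integral>\<^sup>+x. ennpow (ennreal (1 / c) * h x) p \<partial>M) = ennreal (c powr - p) * (\<integral>\<^sup>+x. ennpow (h x) p \<partial>M)"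
    using h by (simp add: nn_integral_cmult)
  have eq: "ennreal l < ennreal (1 / c) * h x \<longleftrightarrow> ennreal (c * l) < h x" if "0 < l" for x
  proof -
    have "ennreal (1 / c) * h x = h x / ennreal c"
      using c by (simp add: divide_ennreal_def inverse_ennreal inverse_eq_divide mult.commute)
    then show ?thesis using less_divide_ennreal[OF c, of l "h x"] that c by (simp add: mult.commute flip: ennreal_mult)
  qed
  have m: "(\<lambda>x. ennreal (1 / c) * h x) \<in> borel_measurable M" using h by simp
  show "\<Phi> (\<lambda>x. ennreal (1 / c) * h x) l
      = (if 0 < l then ennreal (p * l powr (p - 1)) * emeasure M {x \<in> space M. ennreal (c * l) < h x} else 0)"
    unfolding layer(3)[OF m] using eq by (cases "0 < l") simp_all
qed

text \<open>The hypothesis \<open>gl\<close> is the factor 1 - 1 / A in additive form, since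
  subtraction is unsafe in the extended half-line. With \<open>J\<close> and \<open>I\<close> the
  integrals of \<open>N\<close> and \<open>m\<close>, integration gives A * J + J / 2 \<le> A * J +
  A * \<gamma> powr - p * I, where the choice of \<rho> has been used. As \<open>J\<close> is
  finite, A * J may be cancelled.\<close>

lemma good_lambda:
  assumes N: "N \<in> borel_measurable M" and m: "m \<in> borel_measurable M"
    and A: "1 \<le> A" and \<rho>: "0 < \<rho>" "\<rho> powr - p = 1 - 1 / (2 * A)" and \<gamma>: "0 < \<gamma>"
    and gl: "\<And>l. 0 < l \<Longrightarrow> ennreal A * emeasure M {x \<in> space M. ennreal (\<rho> * l) < N x \<and> \<not> ennreal (\<gamma> * l) < m x}
      + emeasure M {x \<in> space M. ennreal l < N x} \<le> ennreal A * emeasure M {x \<in> space M. ennreal l < N x}"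
    and fin: "(\<integral>\<^sup>+x. ennpow (N x) p \<partial>M) < \<infinity>"
  shows "(\<integral>\<^sup>+x. ennpow (N x) p \<partial>M) \<le> ennreal (2 * A * \<gamma> powr - p) * (\<integral>\<^sup>+x. ennpow (m x) p \<partial>M)"
proof -
  let ?N = "\<lambda>x. ennreal (1 / \<rho>) * N x" and ?m = "\<lambda>x. ennreal (1 / \<gamma>) * m x"
  have N': "?N \<in> borel_measurable M" and m': "?m \<in> borel_measurable M" using N m by auto
  have pt: "ennreal A * \<Phi> ?N l + \<Phi> N l \<le> ennreal A * \<Phi> N l + ennreal A * \<Phi> ?m l" for l
  proof (cases "0 < l")
    case True
    define E1 where "E1 = emeasure M {x \<in> space M. ennreal (\<rho> * l) < N x}"
    define E2 where "E2 = emeasure M {x \<in> space M. ennreal (\<rho> * l) < N x \<and> \<not> ennreal (\<gamma> * l) < m x}"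
    define E3 where "E3 = emeasure M {x \<in> space M. ennreal (\<gamma> * l) < m x}"
    define E4 where "E4 = emeasure M {x \<in> space M. ennreal l < N x}"
    define c where "c = ennreal (p * l powr (p - 1))"
    have s1: "{x \<in> space M. ennreal (\<rho> * l) < N x} \<in> sets M" by (rule greater_sets[OF N])
    have s3: "{x \<in> space M. ennreal (\<gamma> * l) < m x} \<in> sets M" by (rule greater_sets[OF m])
    have s2: "{x \<in> space M. ennreal (\<rho> * l) < N x \<and> \<not> ennreal (\<gamma> * l) < m x} \<in> sets M"
      using sets.Diff[OF s1 s3] by (rule back_subst[of "\<lambda>A. A \<in> sets M"]) auto
    have "E1 \<le> emeasure M ({x \<in> space M. ennreal (\<rho> * l) < N x \<and> \<not> ennreal (\<gamma> * l) < m x} \<union> {x \<in> space M. ennreal (\<gamma> * l) < m x})"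
      unfolding E1_def using s2 s3 by (intro emeasure_mono) auto
    also have "\<dots> \<le> E2 + E3" unfolding E2_def E3_def by (rule emeasure_subadditive[OF s2 s3])
    finally have E1: "E1 \<le> E2 + E3" .
    have "ennreal A * E1 + E4 \<le> ennreal A * (E2 + E3) + E4" by (intro add_mono mult_left_mono E1) auto
    also have "\<dots> = (ennreal A * E2 + E4) + ennreal A * E3" by (simp add: algebra_simps)
    also have "\<dots> \<le> ennreal A * E4 + ennreal A * E3"
      using gl[OF True] by (intro add_mono) (auto simp: E2_def E4_def)
    finally have "c * (ennreal A * E1 + E4) \<le> c * (ennreal A * E4 + ennreal A * E3)" by (rule mult_left_mono) simp
    then show ?thesis
      using True by (simp add: scaled(2)[OF N \<rho>(1)] scaled(2)[OF m \<gamma>] layer(3)[OF N] c_def[symmetric]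
          E1_def[symmetric] E3_def[symmetric] E4_def[symmetric] distrib_left mult.left_commute)
  qed (simp add: \<Phi>_def)
  define J where "J = (\<integral>\<^sup>+x. ennpow (N x) p \<partial>M)"
  define I where "I = (\<integral>\<^sup>+x. ennpow (m x) p \<partial>M)"
  have "ennreal A * (\<integral>\<^sup>+l. \<Phi> ?N l \<partial>lborel) + (\<integral>\<^sup>+l. \<Phi> N l \<partial>lborel) = (\<integral>\<^sup>+l. ennreal A * \<Phi> ?N l + \<Phi> N l \<partial>lborel)"
    using layer(2)[OF N'] layer(2)[OF N] by (simp add: nn_integral_add nn_integral_cmult)
  also have "\<dots> \<le> (\<integral>\<^sup>+l. ennreal A * \<Phi> N l + ennreal A * \<Phi> ?m l \<partial>lborel)" by (rule nn_integral_mono[OF pt])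
  also have "\<dots> = ennreal A * (\<integral>\<^sup>+l. \<Phi> N l \<partial>lborel) + ennreal A * (\<integral>\<^sup>+l. \<Phi> ?m l \<partial>lborel)"
    using layer(2)[OF m'] layer(2)[OF N] by (simp add: nn_integral_add nn_integral_cmult)
  finally have main: "ennreal A * (ennreal (1 - 1 / (2 * A)) * J) + J \<le> ennreal A * J + ennreal A * (ennreal (\<gamma> powr - p) * I)"
    unfolding J_def I_def layer(1)[OF N', symmetric] layer(1)[OF N, symmetric] layer(1)[OF m', symmetric]
      scaled(1)[OF N \<rho>(1)] scaled(1)[OF m \<gamma>] \<rho>(2) .
  obtain j where j: "0 \<le> j" "J = ennreal j" using fin unfolding J_def by (cases "\<integral>\<^sup>+x. ennpow (N x) p \<partial>M") auto
  have "J \<le> ennreal (2 * A * \<gamma> powr - p) * I"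
  proof (cases I)
    case (real i)
    have A2: "0 \<le> 1 - 1 / (2 * A)" using A by (simp add: field_simps)
    have "ennreal (A * ((1 - 1 / (2 * A)) * j) + j) \<le> ennreal (A * j + A * (\<gamma> powr - p * i))"
      using main j real A A2 by (simp add: ennreal_mult)
    then have "A * ((1 - 1 / (2 * A)) * j) + j \<le> A * j + A * (\<gamma> powr - p * i)"
      using A j real by (subst (asm) ennreal_le_iff) auto
    moreover have "A * ((1 - 1 / (2 * A)) * j) = A * j - j / 2" using A by (simp add: field_simps)
    ultimately have "j \<le> 2 * A * \<gamma> powr - p * i" by simp
    then show ?thesis using j real A by (simp add: ennreal_leI flip: ennreal_mult)
  next
    case top
    then show ?thesis using A \<gamma> by (simp add: ennreal_mult_top)
  qed
  then show ?thesis by (simp add: J_def I_def)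
qed

end

text \<open>The only consequence of the conditions on the weight that the good-lambda argument uses.\<close>

definition weight_cond :: "(real \<Rightarrow> real) \<Rightarrow> real \<Rightarrow> bool" where
  "weight_cond w A \<longleftrightarrow> is_weight w \<and> (\<forall>a b c S. a < b \<and> b < c \<and> c \<le> 0 \<and> S \<in> sets lebesgue \<and> S \<subseteq> {b..c} \<and>
     ennreal ((c - a) / 4) \<le> emeasure lebesgue S \<longrightarrow> wmeas w {a<..<b} \<le> ennreal A * wmeas w S)"

lemma wmeas_lebm: "S \<subseteq> Rm \<Longrightarrow> wmeas w S = (\<integral>\<^sup>+t\<in>S. ennreal (w t) \<partial>lebm)"
  unfolding wmeas_def by (rule nn_integral_lebm_subset)

lemma wmeas_density:
  assumes "is_weight w" "S \<in> sets lebm"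
  shows "emeasure (density lebm (\<lambda>t. ennreal (w t))) S = wmeas w S"
  using assms sets.sets_into_space[OF assms(2)]
  by (subst emeasure_density) (auto simp: is_weight_def wmeas_lebm space_restrict_space)

text \<open>Needed for Tonelli's theorem in the layer cake formula. A weight may fail to be
  integrable on bounded intervals, so these are also cut down to the set where \<open>w\<close> is
  at most \<open>n\<close>.\<close>

lemma sigma_finite_weight:
  assumes w: "is_weight w"
  shows "sigma_finite_measure (density lebm (\<lambda>t. ennreal (w t)))"
proof
  define A where "A n = {t \<in> space lebm. w t \<le> real n} \<inter> ({- real n..} \<inter> space lebm)" for n :: nat
  have wm: "w \<in> borel_measurable lebm" using w by (simp add: is_weight_def)
  have s: "A n \<in> sets lebm" for n
  proof -
    have "{t \<in> space lebm. w t \<le> real n} \<in> sets lebm" using wm by measurable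
    then show ?thesis unfolding A_def by (intro sets.Int Int_space_lebm) auto
  qed
  have U: "(\<Union>n. A n) = Rm"
  proof -
    have "t \<in> (\<Union>n. A n)" if "t \<le> 0" for t
    proof -
      obtain n :: nat where "max (w t) (- t) \<le> real n" using real_arch_simple by blast
      then have "t \<in> A n" using that by (auto simp: A_def space_restrict_space)
      then show ?thesis by blast
    qed
    then show ?thesis by (auto simp: A_def space_restrict_space)
  qed
  have fin: "emeasure (density lebm (\<lambda>t. ennreal (w t))) (A n) \<noteq> \<infinity>" for n
  proof -
    have "emeasure (density lebm (\<lambda>t. ennreal (w t))) (A n) = (\<integral>\<^sup>+t\<in>A n. ennreal (w t) \<partial>lebm)"
      using wm s by (intro emeasure_density) auto
    also have "\<dots> \<le> (\<integral>\<^sup>+t. ennreal (real n) * indicator {- real n..0} t \<partial>lebesgue)"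
      unfolding nn_integral_lebm
      by (intro nn_integral_mono) (auto simp: A_def indicator_def space_restrict_space intro!: ennreal_leI)
    also have "\<dots> = ennreal (real n) * ennreal (real n)"
      by (simp add: nn_integral_cmult_indicator emeasure_lebesgue_Icc)
    also have "\<dots> < \<infinity>" by (simp add: ennreal_mult_less_top)
    finally show ?thesis by simp
  qed
  show "\<exists>\<A>. countable \<A> \<and> \<A> \<subseteq> sets (density lebm (\<lambda>t. ennreal (w t))) \<and> \<Union>\<A> = space (density lebm (\<lambda>t. ennreal (w t)))
    \<and> (\<forall>a\<in>\<A>. emeasure (density lebm (\<lambda>t. ennreal (w t))) a \<noteq> \<infinity>)"
    using s U fin by (intro exI[of _ "range A"]) (auto simp: space_restrict_space)
qed


section \<open>The good-lambda inequality for the weighted measure\<close>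

context sio
begin

text \<open>The points \<open>x i\<close> halve the distance to \<open>b\<close>, so every piece has
  a length comparable with its distance to \<open>b\<close>, the scale on which
  \<open>good_lambda_local\<close> is effective. The condition on the weight bounds each piece by
  the part of the next one outside \<open>E\<close>.\<close>

lemma maj_set_weight_component:
  assumes f: "f \<in> Linf_c" and l: "0 < l" and kap: "0 < \<kappa>" and gam: "0 < \<gamma>"
    and C1: "0 < C1" "\<And>f l. f \<in> Linf_c \<Longrightarrow> 0 < l \<Longrightarrow>
      emeasure lebm {t \<in> space lebm. l < norm (T f t)} \<le> ennreal (C1 / l) * (\<integral>\<^sup>+t. ennreal (norm (f t)) \<partial>lebm)"
    and small: "320 * C1 * \<gamma> \<le> \<kappa>" "16 * D' * \<gamma> \<le> \<kappa>"
    and w: "weight_cond w A"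
    and E: "E = maj_set f ((1 + \<kappa>) * l) - rs_set (fq f) ((\<gamma> * l) powr q)"
    and ab: "a < b" "b \<le> 0" "b \<notin> maj_set f l"
  shows "wmeas w {a<..<b} \<le> ennreal A * wmeas w ({a<..<b} - E)"
proof -
  define d where "d i = (b - a) / 2 ^ i" for i
  define x where "x i = b - d i" for i
  have d: "0 < d i" "d (Suc i) = d i / 2" for i using ab by (auto simp: d_def)
  have x0: "x 0 = a" by (simp add: x_def d_def)
  have xb: "x i < b" for i using d(1)[of i] by (simp add: x_def)
  have xS: "x (Suc i) = x i + d i / 2" for i by (simp add: x_def d(2))
  have xmono: "x i \<le> x j" if "i \<le> j" for i j
    using that by (rule lift_Suc_mono_le[rotated]) (use xS d(1) in \<open>simp add: less_imp_le\<close>)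
  have l': "0 < (1 + \<kappa>) * l" using l kap by simp
  interpret rl': rising_sun "indicator (level f ((1 + \<kappa>) * l))" "1 / 2" by (rule rising_sun_level[OF f l'])
  interpret rq: rising_sun "fq f" "(\<gamma> * l) powr q" using gam l by (intro rising_sun_fq[OF f]) simp
  have Os: "maj_set f ((1 + \<kappa>) * l) \<in> sets lebesgue" unfolding maj_set_def by (rule rl'.sets_rs_set)
  have Es: "E \<in> sets lebesgue" unfolding E using Os rq.sets_rs_set by auto
  have Esmall: "emeasure lebesgue (E \<inter> {x i<..<x (Suc i)}) \<le> ennreal (d i / 8)" for i
  proof (cases "E \<inter> {x i<..<x (Suc i)} = {}")
    case False
    let ?S = "E \<inter> {x i<..<x (Suc i)}"
    have bb: "bdd_below ?S" by (rule bdd_belowI[of _ "x i"]) auto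
    \<comment> \<open>The local estimate must start at a point outside the superlevel set of the
      maximal function, and points of \<open>E\<close> have this property. Starting near the infimum
      loses at most d i / 16. The rest is at most 20 * C1 * \<gamma> / \<kappa> times d i, which is
      again at most d i / 16; this is the origin of 320 = 20 * 16.\<close>
    have "\<exists>z\<in>?S. z < Inf ?S + d i / 16"
      by (rule cInf_lessD[OF False]) (use d(1)[of i] in simp)
    then obtain z where z: "z \<in> ?S" "z < Inf ?S + d i / 16" by blast
    have zb: "z < b" using z(1) xb[of "Suc i"] by auto
    have zi: "Inf ?S \<le> z" by (rule cInf_lower[OF z(1) bb])
    have "?S \<subseteq> {Inf ?S..z} \<union> ({z..<b} \<inter> maj_set f ((1 + \<kappa>) * l))"
    proof
      fix t assume t: "t \<in> ?S"
      then have "Inf ?S \<le> t" by (rule cInf_lower[OF _ bb])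
      moreover have "t < b" "t \<in> maj_set f ((1 + \<kappa>) * l)" using t xb[of "Suc i"] by (auto simp: E)
      ultimately show "t \<in> {Inf ?S..z} \<union> ({z..<b} \<inter> maj_set f ((1 + \<kappa>) * l))" by auto
    qed
    then have "emeasure lebesgue ?S \<le> emeasure lebesgue ({Inf ?S..z} \<union> ({z..<b} \<inter> maj_set f ((1 + \<kappa>) * l)))"
      using Os by (intro emeasure_mono) auto
    also have "\<dots> \<le> emeasure lebesgue {Inf ?S..z} + emeasure lebesgue ({z..<b} \<inter> maj_set f ((1 + \<kappa>) * l))"
      using Os by (intro emeasure_subadditive) auto
    also have "\<dots> \<le> ennreal (d i / 16) + ennreal (d i / 16)"
    proof (rule add_mono)
      show "emeasure lebesgue {Inf ?S..z} \<le> ennreal (d i / 16)"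
        using z(2) zi by (subst emeasure_lebesgue_Icc) (auto intro!: ennreal_leI)
      have "z \<notin> rs_set (fq f) ((\<gamma> * l) powr q)" using z(1) by (auto simp: E)
      then have "emeasure lebesgue ({z..<b} \<inter> maj_set f ((1 + \<kappa>) * l)) \<le> ennreal (20 * C1 * \<gamma> / \<kappa> * (b - z))"
        by (intro good_lambda_local[OF f l kap gam C1 small zb ab(2,3)])
      also have "\<dots> \<le> ennreal (d i / 16)"
      proof (rule ennreal_leI)
        have "20 * C1 * \<gamma> / \<kappa> \<le> 1 / 16" using small(1) kap by (simp add: field_simps)
        moreover have "b - z \<le> d i" using z(1) by (auto simp: x_def)
        ultimately have "20 * C1 * \<gamma> / \<kappa> * (b - z) \<le> 1 / 16 * d i" using zb by (intro mult_mono) auto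
        then show "20 * C1 * \<gamma> / \<kappa> * (b - z) \<le> d i / 16" by simp
      qed
      finally show "emeasure lebesgue ({z..<b} \<inter> maj_set f ((1 + \<kappa>) * l)) \<le> ennreal (d i / 16)" .
    qed
    also have "\<dots> = ennreal (d i / 8)" using d(1)[of i] by (simp flip: ennreal_plus)
    finally show ?thesis .
  qed simp
  \<comment> \<open>The good part of the next piece, which has length d i / 4 and loses at most d i
    / 16 to \<open>E\<close>.\<close>
  define S where "S i = {x (Suc i)<..<x (Suc (Suc i))} - E" for i
  have Ss: "S i \<in> sets lebesgue" for i unfolding S_def using Es by auto
  have step: "wmeas w {x i<..<x (Suc i)} \<le> ennreal A * wmeas w (S i)" for i
  proof -
    have len: "x (Suc (Suc i)) - x (Suc i) = d i / 4" by (simp add: xS d)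
    have "ennreal (d i / 4) = emeasure lebesgue {x (Suc i)<..<x (Suc (Suc i))}"
      using len d(1)[of i] by (subst emeasure_lebesgue_Ioo) auto
    also have "\<dots> \<le> emeasure lebesgue (S i \<union> (E \<inter> {x (Suc i)<..<x (Suc (Suc i))}))"
      using Es Ss by (intro emeasure_mono) (auto simp: S_def)
    also have "\<dots> \<le> emeasure lebesgue (S i) + emeasure lebesgue (E \<inter> {x (Suc i)<..<x (Suc (Suc i))})"
      using Es Ss by (intro emeasure_subadditive) auto
    also have "\<dots> \<le> emeasure lebesgue (S i) + ennreal (d i / 16)"
      using Esmall[of "Suc i"] by (intro add_left_mono) (simp add: d)
    finally have le: "ennreal (d i / 4) \<le> emeasure lebesgue (S i) + ennreal (d i / 16)" .
    \<comment> \<open>The remaining 3 * d i / 16 is exactly a quarter of 3 * d i / 4, the joint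
      length of the two pieces; this matches the proportion 1 / 4 in
      \<open>weight_cond\<close>.\<close>
    have "ennreal (3 * d i / 16) \<le> emeasure lebesgue (S i)"
    proof (cases "emeasure lebesgue (S i)")
      case (real s)
      then have "ennreal (d i / 4) \<le> ennreal (s + d i / 16)" using le d(1)[of i] by simp
      then have "d i / 4 \<le> s + d i / 16" using real d(1)[of i] by (subst (asm) ennreal_le_iff) auto
      then show ?thesis using real by (simp add: ennreal_leI)
    qed simp
    moreover have "(x (Suc (Suc i)) - x i) / 4 = 3 * d i / 16" by (simp add: xS d)
    moreover have "x i < x (Suc i)" "x (Suc i) < x (Suc (Suc i))" using d(1)[of i] by (simp_all add: xS d)
    moreover have "x (Suc (Suc i)) \<le> 0" using xb[of "Suc (Suc i)"] ab by simp
    moreover have "S i \<subseteq> {x (Suc i)..x (Suc (Suc i))}" by (auto simp: S_def)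
    ultimately show ?thesis using w Ss[of i] unfolding weight_cond_def by (metis (no_types, lifting))
  qed
  let ?\<nu> = "density lebm (\<lambda>t. ennreal (w t))"
  have isw: "is_weight w" using w by (simp add: weight_cond_def)
  have neg: "{a<..<b} \<subseteq> Rm" using ab by auto
  have toset: "X \<in> sets lebm" if "X \<in> sets lebesgue" "X \<subseteq> {a<..<b}" for X
    using that neg by (auto simp: sets_restrict_space_iff)
  have Ssub: "S i \<subseteq> {a<..<b} - E" for i
    using xmono[of 0 "Suc i"] xb[of "Suc (Suc i)"] x0 by (auto simp: S_def)
  have Isub: "{x i<..<x (Suc i)} \<subseteq> {a<..<b}" for i
    using xmono[of 0 i] xb[of "Suc i"] x0 by auto
  have Sl: "S i \<in> sets lebm" for i by (rule toset[OF Ss]) (use Ssub in auto)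
  have Il: "{x i<..<x (Suc i)} \<in> sets lebm" for i by (rule toset[OF _ Isub]) simp
  \<comment> \<open>The open pieces omit the division points, which form a countable and hence null
    set.\<close>
  have "AE t in lebesgue. \<forall>i. t \<noteq> x i" by (simp add: AE_all_countable AE_lebesgue_neq)
  then have cover: "AE t in lebm. \<forall>i. t \<noteq> x i" unfolding AE_lebm_iff by (rule eventually_mono) auto
  have "wmeas w {a<..<b} = emeasure ?\<nu> {a<..<b}" by (rule wmeas_density[OF isw toset, symmetric]) auto
  also have "\<dots> \<le> emeasure ?\<nu> (\<Union>i. {x i<..<x (Suc i)})"
  proof (rule emeasure_mono_AE)
    have wm: "(\<lambda>t. ennreal (w t)) \<in> borel_measurable lebm"
      using isw unfolding is_weight_def by (intro measurable_compose[OF _ measurable_ennreal]) blast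
    show "AE t in ?\<nu>. t \<in> {a<..<b} \<longrightarrow> t \<in> (\<Union>i. {x i<..<x (Suc i)})"
      unfolding AE_density[OF wm] using cover
    proof eventually_elim
      case (elim t)
      show ?case
      proof (intro impI)
        assume t: "t \<in> {a<..<b}"
        then have "0 < (b - t) / (b - a)" using ab by simp
        then obtain n where "(1 / 2) ^ n < (b - t) / (b - a)" using real_arch_pow_inv[of _ "1 / 2"] by auto
        then have "d n < b - t" using ab by (simp add: d_def power_one_over field_simps)
        then have ex: "\<exists>n. t < x n" by (intro exI[of _ n]) (simp add: x_def)
        define k where "k = (LEAST n. t < x n)"
        have k: "t < x k" unfolding k_def using ex by (rule LeastI_ex)
        have "k \<noteq> 0" using k x0 t by (metis greaterThanLessThan_iff less_asym)
        then obtain i where i: "k = Suc i" by (cases k) auto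
        have "\<not> t < x i" using not_less_Least[of i "\<lambda>n. t < x n"] i unfolding k_def by auto
        then have "x i < t" using elim by (metis linorder_neqE_linordered_idom)
        then show "t \<in> (\<Union>i. {x i<..<x (Suc i)})" using k i by auto
      qed
    qed
    show "(\<Union>i. {x i<..<x (Suc i)}) \<in> sets ?\<nu>" using Il by auto
  qed
  also have "\<dots> \<le> (\<Sum>i. emeasure ?\<nu> {x i<..<x (Suc i)})"
    by (rule emeasure_subadditive_countably) (use Il in auto)
  also have "\<dots> \<le> (\<Sum>i. ennreal A * emeasure ?\<nu> (S i))"
    by (intro suminf_le) (use step in \<open>simp_all add: wmeas_density[OF isw Il] wmeas_density[OF isw Sl]\<close>)
  also have "\<dots> = ennreal A * (\<Sum>i. emeasure ?\<nu> (S i))" by (rule ennreal_suminf_cmult)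
  also have "(\<Sum>i. emeasure ?\<nu> (S i)) = emeasure ?\<nu> (\<Union>i. S i)"
  proof (rule suminf_emeasure)
    show "range S \<subseteq> sets ?\<nu>" using Sl by auto
    have "S i \<inter> S j = {}" if "i < j" for i j
      using xmono[of "Suc (Suc i)" "Suc j"] that by (auto simp: S_def)
    then show "disjoint_family S" by (auto simp: disjoint_family_on_def) (metis Int_iff empty_iff linorder_neqE_nat)
  qed
  also have "ennreal A * emeasure ?\<nu> (\<Union>i. S i) \<le> ennreal A * emeasure ?\<nu> ({a<..<b} - E)"
  proof (intro mult_left_mono emeasure_mono)
    show "(\<Union>i. S i) \<subseteq> {a<..<b} - E" using Ssub by auto
    show "{a<..<b} - E \<in> sets ?\<nu>" using toset[of "{a<..<b} - E"] Es by auto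
  qed simp
  also have "emeasure ?\<nu> ({a<..<b} - E) = wmeas w ({a<..<b} - E)"
    using toset[of "{a<..<b} - E"] Es by (intro wmeas_density[OF isw]) auto
  finally show ?thesis .
qed

text \<open>Sums the previous estimate over the components. Adding \<open>A\<close> times the weight
  of \<open>E\<close> to both sides gives the subtraction-free form required by
  \<open>good_lambda\<close>.\<close>

lemma maj_set_weight:
  assumes f: "f \<in> Linf_c" and l: "0 < l" and kap: "0 < \<kappa>" and gam: "0 < \<gamma>"
    and C1: "0 < C1" "\<And>f l. f \<in> Linf_c \<Longrightarrow> 0 < l \<Longrightarrow>
      emeasure lebm {t \<in> space lebm. l < norm (T f t)} \<le> ennreal (C1 / l) * (\<integral>\<^sup>+t. ennreal (norm (f t)) \<partial>lebm)"
    and small: "320 * C1 * \<gamma> \<le> \<kappa>" "16 * D' * \<gamma> \<le> \<kappa>"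
    and w: "weight_cond w A"
    and E: "E = maj_set f ((1 + \<kappa>) * l) - rs_set (fq f) ((\<gamma> * l) powr q)"
  shows "ennreal A * emeasure (density lebm (\<lambda>t. ennreal (w t))) E + emeasure (density lebm (\<lambda>t. ennreal (w t))) (maj_set f l)
    \<le> ennreal A * emeasure (density lebm (\<lambda>t. ennreal (w t))) (maj_set f l)"
proof -
  let ?\<nu> = "density lebm (\<lambda>t. ennreal (w t))"
  \<comment> \<open>This measure takes the value \<open>A\<close> times the weight of
    \<open>X - E\<close> on \<open>X\<close>, so that the estimate on a component becomes a
    comparison of two measures and \<open>emeasure_Union_mono\<close> applies.\<close>
  let ?\<nu>' = "density ?\<nu> (\<lambda>t. ennreal A * indicator (- E) t)"
  have l': "0 < (1 + \<kappa>) * l" using l kap by simp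
  have isw: "is_weight w" using w by (simp add: weight_cond_def)
  interpret rl: rising_sun "indicator (level f l)" "1 / 2" by (rule rising_sun_level[OF f l])
  interpret rl': rising_sun "indicator (level f ((1 + \<kappa>) * l))" "1 / 2" by (rule rising_sun_level[OF f l'])
  interpret rq: rising_sun "fq f" "(\<gamma> * l) powr q" using gam l by (intro rising_sun_fq[OF f]) simp
  have Es: "E \<in> sets lebesgue" unfolding E maj_set_def using rl'.sets_rs_set rq.sets_rs_set by auto
  have Oneg: "maj_set f l \<subseteq> Rm" using rl.rs_set_negative by (auto simp: maj_set_def)
  have EO: "E \<subseteq> maj_set f l"
    using maj_set_antimono[of l "(1 + \<kappa>) * l" f] l kap unfolding E by (auto simp: algebra_simps)
  have Ol: "maj_set f l \<in> sets lebm" using Oneg rl.sets_rs_set by (simp add: maj_set_def sets_restrict_space_iff)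
  have El: "E \<in> sets lebm" using Es EO Oneg by (auto simp: sets_restrict_space_iff)
  have im: "(\<lambda>t. ennreal A * indicator (- E) t) \<in> borel_measurable ?\<nu>"
  proof -
    have "(\<lambda>t. indicator (- E) t :: ennreal) \<in> borel_measurable lebm"
      using Es by (intro measurable_indicator_lebm) (auto simp: Compl_in_sets_lebesgue)
    then show ?thesis by simp
  qed
  have \<nu>': "emeasure ?\<nu>' X = ennreal A * emeasure ?\<nu> (X - E)" if X: "X \<in> sets lebm" for X
  proof -
    have "emeasure ?\<nu>' X = (\<integral>\<^sup>+t. ennreal A * indicator (- E) t * indicator X t \<partial>?\<nu>)"
      by (rule emeasure_density[OF im]) (use X in simp)
    also have "\<dots> = (\<integral>\<^sup>+t. ennreal A * indicator (X - E) t \<partial>?\<nu>)"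
      by (intro nn_integral_cong) (auto simp: indicator_def)
    also have "\<dots> = ennreal A * emeasure ?\<nu> (X - E)"
      by (rule nn_integral_cmult_indicator) (use X El in auto)
    finally show ?thesis .
  qed
  have "emeasure ?\<nu> (\<Union>(components (maj_set f l))) \<le> emeasure ?\<nu>' (\<Union>(components (maj_set f l)))"
  proof (rule emeasure_Union_mono)
    have oO: "open (maj_set f l)" unfolding maj_set_def by (rule rl.open_rs_set)
    show "countable (components (maj_set f l))" by (rule countable_components_real[OF oO])
    show "disjoint (components (maj_set f l))" by (rule disjoint_components)
    fix C assume C: "C \<in> components (maj_set f l)"
    then have "open C" "C \<subseteq> Rm" using oO open_components in_components_subset Oneg by blast+
    then have Cs: "C \<in> sets lebm" by (auto simp: sets_restrict_space_iff)
    then show "C \<in> sets ?\<nu>" by simp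
    have "C \<in> components (rs_set (indicator (level f l)) (1 / 2))" using C by (simp add: maj_set_def)
    from rl.component[OF this] obtain a b where ab: "a < b" "b \<le> 0" "C = {a<..<b}" "b \<notin> rs_set (indicator (level f l)) (1 / 2)"
      by metis
    have "wmeas w {a<..<b} \<le> ennreal A * wmeas w ({a<..<b} - E)"
      using maj_set_weight_component[OF f l kap gam C1 small w E ab(1,2)] ab(4) by (simp add: maj_set_def)
    then show "emeasure ?\<nu> C \<le> emeasure ?\<nu>' C"
      using Cs El wmeas_density[OF isw, of C] wmeas_density[OF isw, of "C - E"] by (simp add: \<nu>' ab(3)[symmetric] sets.Diff)
  qed simp
  then have "emeasure ?\<nu> (maj_set f l) \<le> ennreal A * emeasure ?\<nu> (maj_set f l - E)"
    by (simp add: Union_components \<nu>'[OF Ol])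
  then have "ennreal A * emeasure ?\<nu> E + emeasure ?\<nu> (maj_set f l) \<le> ennreal A * (emeasure ?\<nu> E + emeasure ?\<nu> (maj_set f l - E))"
    by (simp add: distrib_left)
  also have "emeasure ?\<nu> E + emeasure ?\<nu> (maj_set f l - E) = emeasure ?\<nu> (maj_set f l)"
    using El Ol EO by (subst plus_emeasure) (auto simp: Un_absorb1)
  finally show ?thesis .
qed

end

section \<open>The maximal function of the sets O(l) and the estimate for a fixed
  \<open>A\<close>\<close>

context sio
begin

text \<open>A one-sided local maximal function in the sense of John and Stroemberg: averages are
  replaced by medians over the intervals that start at \<open>x\<close>. The supremum over the empty
  set is 0.\<close>

definition maj_fun :: "(real \<Rightarrow> 'x) \<Rightarrow> real \<Rightarrow> ennreal" where
  "maj_fun f x = (SUP l\<in>{l. 0 < l \<and> x \<in> maj_set f l}. ennreal l)"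

text \<open>The strict inequality for \<open>x\<close> in \<open>maj_set f l\<close> comes from
  continuity from below: \<open>level f l\<close> is the increasing union of slightly higher level
  sets, so one of these still fills more than half of the witnessing interval.\<close>

lemma maj_fun_greater:
  assumes f: "f \<in> Linf_c" and l: "0 < l"
  shows "ennreal l < maj_fun f x \<longleftrightarrow> x \<in> maj_set f l"
proof
  assume "ennreal l < maj_fun f x"
  then obtain l' where "0 < l'" "x \<in> maj_set f l'" "ennreal l < ennreal l'"
    unfolding maj_fun_def less_SUP_iff by blast
  then show "x \<in> maj_set f l" using l maj_set_antimono[of l l' f] by (auto simp: ennreal_less_iff)
next
  assume "x \<in> maj_set f l"
  then obtain y where y: "x < y" "ennreal (1 / 2 * (y - x)) < (\<integral>\<^sup>+t\<in>{x..y}. indicator (level f l) t \<partial>lebesgue)"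
    by (auto simp: maj_set_def rs_set_def)
  define e where "e n = 1 / (real n + 1)" for n :: nat
  have e: "0 < e n" for n by (simp add: e_def)
  define A where "A n = level f (l + e n) \<inter> {x..y}" for n
  have As: "A n \<in> sets lebesgue" for n unfolding A_def using level_sets[OF f] by auto
  have U: "(\<Union>n. A n) = level f l \<inter> {x..y}"
  proof (intro equalityI subsetI)
    fix t assume "t \<in> (\<Union>n. A n)"
    then obtain n where "t \<in> A n" by auto
    then show "t \<in> level f l \<inter> {x..y}" using level_antimono[of l "l + e n" f] e[of n] by (auto simp: A_def)
  next
    fix t assume t: "t \<in> level f l \<inter> {x..y}"
    then have "0 < norm (T f t) - l" by (auto simp: level_def)
    then obtain n where "inverse (real (Suc n)) < norm (T f t) - l" using reals_Archimedean by blast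
    then have "t \<in> A n" using t by (auto simp: A_def level_def e_def inverse_eq_divide add.commute)
    then show "t \<in> (\<Union>n. A n)" by auto
  qed
  have "incseq A"
  proof (rule incseq_SucI)
    fix n
    have "e (Suc n) \<le> e n" by (simp add: e_def frac_le)
    then show "A n \<subseteq> A (Suc n)" using level_antimono[of "l + e (Suc n)" "l + e n" f] by (auto simp: A_def)
  qed
  then have "(SUP n. emeasure lebesgue (A n)) = emeasure lebesgue (level f l \<inter> {x..y})"
    using SUP_emeasure_incseq[of A lebesgue] As U by auto
  also have "\<dots> = (\<integral>\<^sup>+t\<in>{x..y}. indicator (level f l) t \<partial>lebesgue)"
    using level_sets[OF f, of l] by (simp flip: indicator_inter_arith)
  finally have "ennreal (1 / 2 * (y - x)) < (SUP n. emeasure lebesgue (A n))" using y(2) by simp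
  then obtain n where "ennreal (1 / 2 * (y - x)) < emeasure lebesgue (A n)" unfolding less_SUP_iff by blast
  also have "emeasure lebesgue (A n) = (\<integral>\<^sup>+t\<in>{x..y}. indicator (level f (l + e n)) t \<partial>lebesgue)"
    using level_sets[OF f, of "l + e n"] by (simp add: A_def flip: indicator_inter_arith)
  finally have "x \<in> maj_set f (l + e n)" using y(1) unfolding maj_set_def rs_set_def by blast
  then have "ennreal (l + e n) \<le> maj_fun f x" unfolding maj_fun_def using l e[of n] by (intro SUP_upper) auto
  moreover have "ennreal l < ennreal (l + e n)" using l e[of n] by (simp add: ennreal_less_iff)
  ultimately show "ennreal l < maj_fun f x" by order
qed

text \<open>An indicator equals 1 > 1 / 2 on its set, so by \<open>AE_le_off\<close> almost every
  point of a level set lies in the corresponding \<open>maj_set\<close>. Rational levels suffice,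
  which keeps the exceptional set null.\<close>

lemma norm_T_le_maj_fun:
  assumes f: "f \<in> Linf_c"
  shows "AE t in lebm. ennreal (norm (T f t)) \<le> maj_fun f t"
proof -
  have "AE t in lebm. t \<in> level f l \<longrightarrow> t \<in> maj_set f l" if l: "0 < l" for l
  proof -
    interpret rl: rising_sun "indicator (level f l)" "1 / 2" by (rule rising_sun_level[OF f l])
    have "ennreal (1 / 2) < ennreal 1" by (subst ennreal_less_iff) auto
    then have half: "\<not> (1::ennreal) \<le> ennreal (1 / 2)" by (simp only: ennreal_1 not_le)
    show ?thesis
      unfolding AE_lebm_iff maj_set_def using rl.AE_le_off
    proof eventually_elim
      case (elim t)
      show ?case
      proof (intro impI, rule ccontr)
        assume t: "t \<in> level f l" "t \<notin> rs_set (indicator (level f l)) (1 / 2)"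
        with elim have "indicator (level f l) t \<le> ennreal (1 / 2)" by blast
        with t(1) half show False by (simp only: indicator_simps)
      qed
    qed
  qed
  then have "AE t in lebm. \<forall>l\<in>\<rat> \<inter> {0<..}. t \<in> level f l \<longrightarrow> t \<in> maj_set f l"
    by (subst AE_ball_countable) (auto intro: countable_Int1 countable_rat)
  then show ?thesis
    using AE_space
  proof eventually_elim
    case (elim t)
    show ?case
    proof (rule ccontr)
      assume "\<not> ennreal (norm (T f t)) \<le> maj_fun f t"
      then have lt: "maj_fun f t < ennreal (norm (T f t))" by simp
      then obtain n where n: "0 \<le> n" "maj_fun f t = ennreal n" by (cases "maj_fun f t") auto
      then have "n < norm (T f t)" using lt by (simp add: ennreal_less_iff)
      then obtain l where l: "l \<in> \<rat>" "n < l" "l < norm (T f t)" using Rats_dense_in_real by blast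
      then have "t \<in> maj_set f l" using elim n by (auto simp: level_def)
      moreover have "0 < l" using l n by linarith
      ultimately have "ennreal l < maj_fun f t" using maj_fun_greater[OF f] by blast
      with n l show False by (simp add: ennreal_less_iff)
    qed
  qed
qed

text \<open>If the norm exceeds \<open>l\<close> on more than half of an interval, its mean there
  exceeds \<open>l / 2\<close>. This passes the finiteness assumption on the maximal function of
  \<open>T f\<close> on to \<open>maj_fun\<close>.\<close>

lemma maj_fun_le_Mplus:
  assumes f: "f \<in> Linf_c"
  shows "maj_fun f x \<le> 2 * Mplus (\<lambda>t. norm (T f t)) x"
  unfolding maj_fun_def
proof (rule SUP_least)
  fix l assume "l \<in> {l. 0 < l \<and> x \<in> maj_set f l}"
  then have l: "0 < l" and "x \<in> maj_set f l" by auto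
  then obtain y where y: "x < y" "ennreal (1 / 2 * (y - x)) < (\<integral>\<^sup>+t\<in>{x..y}. indicator (level f l) t \<partial>lebesgue)"
    by (auto simp: maj_set_def rs_set_def)
  have "ennreal (l / 2 * (y - x)) = ennreal l * ennreal (1 / 2 * (y - x))"
    using l y(1) by (simp flip: ennreal_mult)
  also have "\<dots> < ennreal l * (\<integral>\<^sup>+t\<in>{x..y}. indicator (level f l) t \<partial>lebesgue)"
    using y(2) l by (intro ennreal_mult_strict_left_mono) auto
  also have "\<dots> = (\<integral>\<^sup>+t. ennreal l * indicator (level f l \<inter> {x..y}) t \<partial>lebesgue)"
    using level_sets[OF f, of l] by (simp add: nn_integral_cmult flip: indicator_inter_arith)
  also have "\<dots> \<le> (\<integral>\<^sup>+t\<in>{x..y}. ennreal \<bar>norm (T f t)\<bar> * indicator Rm t \<partial>lebesgue)"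
    by (intro nn_integral_mono) (auto simp: indicator_def level_def space_restrict_space intro!: ennreal_leI)
  finally have "x \<in> rs_set (\<lambda>t. ennreal \<bar>norm (T f t)\<bar> * indicator Rm t) (l / 2)"
    using y(1) unfolding rs_set_def by blast
  then have "ennreal (l / 2) < Mplus (\<lambda>t. norm (T f t)) x" using l by (subst rs_set_Mplus) auto
  then have "ennreal 2 * ennreal (l / 2) \<le> ennreal 2 * Mplus (\<lambda>t. norm (T f t)) x"
    by (intro mult_left_mono) auto
  moreover have "ennreal 2 * ennreal (l / 2) = ennreal l" using l by (subst ennreal_mult[symmetric]) auto
  ultimately show "ennreal l \<le> 2 * Mplus (\<lambda>t. norm (T f t)) x" by simp
qed

lemma fq_eq: "(\<lambda>s. ennreal \<bar>norm (f s) powr q\<bar> * indicator Rm s) = fq f"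
  by (simp add: fq_def fun_eq_iff)

text \<open>All constants are fixed before the weight: they depend on \<open>p\<close>,
  \<open>A\<close>, the weak type constant of \<open>T\<close> and \<open>D'\<close> only. Hence the
  quantifier over \<open>w\<close> stands inside.\<close>

lemma weighted_estimate_uniform:
  assumes p: "0 < p" and A: "1 \<le> A"
  shows "\<exists>C\<ge>0. \<forall>w. weight_cond w A \<longrightarrow> weighted_estimate T r p w C"
proof -
  obtain C1 where C1: "0 < C1" "\<And>f l. f \<in> Linf_c \<Longrightarrow> 0 < l \<Longrightarrow>
      emeasure lebm {t \<in> space lebm. l < norm (T f t)} \<le> ennreal (C1 / l) * (\<integral>\<^sup>+t. ennreal (norm (f t)) \<partial>lebm)"
    using weak_type by blast
  define \<theta> where "\<theta> = 1 - 1 / (2 * A)"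
  have \<theta>: "0 < \<theta>" "\<theta> < 1" using A by (auto simp: \<theta>_def field_simps)
  \<comment> \<open>The solution of \<rho> powr - p = 1 - 1 / (2 * A), as required by
    \<open>good_lambda\<close>; it exceeds 1, which makes \<kappa> positive.\<close>
  define \<rho> where "\<rho> = \<theta> powr (- (1 / p))"
  have \<rho>p: "\<rho> powr - p = 1 - 1 / (2 * A)" using p \<theta> by (simp add: \<rho>_def powr_powr \<theta>_def[symmetric])
  have \<rho>: "1 < \<rho>"
  proof -
    have "1 powr (- (1 / p)) < \<theta> powr (- (1 / p))" using \<theta> p by (intro powr_less_mono2_neg) auto
    then show ?thesis by (simp add: \<rho>_def)
  qed
  define \<kappa> where "\<kappa> = \<rho> - 1"
  have kap: "0 < \<kappa>" "\<rho> = 1 + \<kappa>" using \<rho> by (auto simp: \<kappa>_def)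
  define c where "c = 320 * C1 + 16 * D'"
  have c: "0 < c" "320 * C1 \<le> c" "16 * D' \<le> c" using C1(1) D'(2) by (auto simp: c_def)
  define \<gamma> where "\<gamma> = \<kappa> / c"
  have gam: "0 < \<gamma>" "c * \<gamma> = \<kappa>" using kap c by (auto simp: \<gamma>_def)
  have small: "320 * C1 * \<gamma> \<le> \<kappa>" "16 * D' * \<gamma> \<le> \<kappa>"
    using mult_right_mono[OF c(2), of \<gamma>] mult_right_mono[OF c(3), of \<gamma>] gam by auto
  have "weighted_estimate T r p w (2 * A * \<gamma> powr - p)" if w: "weight_cond w A" for w
    unfolding weighted_estimate_def
  proof (intro ballI impI)
    fix f :: "real \<Rightarrow> 'x" assume f: "f \<in> Linf_c" and L: "Mplus (\<lambda>t. norm (T f t)) \<in> Lpw p w"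
    let ?\<mu> = "density lebm (\<lambda>t. ennreal (w t))"
    have isw: "is_weight w" using w by (simp add: weight_cond_def)
    have wm: "(\<lambda>t. ennreal (w t)) \<in> borel_measurable lebm"
      using isw unfolding is_weight_def by (intro measurable_compose[OF _ measurable_ennreal]) blast
    interpret sigma_finite_measure ?\<mu> by (rule sigma_finite_weight[OF isw])
    interpret lc: layer_cake ?\<mu> p by unfold_locales (rule p)
    \<comment> \<open>The root makes the function homogeneous of degree 1 in \<open>f\<close>: the
      level \<gamma> * l of \<open>m\<close> is the level (\<gamma> * l) powr q of the maximal
      function, and the power \<open>p\<close> of \<open>m\<close> is its power
      \<open>p / q\<close>.\<close>
    define m where "m x = ennpow (Mplus (\<lambda>s. norm (f s) powr q) x) (1 / q)" for x
    have Osub: "maj_set f l \<subseteq> Rm" "maj_set f l \<in> sets lebm" if "0 < l" for l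
    proof -
      interpret rl: rising_sun "indicator (level f l)" "1 / 2" by (rule rising_sun_level[OF f that])
      show 1: "maj_set f l \<subseteq> Rm" unfolding maj_set_def using rl.rs_set_negative by auto
      show "maj_set f l \<in> sets lebm" using 1 rl.sets_rs_set by (simp add: maj_set_def sets_restrict_space_iff)
    qed
    have Nset: "{x \<in> space ?\<mu>. ennreal l < maj_fun f x} = maj_set f l" if "0 < l" for l
      using Osub[OF that] maj_fun_greater[OF f that] by (auto simp: space_restrict_space)
    have Nm: "maj_fun f \<in> borel_measurable lebm"
      by (rule borel_measurable_ennreal_posI) (use Nset Osub in simp)
    have m_greater: "ennreal G < m x \<longleftrightarrow> x \<in> rs_set (fq f) (G powr q)" if "0 < G" for G x
    proof -
      have "ennreal G = ennpow (ennreal (G powr q)) (1 / q)"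
        using that q(2) by (simp add: ennpow_ennreal powr_powr)
      then have "ennreal G < m x \<longleftrightarrow> ennreal (G powr q) < Mplus (\<lambda>s. norm (f s) powr q) x"
        unfolding m_def using q(2) by (simp add: ennpow_less_iff)
      also have "\<dots> \<longleftrightarrow> x \<in> rs_set (\<lambda>s. ennreal \<bar>norm (f s) powr q\<bar> * indicator Rm s) (G powr q)"
        by (rule rs_set_Mplus) simp
      finally show ?thesis by (simp only: fq_eq)
    qed
    have mm: "m \<in> borel_measurable lebm"
    proof (rule borel_measurable_ennreal_posI)
      fix G :: real assume G: "0 < G"
      interpret rq: rising_sun "fq f" "G powr q" using G by (intro rising_sun_fq[OF f]) simp
      have "{x \<in> space lebm. ennreal G < m x} = rs_set (fq f) (G powr q) \<inter> space lebm"
        using m_greater[OF G] by auto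
      then show "{x \<in> space lebm. ennreal G < m x} \<in> sets lebm"
        using Int_space_lebm[OF rq.sets_rs_set] by simp
    qed
    have Mm: "Mplus (\<lambda>t. norm (T f t)) \<in> borel_measurable lebm" using L by (simp add: Lpw_def)
    have dens: "(\<integral>\<^sup>+x. ennpow (h x) p \<partial>?\<mu>) = (\<integral>\<^sup>+x. ennpow (h x) p * ennreal (w x) \<partial>lebm)"
      if "h \<in> borel_measurable lebm" for h
      using that wm by (subst nn_integral_density) (auto simp: mult.commute)
    have mp: "ennpow (m x) p = ennpow (Mplus (\<lambda>s. norm (f s) powr q) x) (p / q)" for x
      unfolding m_def using q(2) by (simp add: ennpow_ennpow)
    have fin: "(\<integral>\<^sup>+x. ennpow (maj_fun f x) p \<partial>?\<mu>) < \<infinity>"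
    proof -
      have "(\<integral>\<^sup>+x. ennpow (maj_fun f x) p \<partial>?\<mu>) \<le> (\<integral>\<^sup>+x. ennpow (2 * Mplus (\<lambda>t. norm (T f t)) x) p \<partial>?\<mu>)"
        using p by (intro nn_integral_mono ennpow_mono maj_fun_le_Mplus[OF f]) auto
      also have "\<dots> = (\<integral>\<^sup>+x. ennpow 2 p * ennpow (Mplus (\<lambda>t. norm (T f t)) x) p \<partial>?\<mu>)"
        by (simp add: ennpow_mult[OF p])
      also have "\<dots> = ennpow 2 p * (\<integral>\<^sup>+x. ennpow (Mplus (\<lambda>t. norm (T f t)) x) p \<partial>?\<mu>)"
        using Mm by (intro nn_integral_cmult) simp
      also have "\<dots> = ennpow 2 p * (\<integral>\<^sup>+x. ennpow (Mplus (\<lambda>t. norm (T f t)) x) p * ennreal (w x) \<partial>lebm)"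
        by (simp only: dens[OF Mm])
      also have "\<dots> < \<infinity>"
        using L by (simp add: Lpw_def ennreal_mult_less_top ennpow_less_top_iff)
      finally show ?thesis .
    qed
    have gl: "ennreal A * emeasure ?\<mu> {x \<in> space ?\<mu>. ennreal (\<rho> * l) < maj_fun f x \<and> \<not> ennreal (\<gamma> * l) < m x}
      + emeasure ?\<mu> {x \<in> space ?\<mu>. ennreal l < maj_fun f x} \<le> ennreal A * emeasure ?\<mu> {x \<in> space ?\<mu>. ennreal l < maj_fun f x}"
      if l: "0 < l" for l
    proof -
      have pos: "0 < \<rho> * l" "0 < \<gamma> * l" using l \<rho> gam by auto
      have E: "{x \<in> space ?\<mu>. ennreal (\<rho> * l) < maj_fun f x \<and> \<not> ennreal (\<gamma> * l) < m x}
        = maj_set f ((1 + \<kappa>) * l) - rs_set (fq f) ((\<gamma> * l) powr q)"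
        using Nset[OF pos(1)] m_greater[OF pos(2)] kap(2) by auto
      show ?thesis unfolding Nset[OF l] by (rule maj_set_weight[OF f l kap(1) gam(1) C1 small w E])
    qed
    have "(\<integral>\<^sup>+t. ennreal (norm (T f t) powr p) * ennreal (w t) \<partial>lebm) \<le> (\<integral>\<^sup>+t. ennpow (maj_fun f t) p * ennreal (w t) \<partial>lebm)"
    proof (rule nn_integral_mono_AE, use norm_T_le_maj_fun[OF f] in eventually_elim)
      case (elim t)
      have "ennreal (norm (T f t) powr p) = ennpow (ennreal (norm (T f t))) p" by (simp add: ennpow_ennreal)
      also have "\<dots> \<le> ennpow (maj_fun f t) p" using elim p by (intro ennpow_mono) auto
      finally show ?case by (rule mult_right_mono) simp
    qed
    also have "\<dots> = (\<integral>\<^sup>+x. ennpow (maj_fun f x) p \<partial>?\<mu>)" by (rule dens[OF Nm, symmetric])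
    also have "\<dots> \<le> ennreal (2 * A * \<gamma> powr - p) * (\<integral>\<^sup>+x. ennpow (m x) p \<partial>?\<mu>)"
      using Nm mm \<rho> by (intro lc.good_lambda[where \<rho> = \<rho>] A \<rho>p gam(1) gl fin) auto
    also have "(\<integral>\<^sup>+x. ennpow (m x) p \<partial>?\<mu>) = (\<integral>\<^sup>+x. ennpow (m x) p * ennreal (w x) \<partial>lebm)" by (rule dens[OF mm])
    also have "\<dots> = (\<integral>\<^sup>+t. ennpow (Mplus (\<lambda>s. norm (f s) powr (r / (r - 1))) t) (p / (r / (r - 1))) * ennreal (w t) \<partial>lebm)"
      by (simp only: mp q_def)
    finally show "(\<integral>\<^sup>+t. ennreal (norm (T f t) powr p) * ennreal (w t) \<partial>lebm) \<le> ennreal (2 * A * \<gamma> powr - p)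
      * (\<integral>\<^sup>+t. ennpow (Mplus (\<lambda>s. norm (f s) powr (r / (r - 1))) t) (p / (r / (r - 1))) * ennreal (w t) \<partial>lebm)" .
  qed
  moreover have "0 \<le> 2 * A * \<gamma> powr - p" using A by simp
  ultimately show ?thesis by blast
qed

end

section \<open>From the weight classes to \<open>weight_cond\<close>, and conclusion\<close>

lemma Ainf_plus_weight_cond:
  assumes "w \<in> Ainf_plus"
  shows "\<exists>A\<ge>1. weight_cond w A"
proof -
  obtain C \<delta> where C: "0 < C" "0 < \<delta>" and isw: "is_weight w" and
    cond: "\<And>a b c S. a < b \<Longrightarrow> b < c \<Longrightarrow> c \<le> 0 \<Longrightarrow> S \<in> sets lebesgue \<Longrightarrow> S \<subseteq> {b..c} \<Longrightarrow>
        emeasure lebesgue S / ennreal (c - a) \<le> ennreal C * ennpow (wmeas w S / wmeas w {a<..<b}) \<delta>"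
    using assms unfolding Ainf_plus_def by blast
  \<comment> \<open>If \<open>S\<close> fills a quarter of the interval, then 1 / 4 is at most
    \<open>C\<close> times the power \<delta> of the quotient of the weights; solving for the
    quotient gives the lower bound \<open>k\<close>.\<close>
  define k where "k = (1 / (4 * C)) powr (1 / \<delta>)"
  have k: "0 < k" using C by (simp add: k_def)
  have "wmeas w {a<..<b} \<le> ennreal (max 1 (1 / k)) * wmeas w S"
    if abc: "a < b" "b < c" "c \<le> 0" "S \<in> sets lebesgue" "S \<subseteq> {b..c}" "ennreal ((c - a) / 4) \<le> emeasure lebesgue S" for a b c S
  proof -
    let ?R = "wmeas w S / wmeas w {a<..<b}"
    have "ennreal (1 / 4) = ennreal ((c - a) / 4) / ennreal (c - a)"
      using abc by (simp add: divide_ennreal)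
    also have "\<dots> \<le> emeasure lebesgue S / ennreal (c - a)" by (rule divide_right_mono_ennreal[OF abc(6)])
    also have "\<dots> \<le> ennreal C * ennpow ?R \<delta>" by (rule cond[OF abc(1-5)])
    finally have 1: "ennreal (1 / 4) \<le> ennreal C * ennpow ?R \<delta>" .
    have "ennreal (1 / (4 * C)) = ennreal (1 / C) * ennreal (1 / 4)" using C by (simp flip: ennreal_mult)
    also have "\<dots> \<le> ennreal (1 / C) * (ennreal C * ennpow ?R \<delta>)" by (rule mult_left_mono[OF 1]) simp
    also have "\<dots> = ennpow ?R \<delta>" using C by (simp add: mult.assoc[symmetric] flip: ennreal_mult)
    finally have "ennpow (ennreal (1 / (4 * C))) (1 / \<delta>) \<le> ennpow (ennpow ?R \<delta>) (1 / \<delta>)"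
      using C by (intro ennpow_mono) auto
    then have kR: "ennreal k \<le> ?R" using C by (simp add: ennpow_inverse_cancel ennpow_ennreal k_def)
    show ?thesis
    proof (cases "wmeas w {a<..<b}")
      case (real x)
      show ?thesis
      proof (cases "x = 0")
        case False
        then have x: "0 < x" using real by simp
        have "\<not> wmeas w S / ennreal x < ennreal k" using kR real(2) by (simp only: not_less)
        then have "\<not> wmeas w S < ennreal k * ennreal x"
          by (subst (asm) divide_less_ennreal) (use x in auto)
        then have "ennreal k * ennreal x \<le> wmeas w S" by (simp only: not_less)
        then have "ennreal (1 / k) * (ennreal k * ennreal x) \<le> ennreal (1 / k) * wmeas w S" by (rule mult_left_mono) simp
        moreover have "ennreal (1 / k) * (ennreal k * ennreal x) = ennreal x"
          using k by (simp add: mult.assoc[symmetric] flip: ennreal_mult)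
        moreover have "ennreal (1 / k) * wmeas w S \<le> ennreal (max 1 (1 / k)) * wmeas w S"
          by (intro mult_right_mono ennreal_leI) auto
        ultimately show ?thesis using real by (metis order_trans)
      qed (use real in simp)
    next
      \<comment> \<open>A quotient with infinite denominator is 0, which contradicts the positive
        lower bound \<open>k\<close>; so this case does not occur.\<close>
      case top
      then have "ennreal k \<le> 0" using kR by simp
      then show ?thesis using k by simp
    qed
  qed
  then have "weight_cond w (max 1 (1 / k))" using isw unfolding weight_cond_def by blast
  then show ?thesis by (intro exI[of _ "max 1 (1 / k)"]) auto
qed

text \<open>Hoelder's inequality for w powr (1 / p) and w powr (- (1 / p)) on \<open>S\<close>
  bounds the power \<open>p\<close> of the measure of \<open>S\<close> by its weight times
  \<open>V\<close>, the dual factor in \<open>Ap_const\<close>. Multiplying by the bound for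
  \<open>Ap_const\<close> and cancelling \<open>V\<close> leaves a constant that depends on
  \<open>p\<close> and \<open>N\<close> only.\<close>

lemma Ap_plus_weight_cond:
  assumes p: "1 < p" and w: "w \<in> Ap_plus p" and N: "Ap_const p w \<le> ennreal N" "0 < N"
  shows "weight_cond w (max 1 (4 powr p * N))"
proof -
  have isw: "is_weight w" using w by (simp add: Ap_plus_def)
  then have wm: "w \<in> borel_measurable lebm" and w0: "\<And>t. t \<in> Rm \<Longrightarrow> 0 \<le> w t" and wpos: "AE t in lebm. 0 < w t"
    by (auto simp: is_weight_def)
  define q where "q = p / (p - 1)"
  have q: "0 < q" "1 / p + 1 / q = 1" "1 / q * p = p - 1" using p by (auto simp: q_def field_simps)
  have "wmeas w {a<..<b} \<le> ennreal (max 1 (4 powr p * N)) * wmeas w S"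
    if abc: "a < b" "b < c" "c \<le> 0" "S \<in> sets lebesgue" "S \<subseteq> {b..c}" "ennreal ((c - a) / 4) \<le> emeasure lebesgue S" for a b c S
  proof -
    define V where "V = ennpow (\<integral>\<^sup>+t\<in>{b<..<c}. ennreal (w t powr (1 - p / (p - 1))) \<partial>lebesgue) (p - 1)"
    have "ennreal (1 / (c - a) powr p) * wmeas w {a<..<b} * V \<le> Ap_const p w"
      unfolding Ap_const_def wmeas_def V_def using abc by (intro SUP_upper2[of "(a, b, c)"]) auto
    with N(1) have ap: "ennreal (1 / (c - a) powr p) * wmeas w {a<..<b} * V \<le> ennreal N" by order
    have SR: "S \<subseteq> Rm" using abc by auto
    have Sl: "S \<in> sets lebm" using abc SR by (simp add: sets_restrict_space_iff)
    define f1 where "f1 t = w t powr (1 / p) * indicator S t" for t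
    define f2 where "f2 t = w t powr (- (1 / p)) * indicator S t" for t
    have im: "(\<lambda>t. indicator S t :: real) \<in> borel_measurable lebm" using Sl by simp
    have "emeasure lebesgue S = (\<integral>\<^sup>+t. indicator S t \<partial>lebm)"
      using Sl SR by (simp add: emeasure_restrict_space)
    also have "\<dots> = (\<integral>\<^sup>+t. ennreal (f1 t * f2 t) \<partial>lebm)"
    proof (rule nn_integral_cong_AE, use wpos in eventually_elim)
      case (elim t)
      then have "w t powr (1 / p) * w t powr (- (1 / p)) = 1" by (simp add: powr_minus)
      then show ?case by (auto simp: f1_def f2_def indicator_def)
    qed
    also have "\<dots> \<le> ennpow (\<integral>\<^sup>+t. ennreal (f1 t powr p) \<partial>lebm) (1 / p) * ennpow (\<integral>\<^sup>+t. ennreal (f2 t powr q) \<partial>lebm) (1 / q)"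
    proof (rule nn_integral_Holder[OF _ _ _ _ p q(2)])
      show "f1 \<in> borel_measurable lebm" "f2 \<in> borel_measurable lebm" unfolding f1_def f2_def
        by (intro borel_measurable_times powr_real_measurable borel_measurable_const wm im)+
    qed (auto simp: f1_def f2_def)
    also have "(\<integral>\<^sup>+t. ennreal (f1 t powr p) \<partial>lebm) = wmeas w S"
      unfolding wmeas_lebm[OF SR]
      by (intro nn_integral_cong) (use p w0 in \<open>auto simp: f1_def indicator_def powr_powr space_restrict_space\<close>)
    finally have "ennpow (emeasure lebesgue S) p \<le> ennpow (ennpow (wmeas w S) (1 / p) * ennpow (\<integral>\<^sup>+t. ennreal (f2 t powr q) \<partial>lebm) (1 / q)) p"
      using p by (intro ennpow_mono) auto
    also have "\<dots> = wmeas w S * ennpow (\<integral>\<^sup>+t. ennreal (f2 t powr q) \<partial>lebm) (p - 1)"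
    proof -
      have "0 < p" "0 < 1 / q" using p q(1) by auto
      then show ?thesis by (simp only: ennpow_mult ennpow_inverse_cancel(1) ennpow_ennpow[of "1 / q"] q(3))
    qed
    also have "\<dots> \<le> wmeas w S * V"
    proof (rule mult_left_mono)
      have "(\<integral>\<^sup>+t. ennreal (f2 t powr q) \<partial>lebm) \<le> (\<integral>\<^sup>+t\<in>{b..c}. ennreal (w t powr (1 - p / (p - 1))) \<partial>lebesgue)"
        unfolding nn_integral_lebm
      proof (rule nn_integral_mono)
        fix t
        have e: "- (1 / p) * q = 1 - p / (p - 1)" using p by (simp add: q_def field_simps)
        show "ennreal (f2 t powr q) * indicator Rm t \<le> ennreal (w t powr (1 - p / (p - 1))) * indicator {b..c} t"
          using abc(5) q(1) by (cases "t \<in> S") (auto simp: f2_def powr_powr e[symmetric] indicator_def)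
      qed
      also have "\<dots> = (\<integral>\<^sup>+t\<in>{b<..<c}. ennreal (w t powr (1 - p / (p - 1))) \<partial>lebesgue)"
        by (rule nn_integral_Icc_eq_Ioo)
      finally show "ennpow (\<integral>\<^sup>+t. ennreal (f2 t powr q) \<partial>lebm) (p - 1) \<le> V"
        unfolding V_def using p by (intro ennpow_mono) auto
    qed simp
    finally have SV: "ennpow (emeasure lebesgue S) p \<le> wmeas w S * V" .
    define d where "d = (c - a) powr p"
    have d: "0 < d" using abc by (simp add: d_def)
    have dS: "ennreal (d / 4 powr p) \<le> wmeas w S * V"
    proof -
      have "ennreal (d / 4 powr p) = ennpow (ennreal ((c - a) / 4)) p"
        using abc by (simp add: d_def ennpow_ennreal powr_divide)
      also have "\<dots> \<le> ennpow (emeasure lebesgue S) p" using abc(6) p by (intro ennpow_mono) auto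
      finally show ?thesis using SV by order
    qed
    have ap': "ennreal (1 / d) * wmeas w {a<..<b} * V \<le> ennreal N" using ap by (simp add: d_def)
    have "wmeas w {a<..<b} \<le> ennreal (4 powr p * N) * wmeas w S"
    \<comment> \<open>In these two cases the claim is trivial. In the remaining one \<open>V\<close>
      is finite by the bound on \<open>Ap_const\<close> and positive by \<open>dS\<close>, so it can
      be cancelled among real numbers.\<close>
    proof (cases "wmeas w {a<..<b} = 0 \<or> wmeas w S = top")
      case True
      then show ?thesis using N by (auto simp: ennreal_mult_top)
    next
      case False
      then have ne: "wmeas w {a<..<b} \<noteq> 0" "wmeas w S \<noteq> top" by auto
      have "V \<noteq> top"
      proof
        assume "V = top"
        moreover have "ennreal (1 / d) * wmeas w {a<..<b} \<noteq> 0" using ne d by simp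
        ultimately show False using ap' by (simp add: ennreal_mult_top top_unique)
      qed
      then obtain v where v: "0 \<le> v" "V = ennreal v" by (cases V) auto
      obtain s where s: "0 \<le> s" "wmeas w S = ennreal s" using ne by (cases "wmeas w S") auto
      have "ennreal (d / 4 powr p) \<le> ennreal (s * v)" using dS s v by (simp add: ennreal_mult)
      then have sv: "d / 4 powr p \<le> s * v" using s v by (subst (asm) ennreal_le_iff) auto
      have "0 < d / 4 powr p" using d by simp
      then have "v \<noteq> 0" using sv by auto
      then have v0: "0 < v" using v by simp
      have "wmeas w {a<..<b} \<noteq> top"
      proof
        assume "wmeas w {a<..<b} = top"
        then show False using ap' v v0 d by (simp add: ennreal_mult_top ennreal_top_mult top_unique)
      qed
      then obtain x where x: "0 \<le> x" "wmeas w {a<..<b} = ennreal x" by (cases "wmeas w {a<..<b}") auto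
      have "ennreal (1 / d * x * v) = ennreal (1 / d) * ennreal x * ennreal v"
        using d x(1) v(1) by (simp only: ennreal_mult mult_nonneg_nonneg divide_nonneg_nonneg zero_le_one less_imp_le)
      then have "ennreal (1 / d * x * v) \<le> ennreal N" using ap' by (simp only: x(2) v(2))
      then have "1 / d * x * v \<le> N" using N by (subst (asm) ennreal_le_iff) auto
      then have "x * v \<le> N * d" using d by (simp add: field_simps)
      also have "\<dots> \<le> N * (4 powr p * (s * v))"
        using sv N by (intro mult_left_mono) (auto simp: field_simps)
      finally have "x * v \<le> (4 powr p * N * s) * v" by (simp add: mult_ac)
      then have "x \<le> 4 powr p * N * s" using v0 by simp
      then show ?thesis using x s N by (simp add: ennreal_leI flip: ennreal_mult)
    qed
    also have "\<dots> \<le> ennreal (max 1 (4 powr p * N)) * wmeas w S"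
      by (intro mult_right_mono ennreal_leI) auto
    finally show ?thesis .
  qed
  then show ?thesis using isw unfolding weight_cond_def by blast
qed

theorem theorem3p1:
  fixes T :: "(real \<Rightarrow> 'x::banach) \<Rightarrow> (real \<Rightarrow> 'y::banach)"
    and K :: "real \<Rightarrow> real \<Rightarrow> ('x \<Rightarrow>\<^sub>L 'y)"
    and p0 r :: real
  assumes "1 < p0"
    and "singular_integral_operator p0 T K"
    and "\<forall>t\<in>Rm. \<forall>s\<in>Rm. \<not> t < s \<longrightarrow> K t s = 0"
    and "1 < r"
    and "D_const 1 K < \<infinity>"
    and "D'_const r K < \<infinity>"
  shows "(\<forall>p>0. \<forall>w\<in>Ainf_plus. \<exists>C\<ge>0. weighted_estimate T r p w C) \<and>
         (\<forall>p>1. \<forall>F. F \<subseteq> Ap_plus p \<and> (SUP w\<in>F. Ap_const p w) < \<infinity> \<longrightarrow>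
            (\<exists>C :: (real \<Rightarrow> real) \<Rightarrow> real.
               (\<forall>w\<in>F. 0 \<le> C w \<and> weighted_estimate T r p w (C w)) \<and> bdd_above (C ` F)))"
proof -
  interpret sio T K p0 r by unfold_locales (fact assms)+
  show ?thesis
  proof (intro conjI allI impI ballI)
    fix p :: real and w assume p: "0 < p" and w: "w \<in> Ainf_plus"
    obtain A where A: "1 \<le> A" "weight_cond w A" using Ainf_plus_weight_cond[OF w] by blast
    then show "\<exists>C\<ge>0. weighted_estimate T r p w C" using weighted_estimate_uniform[OF p A(1)] by blast
  next
    fix p :: real and F
    assume p: "1 < p" and F: "F \<subseteq> Ap_plus p \<and> (SUP w\<in>F. Ap_const p w) < \<infinity>"
    obtain n where n: "0 \<le> n" "(SUP w\<in>F. Ap_const p w) = ennreal n"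
      using F by (cases "SUP w\<in>F. Ap_const p w") auto
    \<comment> \<open>The supremum may be 0, for example for an empty family; adding 1 gives the
      positive bound that \<open>Ap_plus_weight_cond\<close> requires.\<close>
    define A where "A = max 1 (4 powr p * (n + 1))"
    have "weight_cond w A" if "w \<in> F" for w
    proof -
      have "Ap_const p w \<le> ennreal n" unfolding n(2)[symmetric] using that by (rule SUP_upper)
      also have "\<dots> \<le> ennreal (n + 1)" by (rule ennreal_leI) simp
      finally show ?thesis unfolding A_def using that F n by (intro Ap_plus_weight_cond[OF p]) auto
    qed
    moreover obtain C where "0 \<le> C" "\<And>w. weight_cond w A \<Longrightarrow> weighted_estimate T r p w C"
      using weighted_estimate_uniform[of p A] p by (auto simp: A_def)
    ultimately show "\<exists>C :: (real \<Rightarrow> real) \<Rightarrow> real.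
        (\<forall>w\<in>F. 0 \<le> C w \<and> weighted_estimate T r p w (C w)) \<and> bdd_above (C ` F)"
      by (intro exI[of _ "\<lambda>_. C"]) (auto intro!: bdd_aboveI2[of _ _ C])
  qed
qed

end
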